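(* Let $\mathcal{C}$ be an additive finitely accessible category with products and an additive closed symmetric monoidal structure such that $\mathcal{C}^{\mathrm{fp}}$ is a monoidal subcategory. Suppose $\mathcal{D}$ is an fp-hom-closed definable subcategory of $\mathcal{C}$ and equip $\mathrm{fun}(\mathcal{D})$ with its induced monoidal structure. If the monoidal structure on $\mathrm{fun}(\mathcal{D})$ is exact in each variable then $\mathcal{D}$ satisfies the exactness criterion.
   Context: All functors are additive. $\mathcal{C}$ is finitely accessible if it has direct limits and a set of finitely presented objects such that every object is a direct limit of objects in this set; $\mathcal{C}^{\mathrm{fp}}$ is the full subcategory of finitely presented objects. $\mathcal{C}^{\mathrm{fp}}\text{-}\mathrm{mod}$ is the abelian category of finitely presented additive functors $\mathcal{C}^{\mathrm{fp}}\to\mathbf{Ab}$, with monoidal structure given by (the restriction of) Day convolution, i.e. right exact in each variable with $(A,-)\otimes(B,-)\cong(A\otimes B,-)$. For $F\in\mathcal{C}^{\mathrm{fp}}\text{-}\mathrm{mod}$, $\overrightarrow{F}:\mathcal{C}\to\mathbf{Ab}$ is the unique extension commuting with direct limits. A monomorphism $m:X\to Y$ in $\mathcal{C}$ is pure if for every $f:A\to B$ in $\mathcal{C}^{\mathrm{fp}}$ and all $h:A\to X$, $h':B\to Y$ with $h'f=mh$ there is $k:B\to X$ with $kf=h$. A full subcategory $\mathcal{D}\subseteq\mathcal{C}$ is definable if closed under products, direct limits and pure subobjects; it is fp-hom-closed if $\mathrm{hom}(A,X)\in\mathcal{D}$ for all $A\in\mathcal{C}^{\mathrm{fp}}$, $X\in\mathcal{D}$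 ($\mathrm{hom}$ the internal hom of $\mathcal{C}$). Write $f\,|\,k$ if $k=k'\circ f$ for some $k'$. $\mathcal{D}$ satisfies the exactness criterion if for all $f:A\to B$, $g:U\to V$ in $\mathcal{C}^{\mathrm{fp}}$, all $X\in\mathcal{D}$ and $h:A\otimes U\to X$: if $(f\otimes U)\,|\,h$ and $(A\otimes g)\,|\,h$ then $(f\otimes g)\,|\,h$. $\mathrm{fun}(\mathcal{D})=(\mathcal{D},\mathbf{Ab})^{\to\Pi}$ is the category of additive functors $\mathcal{D}\to\mathbf{Ab}$ commuting with direct products and direct limits. Let $\mathsf{S}=\{F\in\mathcal{C}^{\mathrm{fp}}\text{-}\mathrm{mod}:\overrightarrow{F}(X)=0\ \forall X\in\mathcal{D}\}$. Then $F\mapsto\overrightarrow{F}|_{\mathcal{D}}$ induces an equivalence $\mathcal{C}^{\mathrm{fp}}\text{-}\mathrm{mod}/\mathsf{S}\simeq\mathrm{fun}(\mathcal{D})$. When $\mathcal{D}$ is fp-hom-closed, $\mathsf{S}$ is a Serre tensor-ideal and the class $\Sigma_{\mathsf{S}}$ of morphisms with kernel and cokernel in $\mathsf{S}$ is closed under tensoring with objects, so $\mathcal{C}^{\mathrm{fp}}\text{-}\mathrm{mod}/\mathsf{S}$ has an additive symmetric monoidal structure for which the localisation functor is monoidal (universal among monoidal functors inverting $\Sigma_{\mathsf{S}}$); the induced monoidal structure on $\mathrm{fun}(\mathcal{D})$ is its transport along this equivalence. *)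

theory Defs
  imports "HOL-Algebra.Group" "HOL-Library.Equipollence"
begin

section \<open>Preadditive categories, functors, natural transformations\<close>

record ('o, 'a) precat =
  Obj :: "'o set"
  Arr :: "'a set"
  Src :: "'a \<Rightarrow> 'o"
  Tgt :: "'a \<Rightarrow> 'o"
  Ident :: "'o \<Rightarrow> 'a"
  Comp :: "'a \<Rightarrow> 'a \<Rightarrow> 'a"  (infixl \<open>\<cdot>\<index>\<close> 70)
  Plus :: "'a \<Rightarrow> 'a \<Rightarrow> 'a"  (infixl \<open>\<boxplus>\<index>\<close> 65)
  Zro :: "'o \<Rightarrow> 'o \<Rightarrow> 'a"

definition hom_set :: "('o, 'a) precat \<Rightarrow> 'o \<Rightarrow> 'o \<Rightarrow> 'a set" where
  "hom_set C A B = {f \<in> Arr C. Src C f = A \<and> Tgt C f = B}"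

definition hom_group :: "('o, 'a) precat \<Rightarrow> 'o \<Rightarrow> 'o \<Rightarrow> 'a monoid" where
  "hom_group C A B = \<lparr>carrier = hom_set C A B, mult = Plus C, one = Zro C A B\<rparr>"

locale preadditive_category =
  fixes C :: "('o, 'a) precat" (structure)
  assumes src_obj: "f \<in> Arr C \<Longrightarrow> Src C f \<in> Obj C"
    and tgt_obj: "f \<in> Arr C \<Longrightarrow> Tgt C f \<in> Obj C"
    and ident_hom: "A \<in> Obj C \<Longrightarrow> Ident C A \<in> hom_set C A A"
    and comp_hom: "\<lbrakk>f \<in> hom_set C A B; g \<in> hom_set C B D\<rbrakk> \<Longrightarrow> g \<cdot> f \<in> hom_set C A D"
    and comp_ident_right: "f \<in> hom_set C A B \<Longrightarrow> f \<cdot> Ident C A = f"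
    and comp_ident_left: "f \<in> hom_set C A B \<Longrightarrow> Ident C B \<cdot> f = f"
    and comp_assoc: "\<lbrakk>f \<in> hom_set C A B; g \<in> hom_set C B D; h \<in> hom_set C D E\<rbrakk>
                      \<Longrightarrow> (h \<cdot> g) \<cdot> f = h \<cdot> (g \<cdot> f)"
    and hom_comm_group: "\<lbrakk>A \<in> Obj C; B \<in> Obj C\<rbrakk> \<Longrightarrow> comm_group (hom_group C A B)"
    and comp_plus_right: "\<lbrakk>f \<in> hom_set C A B; f' \<in> hom_set C A B; g \<in> hom_set C B D\<rbrakk>
                      \<Longrightarrow> g \<cdot> (f \<boxplus> f') = (g \<cdot> f) \<boxplus> (g \<cdot> f')"
    and comp_plus_left: "\<lbrakk>f \<in> hom_set C A B; g \<in> hom_set C B D; g' \<in> hom_set C B D\<rbrakk>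
                      \<Longrightarrow> (g \<boxplus> g') \<cdot> f = (g \<cdot> f) \<boxplus> (g' \<cdot> f)"

definition is_biproduct ::
    "('o, 'a) precat \<Rightarrow> 'o \<Rightarrow> 'o \<Rightarrow> 'o \<Rightarrow> 'a \<Rightarrow> 'a \<Rightarrow> 'a \<Rightarrow> 'a \<Rightarrow> bool" where
  "is_biproduct C A B P p q i j \<longleftrightarrow>
     P \<in> Obj C \<and> p \<in> hom_set C P A \<and> q \<in> hom_set C P B \<and> i \<in> hom_set C A P \<and> j \<in> hom_set C B P \<and>
     p \<cdot>\<^bsub>C\<^esub> i = Ident C A \<and> q \<cdot>\<^bsub>C\<^esub> j = Ident C B \<and>
     p \<cdot>\<^bsub>C\<^esub> j = Zro C B A \<and> q \<cdot>\<^bsub>C\<^esub> i = Zro C A B \<and>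
     (i \<cdot>\<^bsub>C\<^esub> p) \<boxplus>\<^bsub>C\<^esub> (j \<cdot>\<^bsub>C\<^esub> q) = Ident C P"

locale additive_category = preadditive_category +
  assumes zero_object: "\<exists>Z\<in>Obj C. Ident C Z = Zro C Z Z"
    and biproducts: "\<lbrakk>A \<in> Obj C; B \<in> Obj C\<rbrakk> \<Longrightarrow> \<exists>P p q i j. is_biproduct C A B P p q i j"

definition is_iso :: "('o, 'a) precat \<Rightarrow> 'a \<Rightarrow> bool" where
  "is_iso C f \<longleftrightarrow> f \<in> Arr C \<and>
     (\<exists>g \<in> hom_set C (Tgt C f) (Src C f).
        g \<cdot>\<^bsub>C\<^esub> f = Ident C (Src C f) \<and> f \<cdot>\<^bsub>C\<^esub> g = Ident C (Tgt C f))"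

definition inverse_arr :: "('o, 'a) precat \<Rightarrow> 'a \<Rightarrow> 'a" where
  "inverse_arr C f = (THE g. g \<in> hom_set C (Tgt C f) (Src C f) \<and>
        g \<cdot>\<^bsub>C\<^esub> f = Ident C (Src C f) \<and> f \<cdot>\<^bsub>C\<^esub> g = Ident C (Tgt C f))"

definition is_mono :: "('o, 'a) precat \<Rightarrow> 'a \<Rightarrow> bool" where
  "is_mono C m \<longleftrightarrow> m \<in> Arr C \<and>
     (\<forall>Z\<in>Obj C. \<forall>f \<in> hom_set C Z (Src C m). \<forall>g \<in> hom_set C Z (Src C m).
        m \<cdot>\<^bsub>C\<^esub> f = m \<cdot>\<^bsub>C\<^esub> g \<longrightarrow> f = g)"

definition is_kernel :: "('o, 'a) precat \<Rightarrow> 'a \<Rightarrow> 'a \<Rightarrow> bool" where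
  "is_kernel C f k \<longleftrightarrow> f \<in> Arr C \<and> k \<in> Arr C \<and> Tgt C k = Src C f \<and>
     f \<cdot>\<^bsub>C\<^esub> k = Zro C (Src C k) (Tgt C f) \<and>
     (\<forall>Z\<in>Obj C. \<forall>g \<in> hom_set C Z (Src C f). f \<cdot>\<^bsub>C\<^esub> g = Zro C Z (Tgt C f) \<longrightarrow>
        (\<exists>!u. u \<in> hom_set C Z (Src C k) \<and> k \<cdot>\<^bsub>C\<^esub> u = g))"

definition is_cokernel :: "('o, 'a) precat \<Rightarrow> 'a \<Rightarrow> 'a \<Rightarrow> bool" where
  "is_cokernel C f p \<longleftrightarrow> f \<in> Arr C \<and> p \<in> Arr C \<and> Src C p = Tgt C f \<and>
     p \<cdot>\<^bsub>C\<^esub> f = Zro C (Src C f) (Tgt C p) \<and>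
     (\<forall>Z\<in>Obj C. \<forall>g \<in> hom_set C (Tgt C f) Z. g \<cdot>\<^bsub>C\<^esub> f = Zro C (Src C f) Z \<longrightarrow>
        (\<exists>!u. u \<in> hom_set C (Tgt C p) Z \<and> u \<cdot>\<^bsub>C\<^esub> p = g))"

definition short_exact :: "('o, 'a) precat \<Rightarrow> 'a \<Rightarrow> 'a \<Rightarrow> bool" where
  "short_exact C k p \<longleftrightarrow> is_kernel C p k \<and> is_cokernel C k p"

definition full_sub :: "('o, 'a) precat \<Rightarrow> 'o set \<Rightarrow> ('o, 'a) precat" where
  "full_sub C S = C\<lparr>Obj := Obj C \<inter> S, Arr := {f \<in> Arr C. Src C f \<in> S \<and> Tgt C f \<in> S}\<rparr>"

definition op_cat :: "('o, 'a) precat \<Rightarrow> ('o, 'a) precat" where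
  "op_cat C = \<lparr>Obj = Obj C, Arr = Arr C, Src = Tgt C, Tgt = Src C, Ident = Ident C,
     Comp = (\<lambda>g f. f \<cdot>\<^bsub>C\<^esub> g), Plus = Plus C, Zro = (\<lambda>A B. Zro C B A)\<rparr>"

record ('o, 'a, 'p, 'b) func =
  FO :: "'o \<Rightarrow> 'p"
  FA :: "'a \<Rightarrow> 'b"

locale additive_functor = S: preadditive_category C + T: preadditive_category D
  for C :: "('o, 'a) precat" and D :: "('p, 'b) precat" and F :: "('o, 'a, 'p, 'b) func" +
  assumes FO_obj: "A \<in> Obj C \<Longrightarrow> FO F A \<in> Obj D"
    and FA_hom: "f \<in> hom_set C A B \<Longrightarrow> FA F f \<in> hom_set D (FO F A) (FO F B)"
    and FA_ident: "A \<in> Obj C \<Longrightarrow> FA F (Ident C A) = Ident D (FO F A)"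
    and FA_comp: "\<lbrakk>f \<in> hom_set C A B; g \<in> hom_set C B E\<rbrakk>
                    \<Longrightarrow> FA F (g \<cdot>\<^bsub>C\<^esub> f) = FA F g \<cdot>\<^bsub>D\<^esub> FA F f"
    and FA_plus: "\<lbrakk>f \<in> hom_set C A B; g \<in> hom_set C A B\<rbrakk>
                    \<Longrightarrow> FA F (f \<boxplus>\<^bsub>C\<^esub> g) = FA F f \<boxplus>\<^bsub>D\<^esub> FA F g"

definition is_equivalence ::
    "('o, 'a) precat \<Rightarrow> ('p, 'b) precat \<Rightarrow> ('o, 'a, 'p, 'b) func \<Rightarrow> bool" where
  "is_equivalence C D F \<longleftrightarrow> additive_functor C D F \<and>
     (\<forall>A\<in>Obj C. \<forall>B\<in>Obj C. bij_betw (FA F) (hom_set C A B) (hom_set D (FO F A) (FO F B))) \<and>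
     (\<forall>Y\<in>Obj D. \<exists>X\<in>Obj C. \<exists>f \<in> hom_set D (FO F X) Y. is_iso D f)"

record ('o, 'a, 'p, 'b) nat_trans =
  NSrc :: "('o, 'a, 'p, 'b) func"
  NTgt :: "('o, 'a, 'p, 'b) func"
  NMap :: "'o \<Rightarrow> 'b"

definition natural ::
    "('o, 'a) precat \<Rightarrow> ('p, 'b) precat \<Rightarrow> ('o, 'a, 'p, 'b) nat_trans \<Rightarrow> bool" where
  "natural C D \<eta> \<longleftrightarrow> NMap \<eta> \<in> extensional (Obj C) \<and>
     (\<forall>A\<in>Obj C. NMap \<eta> A \<in> hom_set D (FO (NSrc \<eta>) A) (FO (NTgt \<eta>) A)) \<and>
     (\<forall>f\<in>Arr C. NMap \<eta> (Tgt C f) \<cdot>\<^bsub>D\<^esub> FA (NSrc \<eta>) f = FA (NTgt \<eta>) f \<cdot>\<^bsub>D\<^esub> NMap \<eta> (Src C f))"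

definition functor_cat :: "('o, 'a) precat \<Rightarrow> ('p, 'b) precat
    \<Rightarrow> (('o, 'a, 'p, 'b) func, ('o, 'a, 'p, 'b) nat_trans) precat" where
  "functor_cat C D =
     \<lparr>Obj = {F. additive_functor C D F},
      Arr = {\<eta>. additive_functor C D (NSrc \<eta>) \<and> additive_functor C D (NTgt \<eta>) \<and> natural C D \<eta>},
      Src = NSrc, Tgt = NTgt,
      Ident = (\<lambda>F. \<lparr>NSrc = F, NTgt = F, NMap = \<lambda>A\<in>Obj C. Ident D (FO F A)\<rparr>),
      Comp = (\<lambda>\<theta> \<eta>. \<lparr>NSrc = NSrc \<eta>, NTgt = NTgt \<theta>, NMap = \<lambda>A\<in>Obj C. NMap \<theta> A \<cdot>\<^bsub>D\<^esub> NMap \<eta> A\<rparr>),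
      Plus = (\<lambda>\<theta> \<eta>. \<lparr>NSrc = NSrc \<theta>, NTgt = NTgt \<theta>, NMap = \<lambda>A\<in>Obj C. NMap \<theta> A \<boxplus>\<^bsub>D\<^esub> NMap \<eta> A\<rparr>),
      Zro = (\<lambda>F G. \<lparr>NSrc = F, NTgt = G, NMap = \<lambda>A\<in>Obj C. Zro D (FO F A) (FO G A)\<rparr>)\<rparr>"

definition restrict_func ::
    "('o, 'a) precat \<Rightarrow> ('o, 'a, 'p, 'b) func \<Rightarrow> ('o, 'a, 'p, 'b) func" where
  "restrict_func C F = \<lparr>FO = restrict (FO F) (Obj C), FA = restrict (FA F) (Arr C)\<rparr>"

definition restrict_nat ::
    "('o, 'a) precat \<Rightarrow> ('o, 'a, 'p, 'b) nat_trans \<Rightarrow> ('o, 'a, 'p, 'b) nat_trans" where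
  "restrict_nat C \<eta> = \<lparr>NSrc = restrict_func C (NSrc \<eta>), NTgt = restrict_func C (NTgt \<eta>),
                       NMap = restrict (NMap \<eta>) (Obj C)\<rparr>"

section \<open>Size, products and direct limits\<close>

text \<open>A type \<open>'u\<close> plays the role of the universe: a set, of whatever type, is small if it has
  smaller cardinality than \<open>'u\<close>.  Every small set is then in bijection with a small subset
  of \<open>'u\<close>, so it is enough to index products and direct limits by subsets of \<open>'u\<close>.  The condition
  \<open>universe\<close> says that the cardinality of \<open>'u\<close> is infinite, regular and a strong limit; for
  uncountable \<open>'u\<close> this means (strongly) inaccessible, i.e. \<open>'u\<close> has the cardinality of a
  Grothendieck universe.\<close>

definition small :: "'u itself \<Rightarrow> 'b set \<Rightarrow> bool" where
  "small u S \<longleftrightarrow> S \<prec> (UNIV :: 'u set)"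

definition universe :: "'u itself \<Rightarrow> bool" where
  "universe u \<longleftrightarrow> infinite (UNIV :: 'u set) \<and>
     (\<forall>S :: 'u set. small u S \<longrightarrow> small u (Pow S)) \<and>
     (\<forall>(I :: 'u set) (S :: 'u \<Rightarrow> 'u set).
        small u I \<and> (\<forall>i\<in>I. small u (S i)) \<longrightarrow> small u (\<Union>i\<in>I. S i))"

definition is_product ::
    "('o, 'a) precat \<Rightarrow> 'i set \<Rightarrow> ('i \<Rightarrow> 'o) \<Rightarrow> 'o \<Rightarrow> ('i \<Rightarrow> 'a) \<Rightarrow> bool" where
  "is_product C I X P \<pi> \<longleftrightarrow> P \<in> Obj C \<and> (\<forall>i\<in>I. X i \<in> Obj C \<and> \<pi> i \<in> hom_set C P (X i)) \<and>
     (\<forall>Z\<in>Obj C. \<forall>f. (\<forall>i\<in>I. f i \<in> hom_set C Z (X i)) \<longrightarrow>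
        (\<exists>!u. u \<in> hom_set C Z P \<and> (\<forall>i\<in>I. \<pi> i \<cdot>\<^bsub>C\<^esub> u = f i)))"

definition directed_system ::
    "('o, 'a) precat \<Rightarrow> 'i set \<Rightarrow> 'i rel \<Rightarrow> ('i \<Rightarrow> 'o) \<Rightarrow> ('i \<Rightarrow> 'i \<Rightarrow> 'a) \<Rightarrow> bool" where
  "directed_system C I r X \<phi> \<longleftrightarrow>
     preorder_on I r \<and> I \<noteq> {} \<and> (\<forall>i\<in>I. \<forall>j\<in>I. \<exists>k\<in>I. (i, k) \<in> r \<and> (j, k) \<in> r) \<and>
     (\<forall>i\<in>I. X i \<in> Obj C \<and> \<phi> i i = Ident C (X i)) \<and>
     (\<forall>i j. (i, j) \<in> r \<longrightarrow> \<phi> i j \<in> hom_set C (X i) (X j)) \<and>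
     (\<forall>i j k. (i, j) \<in> r \<longrightarrow> (j, k) \<in> r \<longrightarrow> \<phi> j k \<cdot>\<^bsub>C\<^esub> \<phi> i j = \<phi> i k)"

definition is_cocone :: "('o, 'a) precat \<Rightarrow> 'i set \<Rightarrow> 'i rel \<Rightarrow> ('i \<Rightarrow> 'o) \<Rightarrow> ('i \<Rightarrow> 'i \<Rightarrow> 'a)
    \<Rightarrow> 'o \<Rightarrow> ('i \<Rightarrow> 'a) \<Rightarrow> bool" where
  "is_cocone C I r X \<phi> L c \<longleftrightarrow> L \<in> Obj C \<and> (\<forall>i\<in>I. c i \<in> hom_set C (X i) L) \<and>
     (\<forall>i j. (i, j) \<in> r \<longrightarrow> c j \<cdot>\<^bsub>C\<^esub> \<phi> i j = c i)"

definition is_direct_limit :: "('o, 'a) precat \<Rightarrow> 'i set \<Rightarrow> 'i rel \<Rightarrow> ('i \<Rightarrow> 'o) \<Rightarrow> ('i \<Rightarrow> 'i \<Rightarrow> 'a)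
    \<Rightarrow> 'o \<Rightarrow> ('i \<Rightarrow> 'a) \<Rightarrow> bool" where
  "is_direct_limit C I r X \<phi> L c \<longleftrightarrow> directed_system C I r X \<phi> \<and> is_cocone C I r X \<phi> L c \<and>
     (\<forall>Z d. is_cocone C I r X \<phi> Z d \<longrightarrow>
        (\<exists>!u. u \<in> hom_set C L Z \<and> (\<forall>i\<in>I. u \<cdot>\<^bsub>C\<^esub> c i = d i)))"

text \<open>In the following definitions the arrows of the category have the universe \<open>'u\<close> as their type,
  and index sets are small subsets of \<open>'u\<close>.\<close>

definition has_products :: "('o, 'u) precat \<Rightarrow> bool" where
  "has_products C \<longleftrightarrow> (\<forall>(I :: 'u set) X. small TYPE('u) I \<and> (\<forall>i\<in>I. X i \<in> Obj C) \<longrightarrow>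
     (\<exists>P \<pi>. is_product C I X P \<pi>))"

definition has_direct_limits :: "('o, 'u) precat \<Rightarrow> bool" where
  "has_direct_limits C \<longleftrightarrow>
     (\<forall>(I :: 'u set) r X \<phi>. small TYPE('u) I \<and> directed_system C I r X \<phi> \<longrightarrow>
        (\<exists>L c. is_direct_limit C I r X \<phi> L c))"

definition preserves_products ::
    "('o, 'u) precat \<Rightarrow> ('p, 'b) precat \<Rightarrow> ('o, 'u, 'p, 'b) func \<Rightarrow> bool" where
  "preserves_products C D F \<longleftrightarrow>
     (\<forall>(I :: 'u set) X P \<pi>. small TYPE('u) I \<and> is_product C I X P \<pi> \<longrightarrow>
        is_product D I (\<lambda>i. FO F (X i)) (FO F P) (\<lambda>i. FA F (\<pi> i)))"

definition preserves_direct_limits ::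
    "('o, 'u) precat \<Rightarrow> ('p, 'b) precat \<Rightarrow> ('o, 'u, 'p, 'b) func \<Rightarrow> bool" where
  "preserves_direct_limits C D F \<longleftrightarrow>
     (\<forall>(I :: 'u set) r X \<phi> L c. small TYPE('u) I \<and> is_direct_limit C I r X \<phi> L c \<longrightarrow>
        is_direct_limit D I r (\<lambda>i. FO F (X i)) (\<lambda>i j. FA F (\<phi> i j)) (FO F L) (\<lambda>i. FA F (c i)))"

section \<open>The category of small abelian groups\<close>

datatype 'u gmap = GMap (gsrc: "'u monoid") (gtgt: "'u monoid") (gfun: "'u \<Rightarrow> 'u")

definition Ab :: "('u monoid, 'u gmap) precat" where
  "Ab = \<lparr>Obj = {G. comm_group G \<and> small TYPE('u) (carrier G)},
     Arr = {m. comm_group (gsrc m) \<and> small TYPE('u) (carrier (gsrc m)) \<and>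
               comm_group (gtgt m) \<and> small TYPE('u) (carrier (gtgt m)) \<and>
               gfun m \<in> hom (gsrc m) (gtgt m) \<and> gfun m \<in> extensional (carrier (gsrc m))},
     Src = gsrc, Tgt = gtgt,
     Ident = (\<lambda>G. GMap G G (\<lambda>x\<in>carrier G. x)),
     Comp = (\<lambda>n m. GMap (gsrc m) (gtgt n) (compose (carrier (gsrc m)) (gfun n) (gfun m))),
     Plus = (\<lambda>m n. GMap (gsrc m) (gtgt m)
                     (\<lambda>x\<in>carrier (gsrc m). gfun m x \<otimes>\<^bsub>gtgt m\<^esub> gfun n x)),
     Zro = (\<lambda>G H. GMap G H (\<lambda>x\<in>carrier G. \<one>\<^bsub>H\<^esub>))\<rparr>"

type_synonym ('o, 'u) abfunc = "('o, 'u, 'u monoid, 'u gmap) func"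
type_synonym ('o, 'u) abnat = "('o, 'u, 'u monoid, 'u gmap) nat_trans"

section \<open>Finitely accessible categories\<close>

definition locally_small :: "('o, 'u) precat \<Rightarrow> bool" where
  "locally_small C \<longleftrightarrow> (\<forall>A\<in>Obj C. \<forall>B\<in>Obj C. small TYPE('u) (hom_set C A B))"

definition hom_functor :: "('o, 'u) precat \<Rightarrow> 'o \<Rightarrow> ('o, 'u) abfunc" where
  "hom_functor C A =
     \<lparr>FO = (\<lambda>X. hom_group C A X),
      FA = (\<lambda>f. GMap (hom_group C A (Src C f)) (hom_group C A (Tgt C f))
                     (\<lambda>h\<in>hom_set C A (Src C f). f \<cdot>\<^bsub>C\<^esub> h))\<rparr>"

text \<open>The contravariant Yoneda functor \<open>A \<mapsto> (A, -)\<close>; its source is \<open>op_cat C\<close>.\<close>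

definition yoneda :: "('o, 'u) precat \<Rightarrow> ('o, 'u, ('o, 'u) abfunc, ('o, 'u) abnat) func" where
  "yoneda C =
     \<lparr>FO = hom_functor C,
      FA = (\<lambda>f. \<lparr>NSrc = hom_functor C (Tgt C f), NTgt = hom_functor C (Src C f),
                 NMap = (\<lambda>X\<in>Obj C. GMap (hom_group C (Tgt C f) X) (hom_group C (Src C f) X)
                                     (\<lambda>h\<in>hom_set C (Tgt C f) X. h \<cdot>\<^bsub>C\<^esub> f))\<rparr>)\<rparr>"

definition fp_objects :: "('o, 'u) precat \<Rightarrow> 'o set" where
  "fp_objects C = {A \<in> Obj C. preserves_direct_limits C Ab (hom_functor C A)}"

abbreviation fp_cat :: "('o, 'u) precat \<Rightarrow> ('o, 'u) precat" where
  "fp_cat C \<equiv> full_sub C (fp_objects C)"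

definition finitely_accessible :: "('o, 'u) precat \<Rightarrow> bool" where
  "finitely_accessible C \<longleftrightarrow> has_direct_limits C \<and>
     (\<exists>G \<subseteq> fp_objects C. small TYPE('u) G \<and>
        (\<forall>X\<in>Obj C. \<exists>(I :: 'u set) r Y \<phi> c. small TYPE('u) I \<and>
            is_direct_limit C I r Y \<phi> X c \<and> (\<forall>i\<in>I. Y i \<in> G)))"

section \<open>Monoidal categories and monoidal functors\<close>

record ('o, 'a) tensor =
  TO :: "'o \<Rightarrow> 'o \<Rightarrow> 'o"  (infixr \<open>\<odot>\<index>\<close> 75)
  TA :: "'a \<Rightarrow> 'a \<Rightarrow> 'a"  (infixr \<open>\<boxtimes>\<index>\<close> 75)
  Unit :: "'o"
  Assoc :: "'o \<Rightarrow> 'o \<Rightarrow> 'o \<Rightarrow> 'a"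
  LUnit :: "'o \<Rightarrow> 'a"
  RUnit :: "'o \<Rightarrow> 'a"
  Braid :: "'o \<Rightarrow> 'o \<Rightarrow> 'a"

locale additive_symmetric_monoidal_category = preadditive_category C
  for C :: "('o, 'a) precat" (structure) and M :: "('o, 'a) tensor" (structure) +
  assumes unit_obj: "Unit M \<in> Obj C"
    and tensor_obj: "\<lbrakk>A \<in> Obj C; B \<in> Obj C\<rbrakk> \<Longrightarrow> A \<odot>\<^bsub>M\<^esub> B \<in> Obj C"
    and tensor_hom: "\<lbrakk>f \<in> hom_set C A A'; g \<in> hom_set C B B'\<rbrakk>
          \<Longrightarrow> f \<boxtimes>\<^bsub>M\<^esub> g \<in> hom_set C (A \<odot>\<^bsub>M\<^esub> B) (A' \<odot>\<^bsub>M\<^esub> B')"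
    and tensor_ident: "\<lbrakk>A \<in> Obj C; B \<in> Obj C\<rbrakk>
          \<Longrightarrow> Ident C A \<boxtimes>\<^bsub>M\<^esub> Ident C B = Ident C (A \<odot>\<^bsub>M\<^esub> B)"
    and tensor_comp: "\<lbrakk>f \<in> hom_set C A A'; f' \<in> hom_set C A' A'';
                       g \<in> hom_set C B B'; g' \<in> hom_set C B' B''\<rbrakk>
          \<Longrightarrow> (f' \<cdot>\<^bsub>C\<^esub> f) \<boxtimes>\<^bsub>M\<^esub> (g' \<cdot>\<^bsub>C\<^esub> g) = (f' \<boxtimes>\<^bsub>M\<^esub> g') \<cdot>\<^bsub>C\<^esub> (f \<boxtimes>\<^bsub>M\<^esub> g)"
    and tensor_plus_left: "\<lbrakk>f \<in> hom_set C A A'; f' \<in> hom_set C A A'; g \<in> hom_set C B B'\<rbrakk>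
          \<Longrightarrow> (f \<boxplus>\<^bsub>C\<^esub> f') \<boxtimes>\<^bsub>M\<^esub> g = (f \<boxtimes>\<^bsub>M\<^esub> g) \<boxplus>\<^bsub>C\<^esub> (f' \<boxtimes>\<^bsub>M\<^esub> g)"
    and tensor_plus_right: "\<lbrakk>f \<in> hom_set C A A'; g \<in> hom_set C B B'; g' \<in> hom_set C B B'\<rbrakk>
          \<Longrightarrow> f \<boxtimes>\<^bsub>M\<^esub> (g \<boxplus>\<^bsub>C\<^esub> g') = (f \<boxtimes>\<^bsub>M\<^esub> g) \<boxplus>\<^bsub>C\<^esub> (f \<boxtimes>\<^bsub>M\<^esub> g')"
    and assoc_iso: "\<lbrakk>A \<in> Obj C; B \<in> Obj C; D \<in> Obj C\<rbrakk>
          \<Longrightarrow> Assoc M A B D \<in> hom_set C ((A \<odot>\<^bsub>M\<^esub> B) \<odot>\<^bsub>M\<^esub> D) (A \<odot>\<^bsub>M\<^esub> (B \<odot>\<^bsub>M\<^esub> D)) \<and>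
              is_iso C (Assoc M A B D)"
    and assoc_natural: "\<lbrakk>f \<in> hom_set C A A'; g \<in> hom_set C B B'; h \<in> hom_set C D D'\<rbrakk>
          \<Longrightarrow> Assoc M A' B' D' \<cdot>\<^bsub>C\<^esub> ((f \<boxtimes>\<^bsub>M\<^esub> g) \<boxtimes>\<^bsub>M\<^esub> h) = (f \<boxtimes>\<^bsub>M\<^esub> (g \<boxtimes>\<^bsub>M\<^esub> h)) \<cdot>\<^bsub>C\<^esub> Assoc M A B D"
    and lunit_iso: "A \<in> Obj C \<Longrightarrow> LUnit M A \<in> hom_set C (Unit M \<odot>\<^bsub>M\<^esub> A) A \<and> is_iso C (LUnit M A)"
    and lunit_natural: "f \<in> hom_set C A A'
          \<Longrightarrow> LUnit M A' \<cdot>\<^bsub>C\<^esub> (Ident C (Unit M) \<boxtimes>\<^bsub>M\<^esub> f) = f \<cdot>\<^bsub>C\<^esub> LUnit M A"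
    and runit_iso: "A \<in> Obj C \<Longrightarrow> RUnit M A \<in> hom_set C (A \<odot>\<^bsub>M\<^esub> Unit M) A \<and> is_iso C (RUnit M A)"
    and runit_natural: "f \<in> hom_set C A A'
          \<Longrightarrow> RUnit M A' \<cdot>\<^bsub>C\<^esub> (f \<boxtimes>\<^bsub>M\<^esub> Ident C (Unit M)) = f \<cdot>\<^bsub>C\<^esub> RUnit M A"
    and braid_hom: "\<lbrakk>A \<in> Obj C; B \<in> Obj C\<rbrakk>
          \<Longrightarrow> Braid M A B \<in> hom_set C (A \<odot>\<^bsub>M\<^esub> B) (B \<odot>\<^bsub>M\<^esub> A)"
    and braid_natural: "\<lbrakk>f \<in> hom_set C A A'; g \<in> hom_set C B B'\<rbrakk>
          \<Longrightarrow> Braid M A' B' \<cdot>\<^bsub>C\<^esub> (f \<boxtimes>\<^bsub>M\<^esub> g) = (g \<boxtimes>\<^bsub>M\<^esub> f) \<cdot>\<^bsub>C\<^esub> Braid M A B"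
    and braid_braid: "\<lbrakk>A \<in> Obj C; B \<in> Obj C\<rbrakk>
          \<Longrightarrow> Braid M B A \<cdot>\<^bsub>C\<^esub> Braid M A B = Ident C (A \<odot>\<^bsub>M\<^esub> B)"
    and pentagon: "\<lbrakk>A \<in> Obj C; B \<in> Obj C; D \<in> Obj C; E \<in> Obj C\<rbrakk>
          \<Longrightarrow> Assoc M A B (D \<odot>\<^bsub>M\<^esub> E) \<cdot>\<^bsub>C\<^esub> Assoc M (A \<odot>\<^bsub>M\<^esub> B) D E =
              (Ident C A \<boxtimes>\<^bsub>M\<^esub> Assoc M B D E) \<cdot>\<^bsub>C\<^esub>
                (Assoc M A (B \<odot>\<^bsub>M\<^esub> D) E \<cdot>\<^bsub>C\<^esub> (Assoc M A B D \<boxtimes>\<^bsub>M\<^esub> Ident C E))"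
    and triangle: "\<lbrakk>A \<in> Obj C; B \<in> Obj C\<rbrakk>
          \<Longrightarrow> (Ident C A \<boxtimes>\<^bsub>M\<^esub> LUnit M B) \<cdot>\<^bsub>C\<^esub> Assoc M A (Unit M) B = RUnit M A \<boxtimes>\<^bsub>M\<^esub> Ident C B"
    and hexagon: "\<lbrakk>A \<in> Obj C; B \<in> Obj C; D \<in> Obj C\<rbrakk>
          \<Longrightarrow> Assoc M B D A \<cdot>\<^bsub>C\<^esub> (Braid M A (B \<odot>\<^bsub>M\<^esub> D) \<cdot>\<^bsub>C\<^esub> Assoc M A B D) =
              (Ident C B \<boxtimes>\<^bsub>M\<^esub> Braid M A D) \<cdot>\<^bsub>C\<^esub>
                (Assoc M B A D \<cdot>\<^bsub>C\<^esub> (Braid M A B \<boxtimes>\<^bsub>M\<^esub> Ident C D))"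

definition op_tensor :: "('o, 'a) precat \<Rightarrow> ('o, 'a) tensor \<Rightarrow> ('o, 'a) tensor" where
  "op_tensor C M = \<lparr>TO = TO M, TA = TA M, Unit = Unit M,
     Assoc = (\<lambda>A B D. inverse_arr C (Assoc M A B D)),
     LUnit = (\<lambda>A. inverse_arr C (LUnit M A)),
     RUnit = (\<lambda>A. inverse_arr C (RUnit M A)),
     Braid = (\<lambda>A B. inverse_arr C (Braid M A B))\<rparr>"

definition is_internal_hom ::
    "('o, 'a) precat \<Rightarrow> ('o, 'a) tensor \<Rightarrow> 'o \<Rightarrow> 'o \<Rightarrow> 'o \<Rightarrow> 'a \<Rightarrow> bool" where
  "is_internal_hom C M A X H ev \<longleftrightarrow> H \<in> Obj C \<and> ev \<in> hom_set C (H \<odot>\<^bsub>M\<^esub> A) X \<and>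
     (\<forall>Z\<in>Obj C. \<forall>f \<in> hom_set C (Z \<odot>\<^bsub>M\<^esub> A) X.
        \<exists>!g. g \<in> hom_set C Z H \<and> ev \<cdot>\<^bsub>C\<^esub> (g \<boxtimes>\<^bsub>M\<^esub> Ident C A) = f)"

definition closed_monoidal :: "('o, 'a) precat \<Rightarrow> ('o, 'a) tensor \<Rightarrow> bool" where
  "closed_monoidal C M \<longleftrightarrow> (\<forall>A\<in>Obj C. \<forall>X\<in>Obj C. \<exists>H ev. is_internal_hom C M A X H ev)"

definition monoidal_subcategory :: "('o, 'a) precat \<Rightarrow> ('o, 'a) tensor \<Rightarrow> 'o set \<Rightarrow> bool" where
  "monoidal_subcategory C M S \<longleftrightarrow> S \<subseteq> Obj C \<and> Unit M \<in> S \<and> (\<forall>A\<in>S. \<forall>B\<in>S. A \<odot>\<^bsub>M\<^esub> B \<in> S)"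

text \<open>Strong symmetric monoidal functors; \<open>\<phi> A B : F A \<otimes> F B \<rightarrow> F (A \<otimes> B)\<close> and \<open>\<epsilon> : 1 \<rightarrow> F 1\<close>.\<close>

locale monoidal_functor = additive_functor C D F
  for C :: "('o, 'a) precat" and M :: "('o, 'a) tensor"
    and D :: "('p, 'b) precat" and N :: "('p, 'b) tensor"
    and F :: "('o, 'a, 'p, 'b) func" and \<phi> :: "'o \<Rightarrow> 'o \<Rightarrow> 'b" and \<epsilon> :: 'b +
  assumes mult_iso: "\<lbrakk>A \<in> Obj C; B \<in> Obj C\<rbrakk>
          \<Longrightarrow> \<phi> A B \<in> hom_set D (FO F A \<odot>\<^bsub>N\<^esub> FO F B) (FO F (A \<odot>\<^bsub>M\<^esub> B)) \<and> is_iso D (\<phi> A B)"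
    and mult_natural: "\<lbrakk>f \<in> hom_set C A A'; g \<in> hom_set C B B'\<rbrakk>
          \<Longrightarrow> \<phi> A' B' \<cdot>\<^bsub>D\<^esub> (FA F f \<boxtimes>\<^bsub>N\<^esub> FA F g) = FA F (f \<boxtimes>\<^bsub>M\<^esub> g) \<cdot>\<^bsub>D\<^esub> \<phi> A B"
    and unit_iso: "\<epsilon> \<in> hom_set D (Unit N) (FO F (Unit M)) \<and> is_iso D \<epsilon>"
    and mult_assoc: "\<lbrakk>A \<in> Obj C; B \<in> Obj C; E \<in> Obj C\<rbrakk>
          \<Longrightarrow> FA F (Assoc M A B E) \<cdot>\<^bsub>D\<^esub> (\<phi> (A \<odot>\<^bsub>M\<^esub> B) E \<cdot>\<^bsub>D\<^esub> (\<phi> A B \<boxtimes>\<^bsub>N\<^esub> Ident D (FO F E))) =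
              \<phi> A (B \<odot>\<^bsub>M\<^esub> E) \<cdot>\<^bsub>D\<^esub> ((Ident D (FO F A) \<boxtimes>\<^bsub>N\<^esub> \<phi> B E) \<cdot>\<^bsub>D\<^esub>
                 Assoc N (FO F A) (FO F B) (FO F E))"
    and mult_lunit: "A \<in> Obj C
          \<Longrightarrow> FA F (LUnit M A) \<cdot>\<^bsub>D\<^esub> (\<phi> (Unit M) A \<cdot>\<^bsub>D\<^esub> (\<epsilon> \<boxtimes>\<^bsub>N\<^esub> Ident D (FO F A))) = LUnit N (FO F A)"
    and mult_runit: "A \<in> Obj C
          \<Longrightarrow> FA F (RUnit M A) \<cdot>\<^bsub>D\<^esub> (\<phi> A (Unit M) \<cdot>\<^bsub>D\<^esub> (Ident D (FO F A) \<boxtimes>\<^bsub>N\<^esub> \<epsilon>)) = RUnit N (FO F A)"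
    and mult_braid: "\<lbrakk>A \<in> Obj C; B \<in> Obj C\<rbrakk>
          \<Longrightarrow> FA F (Braid M A B) \<cdot>\<^bsub>D\<^esub> \<phi> A B = \<phi> B A \<cdot>\<^bsub>D\<^esub> Braid N (FO F A) (FO F B)"

definition exact_in_each_variable :: "('o, 'a) precat \<Rightarrow> ('o, 'a) tensor \<Rightarrow> bool" where
  "exact_in_each_variable C M \<longleftrightarrow> (\<forall>A\<in>Obj C. \<forall>k p. short_exact C k p \<longrightarrow>
     short_exact C (Ident C A \<boxtimes>\<^bsub>M\<^esub> k) (Ident C A \<boxtimes>\<^bsub>M\<^esub> p) \<and>
     short_exact C (k \<boxtimes>\<^bsub>M\<^esub> Ident C A) (p \<boxtimes>\<^bsub>M\<^esub> Ident C A))"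

definition right_exact_in_each_variable :: "('o, 'a) precat \<Rightarrow> ('o, 'a) tensor \<Rightarrow> bool" where
  "right_exact_in_each_variable C M \<longleftrightarrow> (\<forall>A\<in>Obj C. \<forall>f p. is_cokernel C f p \<longrightarrow>
     is_cokernel C (Ident C A \<boxtimes>\<^bsub>M\<^esub> f) (Ident C A \<boxtimes>\<^bsub>M\<^esub> p) \<and>
     is_cokernel C (f \<boxtimes>\<^bsub>M\<^esub> Ident C A) (p \<boxtimes>\<^bsub>M\<^esub> Ident C A))"

section \<open>Finitely presented functors and Day convolution\<close>

definition fp_mod :: "('o, 'u) precat \<Rightarrow> (('o, 'u) abfunc, ('o, 'u) abnat) precat" where
  "fp_mod C = full_sub (functor_cat (fp_cat C) Ab)
     {F. \<exists>f \<in> Arr (fp_cat C). \<exists>p. is_cokernel (functor_cat (fp_cat C) Ab) (FA (yoneda (fp_cat C)) f) p \<and>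
           NTgt p = F}"

text \<open>Day convolution on finitely presented functors is the (essentially unique) right exact
  symmetric monoidal structure for which the Yoneda embedding is strong symmetric monoidal.\<close>

definition is_day_convolution :: "('o, 'u) precat \<Rightarrow> ('o, 'u) tensor
    \<Rightarrow> (('o, 'u) abfunc, ('o, 'u) abnat) tensor \<Rightarrow> bool" where
  "is_day_convolution C M N \<longleftrightarrow>
     additive_symmetric_monoidal_category (fp_mod C) N \<and>
     right_exact_in_each_variable (fp_mod C) N \<and>
     (\<exists>\<phi> \<epsilon>. monoidal_functor (op_cat (fp_cat C)) (op_tensor (fp_cat C) M) (fp_mod C) N
               (yoneda (fp_cat C)) \<phi> \<epsilon>)"

text \<open>The extension of \<open>F\<close> from finitely presented objects to all of \<open>C\<close> commuting with direct
  limits (unique up to unique isomorphism), and its action on natural transformations.\<close>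

definition is_extension :: "('o, 'u) precat \<Rightarrow> ('o, 'u) abfunc \<Rightarrow> ('o, 'u) abfunc \<Rightarrow> bool" where
  "is_extension C F E \<longleftrightarrow> additive_functor C Ab E \<and> preserves_direct_limits C Ab E \<and>
     (\<forall>A\<in>Obj (fp_cat C). FO E A = FO F A) \<and> (\<forall>f\<in>Arr (fp_cat C). FA E f = FA F f)"

definition extend :: "('o, 'u) precat \<Rightarrow> ('o, 'u) abfunc \<Rightarrow> ('o, 'u) abfunc" where
  "extend C F = (SOME E. is_extension C F E)"

definition extend_nat :: "('o, 'u) precat \<Rightarrow> ('o, 'u) abnat \<Rightarrow> ('o, 'u) abnat" where
  "extend_nat C \<alpha> = (THE \<eta>.
     \<eta> \<in> hom_set (functor_cat C Ab) (extend C (NSrc \<alpha>)) (extend C (NTgt \<alpha>)) \<and>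
     (\<forall>A\<in>Obj (fp_cat C). NMap \<eta> A = NMap \<alpha> A))"

section \<open>Definable subcategories\<close>

definition is_pure_mono :: "('o, 'u) precat \<Rightarrow> 'u \<Rightarrow> bool" where
  "is_pure_mono C m \<longleftrightarrow> is_mono C m \<and>
     (\<forall>f \<in> Arr (fp_cat C). \<forall>h \<in> hom_set C (Src C f) (Src C m). \<forall>h' \<in> hom_set C (Tgt C f) (Tgt C m).
        h' \<cdot>\<^bsub>C\<^esub> f = m \<cdot>\<^bsub>C\<^esub> h \<longrightarrow> (\<exists>k \<in> hom_set C (Tgt C f) (Src C m). k \<cdot>\<^bsub>C\<^esub> f = h))"

definition definable_subcategory :: "('o, 'u) precat \<Rightarrow> 'o set \<Rightarrow> bool" where
  "definable_subcategory C D \<longleftrightarrow> D \<subseteq> Obj C \<and>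
     (\<forall>(I :: 'u set) X P \<pi>. small TYPE('u) I \<and> is_product C I X P \<pi> \<and> (\<forall>i\<in>I. X i \<in> D) \<longrightarrow> P \<in> D) \<and>
     (\<forall>(I :: 'u set) r X \<phi> L c. small TYPE('u) I \<and> is_direct_limit C I r X \<phi> L c \<and> (\<forall>i\<in>I. X i \<in> D)
        \<longrightarrow> L \<in> D) \<and>
     (\<forall>m. is_pure_mono C m \<and> Tgt C m \<in> D \<longrightarrow> Src C m \<in> D)"

definition fp_hom_closed :: "('o, 'u) precat \<Rightarrow> ('o, 'u) tensor \<Rightarrow> 'o set \<Rightarrow> bool" where
  "fp_hom_closed C M D \<longleftrightarrow>
     (\<forall>A\<in>fp_objects C. \<forall>X\<in>D. \<forall>H ev. is_internal_hom C M A X H ev \<longrightarrow> H \<in> D)"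

definition divides :: "('o, 'a) precat \<Rightarrow> 'a \<Rightarrow> 'a \<Rightarrow> bool" where
  "divides C f k \<longleftrightarrow> (\<exists>k' \<in> hom_set C (Tgt C f) (Tgt C k). k = k' \<cdot>\<^bsub>C\<^esub> f)"

definition exactness_criterion :: "('o, 'u) precat \<Rightarrow> ('o, 'u) tensor \<Rightarrow> 'o set \<Rightarrow> bool" where
  "exactness_criterion C M D \<longleftrightarrow>
     (\<forall>A\<in>fp_objects C. \<forall>B\<in>fp_objects C. \<forall>U\<in>fp_objects C. \<forall>V\<in>fp_objects C.
      \<forall>f \<in> hom_set C A B. \<forall>g \<in> hom_set C U V. \<forall>X\<in>D. \<forall>h \<in> hom_set C (A \<odot>\<^bsub>M\<^esub> U) X.
        divides C (f \<boxtimes>\<^bsub>M\<^esub> Ident C U) h \<and> divides C (Ident C A \<boxtimes>\<^bsub>M\<^esub> g) h \<longrightarrow>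
        divides C (f \<boxtimes>\<^bsub>M\<^esub> g) h)"

definition fun_cat :: "('o, 'u) precat \<Rightarrow> 'o set \<Rightarrow> (('o, 'u) abfunc, ('o, 'u) abnat) precat" where
  "fun_cat C D = full_sub (functor_cat (full_sub C D) Ab)
     {F. preserves_products (full_sub C D) Ab F \<and> preserves_direct_limits (full_sub C D) Ab F}"

text \<open>The functor sending \<open>F\<close> to the restriction to \<open>D\<close> of its extension.\<close>

definition evaluation :: "('o, 'u) precat \<Rightarrow> 'o set
    \<Rightarrow> (('o, 'u) abfunc, ('o, 'u) abnat, ('o, 'u) abfunc, ('o, 'u) abnat) func" where
  "evaluation C D = \<lparr>FO = (\<lambda>F. restrict_func (full_sub C D) (extend C F)),
                     FA = (\<lambda>\<alpha>. restrict_nat (full_sub C D) (extend_nat C \<alpha>))\<rparr>"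

section \<open>Localisation and the induced monoidal structure\<close>

text \<open>Localisation of a category at a class \<open>W\<close> of arrows admitting a calculus of right fractions:
  an arrow \<open>X \<rightarrow> Y\<close> is an equivalence class of pairs \<open>(s, f)\<close>, standing for \<open>f s\<^sup>-\<^sup>1\<close>, of arrows
  with a common source such that \<open>s \<in> W\<close> has target \<open>X\<close> and \<open>f\<close> has target \<open>Y\<close>.\<close>

datatype ('o, 'a) fraction = Fraction (fsrc: 'o) (ftgt: 'o) (freps: "('a \<times> 'a) set")

definition is_roof :: "('o, 'a) precat \<Rightarrow> 'a set \<Rightarrow> 'a \<times> 'a \<Rightarrow> bool" where
  "is_roof A W = (\<lambda>(s, f). s \<in> W \<and> s \<in> Arr A \<and> f \<in> Arr A \<and> Src A s = Src A f)"

definition roof_equiv :: "('o, 'a) precat \<Rightarrow> 'a set \<Rightarrow> 'a \<times> 'a \<Rightarrow> 'a \<times> 'a \<Rightarrow> bool" where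
  "roof_equiv A W = (\<lambda>(s, f) (t, g). is_roof A W (s, f) \<and> is_roof A W (t, g) \<and>
     Tgt A s = Tgt A t \<and> Tgt A f = Tgt A g \<and>
     (\<exists>Z\<in>Obj A. \<exists>u \<in> hom_set A Z (Src A s). \<exists>v \<in> hom_set A Z (Src A t).
        s \<cdot>\<^bsub>A\<^esub> u = t \<cdot>\<^bsub>A\<^esub> v \<and> s \<cdot>\<^bsub>A\<^esub> u \<in> W \<and> f \<cdot>\<^bsub>A\<^esub> u = g \<cdot>\<^bsub>A\<^esub> v))"

definition frac :: "('o, 'a) precat \<Rightarrow> 'a set \<Rightarrow> 'a \<Rightarrow> 'a \<Rightarrow> ('o, 'a) fraction" where
  "frac A W s f = Fraction (Tgt A s) (Tgt A f) {r. roof_equiv A W (s, f) r}"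

definition localisation ::
    "('o, 'a) precat \<Rightarrow> 'a set \<Rightarrow> ('o, ('o, 'a) fraction) precat" where
  "localisation A W =
     \<lparr>Obj = Obj A,
      Arr = {frac A W s f |s f. is_roof A W (s, f)},
      Src = fsrc, Tgt = ftgt,
      Ident = (\<lambda>X. frac A W (Ident A X) (Ident A X)),
      Comp = (\<lambda>d c. Fraction (fsrc c) (ftgt d)
        {r. \<exists>s f t g s' f'. (s, f) \<in> freps c \<and> (t, g) \<in> freps d \<and>
              s' \<in> W \<and> s' \<in> Arr A \<and> f' \<in> Arr A \<and> Src A s' = Src A f' \<and>
              Tgt A s' = Src A f \<and> Tgt A f' = Src A t \<and> f \<cdot>\<^bsub>A\<^esub> s' = t \<cdot>\<^bsub>A\<^esub> f' \<and>
              roof_equiv A W (s \<cdot>\<^bsub>A\<^esub> s', g \<cdot>\<^bsub>A\<^esub> f') r}),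
      Plus = (\<lambda>c d. Fraction (fsrc c) (ftgt c)
        {r. \<exists>s f g. (s, f) \<in> freps c \<and> (s, g) \<in> freps d \<and> roof_equiv A W (s, f \<boxplus>\<^bsub>A\<^esub> g) r}),
      Zro = (\<lambda>X Y. frac A W (Ident A X) (Zro A X Y))\<rparr>"

definition localisation_functor ::
    "('o, 'a) precat \<Rightarrow> 'a set \<Rightarrow> ('o, 'a, 'o, ('o, 'a) fraction) func" where
  "localisation_functor A W = \<lparr>FO = (\<lambda>X. X), FA = (\<lambda>f. frac A W (Ident A (Src A f)) f)\<rparr>"

definition serre_class :: "('o, 'u) precat \<Rightarrow> 'o set \<Rightarrow> ('o, 'u) abfunc set" where
  "serre_class C D = {F \<in> Obj (fp_mod C). \<forall>X\<in>D. carrier (FO (extend C F) X) = {\<one>\<^bsub>FO (extend C F) X\<^esub>}}"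

definition serre_arrows :: "('o, 'u) precat \<Rightarrow> 'o set \<Rightarrow> ('o, 'u) abnat set" where
  "serre_arrows C D = {\<alpha> \<in> Arr (fp_mod C).
     (\<exists>k. is_kernel (fp_mod C) \<alpha> k \<and> NSrc k \<in> serre_class C D) \<and>
     (\<exists>p. is_cokernel (fp_mod C) \<alpha> p \<and> NTgt p \<in> serre_class C D)}"

abbreviation serre_quotient :: "('o, 'u) precat \<Rightarrow> 'o set
    \<Rightarrow> (('o, 'u) abfunc, (('o, 'u) abfunc, ('o, 'u) abnat) fraction) precat" where
  "serre_quotient C D \<equiv> localisation (fp_mod C) (serre_arrows C D)"

abbreviation quotient_functor :: "('o, 'u) precat \<Rightarrow> 'o set \<Rightarrow> (('o, 'u) abfunc, ('o, 'u) abnat,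
    ('o, 'u) abfunc, (('o, 'u) abfunc, ('o, 'u) abnat) fraction) func" where
  "quotient_functor C D \<equiv> localisation_functor (fp_mod C) (serre_arrows C D)"

text \<open>\<open>Q\<close> is the monoidal structure on the quotient making the localisation functor monoidal, and
  \<open>\<Psi>\<close> is the equivalence induced by \<open>F \<mapsto> evaluation C D F\<close>.  That \<open>T\<close> is the transport of \<open>Q\<close>
  along \<open>\<Psi>\<close> means that \<open>\<Psi>\<close> is a monoidal equivalence.\<close>

definition is_induced_structure :: "('o, 'u) precat \<Rightarrow> 'o set
    \<Rightarrow> (('o, 'u) abfunc, ('o, 'u) abnat) tensor
    \<Rightarrow> (('o, 'u) abfunc, ('o, 'u) abnat) tensor \<Rightarrow> bool" where
  "is_induced_structure C D N T \<longleftrightarrow>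
     additive_symmetric_monoidal_category (fun_cat C D) T \<and>
     (\<exists>Q \<Psi> \<phi> \<epsilon> \<psi> \<delta>.
        additive_symmetric_monoidal_category (serre_quotient C D) Q \<and>
        monoidal_functor (fp_mod C) N (serre_quotient C D) Q (quotient_functor C D) \<phi> \<epsilon> \<and>
        is_equivalence (serre_quotient C D) (fun_cat C D) \<Psi> \<and>
        (\<forall>F\<in>Obj (fp_mod C). FO \<Psi> (FO (quotient_functor C D) F) = FO (evaluation C D) F) \<and>
        (\<forall>\<alpha>\<in>Arr (fp_mod C). FA \<Psi> (FA (quotient_functor C D) \<alpha>) = FA (evaluation C D) \<alpha>) \<and>
        monoidal_functor (serre_quotient C D) Q (fun_cat C D) T \<Psi> \<psi> \<delta>)"

end

theory Submission
  imports Defs "HOL-Algebra.Product_Groups"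
begin

text \<open>
  Let \<open>R\<close> send a finitely presented object \<open>A\<close> to the functor \<open>(A, -)\<close> on \<open>D\<close>.  It is contravariant and,
  by construction of the induced structure, carries tensor products to tensor products.  An arrow
  \<open>h : A \<otimes> U \<rightarrow> X\<close> with \<open>X\<close> in \<open>D\<close> is an element of \<open>R (A \<otimes> U)\<close> at \<open>X\<close>, hence an element \<open>z\<close> of \<open>R A \<otimes> R U\<close>
  at \<open>X\<close>, and \<open>f \<otimes> g\<close> divides \<open>h\<close> if and only if \<open>z\<close> is in the image of \<open>R f \<otimes> R g\<close>.  So the exactness
  criterion says that at each object of \<open>D\<close> the images of \<open>R f \<otimes> 1\<close> and \<open>1 \<otimes> R g\<close> meet in the image of
  \<open>R f \<otimes> R g\<close>.  For an exact tensor product this holds for any two arrows \<open>\<alpha> : F \<rightarrow> F'\<close> and \<open>\<beta> : G \<rightarrow> G'\<close>,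
  with images \<open>J\<close> and \<open>J'\<close>: if \<open>z\<close> comes from \<open>a\<close> in \<open>J \<otimes> G'\<close> and from \<open>F' \<otimes> J'\<close>, it dies in
  \<open>F' \<otimes> coker \<beta>\<close>; as \<open>J \<otimes> coker \<beta>\<close> embeds there, \<open>a\<close> dies in \<open>J \<otimes> coker \<beta>\<close> and so comes from
  \<open>J \<otimes> J'\<close>, onto which \<open>F \<otimes> G\<close> maps (\<open>exact_tensor_image_intersection\<close>).

  Such a chase with elements needs that exactness in the category of functors on \<open>D\<close> that commute with
  products and direct limits is exactness at each object.  As products and direct limits of abelian
  groups are exact, kernels and cokernels formed at each object commute with them again
  (\<open>pointwise_kernel_continuous\<close>, \<open>pointwise_cokernel_continuous\<close>); they have the universal
  properties (\<open>is_kernel_of_pointwise\<close>, \<open>is_cokernel_of_pointwise\<close>), so all kernels and cokernels are of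
  this form (\<open>is_kernel_pointwise\<close>, \<open>is_cokernel_surj\<close>).  This rests on the descriptions by elements of
  products and direct limits in \<open>Ab\<close>, obtained from explicit constructions: the group of families and
  its quotient by the families that vanish eventually (\<open>Ab_product_elementwise\<close>,
  \<open>Ab_direct_limit_kernel\<close>).

  It remains to identify \<open>R\<close>.  The induced structure sends \<open>A\<close> to a chosen extension of the functor
  \<open>(A, -)\<close> on finitely presented objects, and arrows to the unique extensions of precomposition.
  Yoneda's map \<open>comparison\<close> from \<open>(A, -)\<close> to the chosen extension is bijective, because both functors
  commute with direct limits and each object is a direct limit of finitely presented ones, and it turns
  the extended transformations back into precomposition (\<open>extend_nat_yoneda\<close>).
\<close>

section \<open>Small sets\<close>

lemma small_image: "small TYPE('u) S \<Longrightarrow> small TYPE('u) (f ` S)"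
  unfolding small_def by (meson image_lepoll lesspoll_trans1)

lemma small_subset: "\<lbrakk>small TYPE('u) S; R \<subseteq> S\<rbrakk> \<Longrightarrow> small TYPE('u) R"
  unfolding small_def by (meson subset_imp_lepoll lesspoll_trans1)

lemma small_obtain_injection:
  assumes "small TYPE('u) S"
  obtains e :: "'x \<Rightarrow> 'u" where "inj_on e S"
  using assms unfolding small_def lesspoll_def lepoll_def by blast

lemma small_PiE:
  fixes I :: "'u set" and S :: "'u \<Rightarrow> 'u set"
  assumes "universe TYPE('u)" "small TYPE('u) I" "\<And>i. i \<in> I \<Longrightarrow> small TYPE('u) (S i)"
  shows "small TYPE('u) (\<Pi>\<^sub>E i\<in>I. S i)"
proof -
  have "infinite (UNIV :: 'u set)"
    using assms(1) by (simp add: universe_def)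
  then have "\<exists>c. bij_betw c ((UNIV :: 'u set) \<times> (UNIV :: 'u set)) (UNIV :: 'u set)"
    unfolding card_of_ordIso by (rule card_of_Times_same_infinite)
  then obtain c :: "'u \<times> 'u \<Rightarrow> 'u" where "inj c"
    by (auto simp: bij_betw_def)
  define R where "R = (\<Union>i\<in>I. (\<lambda>x. c (i, x)) ` S i)"
  have "\<forall>i\<in>I. small TYPE('u) ((\<lambda>x. c (i, x)) ` S i)"
    using assms(3) by (simp add: small_image)
  then have "small TYPE('u) R"
    using assms(1,2) by (simp add: R_def universe_def)
  then have "Pow R \<prec> (UNIV :: 'u set)"
    using assms(1) by (simp add: universe_def small_def)
  \<comment> \<open>A family is determined by its graph, a subset of \<open>R\<close>.\<close>
  moreover have "(\<Pi>\<^sub>E i\<in>I. S i) \<lesssim> Pow R"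
    unfolding lepoll_def
  proof (intro exI conjI inj_onI)
    let ?graph = "\<lambda>x. (\<lambda>i. c (i, x i)) ` I"
    show "?graph ` (\<Pi>\<^sub>E i\<in>I. S i) \<subseteq> Pow R"
      by (auto simp: R_def)
    fix x y
    assume x: "x \<in> (\<Pi>\<^sub>E i\<in>I. S i)" and y: "y \<in> (\<Pi>\<^sub>E i\<in>I. S i)" and eq: "?graph x = ?graph y"
    show "x = y"
    proof (rule PiE_ext[OF x y])
      fix i assume "i \<in> I"
      then have "c (i, x i) \<in> ?graph y"
        using eq by blast
      then show "x i = y i"
        using \<open>inj c\<close> by (auto dest: injD)
    qed
  qed
  ultimately show ?thesis
    unfolding small_def by (rule lesspoll_trans1[rotated])
qed

section \<open>Arrows of full subcategories\<close>

lemma full_sub_simps [simp]: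
  "Obj (full_sub C S) = Obj C \<inter> S"
  "Arr (full_sub C S) = {f \<in> Arr C. Src C f \<in> S \<and> Tgt C f \<in> S}"
  "Src (full_sub C S) = Src C" "Tgt (full_sub C S) = Tgt C" "Ident (full_sub C S) = Ident C"
  "Comp (full_sub C S) = Comp C" "Plus (full_sub C S) = Plus C" "Zro (full_sub C S) = Zro C"
  by (simp_all add: full_sub_def)

lemma hom_set_full_sub: "\<lbrakk>A \<in> S; B \<in> S\<rbrakk> \<Longrightarrow> hom_set (full_sub C S) A B = hom_set C A B"
  by (auto simp: hom_set_def)

lemma hom_set_full_sub_iff:
  "f \<in> hom_set (full_sub C S) A B \<longleftrightarrow> f \<in> hom_set C A B \<and> A \<in> S \<and> B \<in> S"
  by (auto simp: hom_set_def)

lemma hom_setD: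
  assumes "f \<in> hom_set C A B"
  shows "f \<in> Arr C" "Src C f = A" "Tgt C f = B"
  using assms by (auto simp: hom_set_def)

lemma (in preadditive_category) hom_set_objs:
  assumes "f \<in> hom_set C A B" shows "A \<in> Obj C" "B \<in> Obj C"
  using assms src_obj tgt_obj by (auto simp: hom_set_def)

section \<open>Abelian groups\<close>

lemma Ab_simps [simp]:
  "Src Ab = gsrc" "Tgt Ab = gtgt"
  "Ident Ab G = GMap G G (\<lambda>x\<in>carrier G. x)"
  "n \<cdot>\<^bsub>Ab\<^esub> m = GMap (gsrc m) (gtgt n) (compose (carrier (gsrc m)) (gfun n) (gfun m))"
  "m \<boxplus>\<^bsub>Ab\<^esub> n = GMap (gsrc m) (gtgt m)
                     (\<lambda>x\<in>carrier (gsrc m). gfun m x \<otimes>\<^bsub>gtgt m\<^esub> gfun n x)"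
  "Zro Ab G H = GMap G H (\<lambda>x\<in>carrier G. \<one>\<^bsub>H\<^esub>)"
  by (simp_all add: Ab_def)

lemma Ab_Obj_iff: "G \<in> Obj (Ab :: ('u monoid, 'u gmap) precat)
    \<longleftrightarrow> comm_group G \<and> small TYPE('u) (carrier G)"
  by (simp add: Ab_def)

lemma Ab_hom_iff: "m \<in> hom_set Ab G H \<longleftrightarrow> G \<in> Obj Ab \<and> H \<in> Obj Ab \<and> gsrc m = G \<and> gtgt m = H \<and>
    gfun m \<in> hom G H \<and> gfun m \<in> extensional (carrier G)"
  by (auto simp: Ab_def hom_set_def)

lemma Ab_homD:
  assumes "m \<in> hom_set Ab G H"
  shows "G \<in> Obj Ab" "H \<in> Obj Ab" "gsrc m = G" "gtgt m = H" "gfun m \<in> hom G H"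
    "gfun m \<in> extensional (carrier G)"
  using assms by (simp_all add: Ab_hom_iff)

lemma Ab_arr_eqI:
  assumes "m \<in> hom_set Ab G H" "n \<in> hom_set Ab G H" "\<And>x. x \<in> carrier G \<Longrightarrow> gfun m x = gfun n x"
  shows "m = n"
proof (rule gmap.expand)
  have "gfun m = gfun n"
    by (rule extensionalityI[OF Ab_homD(6) Ab_homD(6)]) (use assms in auto)
  then show "gsrc m = gsrc n \<and> gtgt m = gtgt n \<and> gfun m = gfun n"
    using assms(1,2)[THEN Ab_homD(3)] assms(1,2)[THEN Ab_homD(4)] by simp
qed

lemma restrict_in_hom:
  assumes "group G" "t \<in> hom G H" shows "restrict t (carrier G) \<in> hom G H"
proof -
  interpret group G by fact
  show ?thesis using assms by (auto simp: hom_def)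
qed

lemma GMap_hom_Ab:
  assumes "G \<in> Obj Ab" "H \<in> Obj Ab" "t \<in> hom G H"
  shows "GMap G H (\<lambda>x\<in>carrier G. t x) \<in> hom_set Ab G H"
proof -
  interpret G: comm_group G using assms by (simp add: Ab_Obj_iff)
  show ?thesis using assms restrict_in_hom[OF G.is_group assms(3)] by (simp add: Ab_hom_iff)
qed

lemma Ab_hom_closed: "\<lbrakk>m \<in> hom_set Ab G H; x \<in> carrier G\<rbrakk> \<Longrightarrow> gfun m x \<in> carrier H"
  by (auto simp: Ab_hom_iff hom_in_carrier)

lemma Ab_hom_group_hom: "m \<in> hom_set Ab G H \<Longrightarrow> group_hom G H (gfun m)"
  by (auto simp: Ab_hom_iff Ab_Obj_iff comm_group_def intro!: group_hom.intro group_hom_axioms.intro)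

lemma Ab_comp_fun: "\<lbrakk>m \<in> hom_set Ab G H; x \<in> carrier G\<rbrakk> \<Longrightarrow> gfun (n \<cdot>\<^bsub>Ab\<^esub> m) x = gfun n (gfun m x)"
  by (simp add: Ab_hom_iff compose_def)

lemma Ab_comp_hom:
  assumes "m \<in> hom_set Ab G H" "n \<in> hom_set Ab H K" shows "n \<cdot>\<^bsub>Ab\<^esub> m \<in> hom_set Ab G K"
proof -
  interpret group_hom G H "gfun m" using assms(1) by (rule Ab_hom_group_hom)
  have "compose (carrier G) (gfun n) (gfun m) \<in> hom G K"
    using assms[THEN Ab_homD(5)] by (rule G.hom_compose)
  then show ?thesis using assms by (simp add: Ab_hom_iff)
qed

lemma Ab_plus_fun:
  "\<lbrakk>m \<in> hom_set Ab G H; x \<in> carrier G\<rbrakk> \<Longrightarrow> gfun (m \<boxplus>\<^bsub>Ab\<^esub> n) x = gfun m x \<otimes>\<^bsub>H\<^esub> gfun n x"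
  by (simp add: Ab_hom_iff)

lemma Ab_zero_fun: "x \<in> carrier G \<Longrightarrow> gfun (Zro Ab G H) x = \<one>\<^bsub>H\<^esub>"
  by simp

lemma Ab_ident_fun: "x \<in> carrier G \<Longrightarrow> gfun (Ident Ab G) x = x"
  by simp

lemma Ab_ident_hom: "G \<in> Obj Ab \<Longrightarrow> Ident Ab G \<in> hom_set Ab G G"
  using GMap_hom_Ab[OF _ _ iso_imp_homomorphism[OF iso_set_refl]] by simp

lemma Ab_zero_hom: "\<lbrakk>G \<in> Obj Ab; H \<in> Obj Ab\<rbrakk> \<Longrightarrow> Zro Ab G H \<in> hom_set Ab G H"
  by (simp only: Ab_simps) (rule GMap_hom_Ab, auto simp: Ab_Obj_iff comm_group_def trivial_hom)

lemma Ab_plus_hom: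
  assumes "m \<in> hom_set Ab G H" "n \<in> hom_set Ab G H" shows "m \<boxplus>\<^bsub>Ab\<^esub> n \<in> hom_set Ab G H"
proof -
  interpret G: comm_group G using assms by (simp add: Ab_hom_iff Ab_Obj_iff)
  interpret H: comm_group H using assms by (simp add: Ab_hom_iff Ab_Obj_iff)
  have "(\<lambda>x. gfun m x \<otimes>\<^bsub>H\<^esub> gfun n x) \<in> hom G H"
    using assms[THEN Ab_homD(5)] by (rule H.hom_group_mult)
  from GMap_hom_Ab[OF Ab_homD(1,2)[OF assms(1)] this] show ?thesis
    using assms by (simp add: Ab_hom_iff)
qed

lemma comm_group_hom_group_Ab:
  assumes "G \<in> Obj Ab" "H \<in> Obj Ab" shows "comm_group (hom_group Ab G H)"
proof -
  interpret G: comm_group G using assms by (simp add: Ab_Obj_iff)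
  interpret H: comm_group H using assms by (simp add: Ab_Obj_iff)
  note homs = Ab_plus_hom Ab_zero_hom[OF assms]
  note closed = Ab_hom_closed[of _ G H]
  show ?thesis
  proof (rule comm_groupI; unfold hom_group_def partial_object.simps monoid.simps)
    fix m n l assume m: "m \<in> hom_set Ab G H" and n: "n \<in> hom_set Ab G H" and l: "l \<in> hom_set Ab G H"
    show "m \<boxplus>\<^bsub>Ab\<^esub> n \<boxplus>\<^bsub>Ab\<^esub> l = m \<boxplus>\<^bsub>Ab\<^esub> (n \<boxplus>\<^bsub>Ab\<^esub> l)"
    proof (rule Ab_arr_eqI[of _ G H])
      fix x assume "x \<in> carrier G"
      with m n l show "gfun (m \<boxplus>\<^bsub>Ab\<^esub> n \<boxplus>\<^bsub>Ab\<^esub> l) x = gfun (m \<boxplus>\<^bsub>Ab\<^esub> (n \<boxplus>\<^bsub>Ab\<^esub> l)) x"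
        using homs(1)[OF m n] closed
        by (simp add: Ab_plus_fun[of _ G H] H.m_assoc del: Ab_simps)
    qed (use m n l homs in blast)+
  next
    fix m n assume m: "m \<in> hom_set Ab G H" and n: "n \<in> hom_set Ab G H"
    show "m \<boxplus>\<^bsub>Ab\<^esub> n \<in> hom_set Ab G H"
      using m n by (rule Ab_plus_hom)
    show "m \<boxplus>\<^bsub>Ab\<^esub> n = n \<boxplus>\<^bsub>Ab\<^esub> m"
    proof (rule Ab_arr_eqI[of _ G H])
      fix x assume "x \<in> carrier G"
      with m n show "gfun (m \<boxplus>\<^bsub>Ab\<^esub> n) x = gfun (n \<boxplus>\<^bsub>Ab\<^esub> m) x"
        using closed by (simp add: Ab_plus_fun[of _ G H] H.m_comm del: Ab_simps)
    qed (use m n homs in blast)+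
  next
    fix m assume m: "m \<in> hom_set Ab G H"
    interpret m: group_hom G H "gfun m" using m by (rule Ab_hom_group_hom)
    show "Zro Ab G H \<boxplus>\<^bsub>Ab\<^esub> m = m"
      by (rule Ab_arr_eqI[OF Ab_plus_hom[OF homs(2) m] m]) (simp add: closed[OF m])
    let ?n = "GMap G H (\<lambda>x\<in>carrier G. inv\<^bsub>H\<^esub> gfun m x)"
    have n: "?n \<in> hom_set Ab G H"
      by (rule GMap_hom_Ab[OF assms]) (auto simp: hom_def H.inv_mult)
    have "?n \<boxplus>\<^bsub>Ab\<^esub> m = Zro Ab G H"
      by (rule Ab_arr_eqI[OF Ab_plus_hom[OF n m] homs(2)]) (simp add: closed[OF m])
    with n show "\<exists>y\<in>hom_set Ab G H. y \<boxplus>\<^bsub>Ab\<^esub> m = Zro Ab G H" ..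
  qed (rule homs(2))
qed

lemma preadditive_Ab: "preadditive_category (Ab :: ('u monoid, 'u gmap) precat)"
proof (unfold preadditive_category_def, intro conjI allI impI)
  fix m :: "'u gmap" and G H :: "'u monoid"
  show "m \<in> Arr Ab \<Longrightarrow> Src Ab m \<in> Obj Ab" "m \<in> Arr Ab \<Longrightarrow> Tgt Ab m \<in> Obj Ab"
    by (auto simp: Ab_def)
  show "G \<in> Obj Ab \<Longrightarrow> Ident Ab G \<in> hom_set Ab G G"
    by (rule Ab_ident_hom)
  show "comm_group (hom_group Ab G H)" if "G \<in> Obj Ab" "H \<in> Obj Ab"
    using that by (rule comm_group_hom_group_Ab)
next
  fix m n l :: "'u gmap" and G H K L :: "'u monoid"
  assume m: "m \<in> hom_set Ab G H"
  have G: "G \<in> Obj Ab" and H: "H \<in> Obj Ab"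
    using m by (auto dest: Ab_homD)
  show "m \<cdot>\<^bsub>Ab\<^esub> Ident Ab G = m"
    by (rule Ab_arr_eqI[OF Ab_comp_hom[OF Ab_ident_hom[OF G] m] m])
       (simp only: Ab_comp_fun[OF Ab_ident_hom[OF G]] Ab_ident_fun)
  show "Ident Ab H \<cdot>\<^bsub>Ab\<^esub> m = m"
    by (rule Ab_arr_eqI[OF Ab_comp_hom[OF m Ab_ident_hom[OF H]] m])
       (simp only: Ab_comp_fun[OF m] Ab_ident_fun Ab_hom_closed[OF m])
  show comp: "n \<cdot>\<^bsub>Ab\<^esub> m \<in> hom_set Ab G K" if "n \<in> hom_set Ab H K" for n K
    using m that by (rule Ab_comp_hom)
  show "(l \<cdot>\<^bsub>Ab\<^esub> n) \<cdot>\<^bsub>Ab\<^esub> m = l \<cdot>\<^bsub>Ab\<^esub> (n \<cdot>\<^bsub>Ab\<^esub> m)"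
    if n: "n \<in> hom_set Ab H K" and l: "l \<in> hom_set Ab K L"
    by (rule Ab_arr_eqI[OF Ab_comp_hom[OF m Ab_comp_hom[OF n l]] Ab_comp_hom[OF comp[OF n] l]])
       (simp only: Ab_comp_fun[OF m] Ab_comp_fun[OF n] Ab_comp_fun[OF comp[OF n]] Ab_hom_closed[OF m])
  show "(n \<boxplus>\<^bsub>Ab\<^esub> l) \<cdot>\<^bsub>Ab\<^esub> m = (n \<cdot>\<^bsub>Ab\<^esub> m) \<boxplus>\<^bsub>Ab\<^esub> (l \<cdot>\<^bsub>Ab\<^esub> m)"
    if n: "n \<in> hom_set Ab H K" and l: "l \<in> hom_set Ab H K"
    by (rule Ab_arr_eqI[OF comp[OF Ab_plus_hom[OF n l]] Ab_plus_hom[OF comp[OF n] comp[OF l]]])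
       (simp only: Ab_comp_fun[OF m] Ab_plus_fun[OF n] Ab_plus_fun[OF comp[OF n]] Ab_hom_closed[OF m])
  show "n \<cdot>\<^bsub>Ab\<^esub> (m \<boxplus>\<^bsub>Ab\<^esub> l) = (n \<cdot>\<^bsub>Ab\<^esub> m) \<boxplus>\<^bsub>Ab\<^esub> (n \<cdot>\<^bsub>Ab\<^esub> l)"
    if l: "l \<in> hom_set Ab G H" and n: "n \<in> hom_set Ab H K"
    by (rule Ab_arr_eqI[OF Ab_comp_hom[OF Ab_plus_hom[OF m l] n]
          Ab_plus_hom[OF comp[OF n] Ab_comp_hom[OF l n]]])
       (simp only: Ab_comp_fun[OF m] Ab_comp_fun[OF l] Ab_comp_fun[OF Ab_plus_hom[OF m l]]
          Ab_plus_fun[OF m] Ab_plus_fun[OF comp[OF n]] Ab_hom_closed[OF m] Ab_hom_closed[OF l]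
          hom_mult[OF Ab_homD(5)[OF n]])
qed

text \<open>The groups of \<open>Ab\<close> live on subsets of \<open>'u\<close>, whereas product groups and quotient groups live on types
  of functions and of sets; transport along an injection into \<open>'u\<close> brings them back.\<close>

lemma Ab_copy:
  fixes G :: "'x monoid"
  assumes "comm_group G" and "small TYPE('u) (carrier G)"
  obtains W :: "'u monoid" and e where "W \<in> Obj Ab" "e \<in> iso G W"
proof -
  obtain e :: "'x \<Rightarrow> 'u" where e: "inj_on e (carrier G)"
    using assms(2) by (rule small_obtain_injection)
  interpret G: comm_group G by fact
  define d where "d = inv_into (carrier G) e"
  have d: "\<And>x. x \<in> carrier G \<Longrightarrow> d (e x) = x"
    using e by (simp add: d_def)
  define W where "W = \<lparr>carrier = e ` carrier G, mult = (\<lambda>x y. e (d x \<otimes>\<^bsub>G\<^esub> d y)), one = e \<one>\<^bsub>G\<^esub>\<rparr>"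
  have iso: "e \<in> iso G W"
    using e by (auto simp: iso_def hom_def bij_betw_def W_def d)
  have "comm_group (W\<lparr>one := e \<one>\<^bsub>G\<^esub>\<rparr>)"
    by (rule G.iso_imp_img_comm_group[OF iso])
  then have "W \<in> Obj Ab"
    using assms(2) by (simp add: Ab_Obj_iff small_image W_def)
  then show thesis using iso by (rule that)
qed

lemma Ab_subgroup:
  fixes G :: "'u monoid"
  assumes "G \<in> Obj Ab" "subgroup N G" shows "G\<lparr>carrier := N\<rparr> \<in> Obj Ab"
proof -
  interpret G: comm_group G using assms by (simp add: Ab_Obj_iff)
  have "comm_group (G\<lparr>carrier := N\<rparr>)"
    using G.subgroup_imp_group[OF assms(2)] G.m_comm subgroup.subset[OF assms(2)]
    by (intro group.group_comm_groupI) auto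
  moreover have "small TYPE('u) N"
    using assms(1) subgroup.subset[OF assms(2)] by (auto simp: Ab_Obj_iff intro: small_subset)
  ultimately show ?thesis by (simp add: Ab_Obj_iff)
qed

lemma Ab_quotient:
  fixes G :: "'u monoid"
  assumes "G \<in> Obj Ab" "subgroup N G"
  obtains Q :: "'u monoid" and q where "Q \<in> Obj Ab" "q \<in> hom G Q" "q ` carrier G = carrier Q"
    "\<forall>x\<in>carrier G. q x = \<one>\<^bsub>Q\<^esub> \<longleftrightarrow> x \<in> N"
proof -
  interpret G: comm_group G using assms by (simp add: Ab_Obj_iff)
  interpret N: normal N G using G.subgroup_imp_normal[OF assms(2)] .
  have carrier: "carrier (G Mod N) = (\<lambda>x. N #>\<^bsub>G\<^esub> x) ` carrier G"
    by (auto simp: FactGroup_def RCOSETS_def)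
  obtain Q and e where Q: "Q \<in> (Obj Ab :: 'u monoid set)" and e: "e \<in> iso (G Mod N) Q"
    using Ab_copy[OF G.abelian_FactGroup[OF assms(2)]] assms(1) small_image
    by (metis Ab_Obj_iff carrier)
  have hom: "(\<lambda>x. e (N #>\<^bsub>G\<^esub> x)) \<in> hom G Q"
    using hom_compose[OF N.r_coset_hom_Mod iso_imp_homomorphism[OF e]] by (simp add: o_def)
  have bij: "bij_betw e (carrier (G Mod N)) (carrier Q)"
    using e by (simp add: iso_def)
  interpret Q: comm_group Q using Q by (simp add: Ab_Obj_iff)
  interpret e: group_hom "G Mod N" Q e
    using N.factorgroup_is_group iso_imp_homomorphism[OF e]
    by (auto intro!: group_hom.intro group_hom_axioms.intro)
  have "e (N #>\<^bsub>G\<^esub> x) = \<one>\<^bsub>Q\<^esub> \<longleftrightarrow> x \<in> N" if x: "x \<in> carrier G" for x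
  proof -
    have "e (N #>\<^bsub>G\<^esub> x) = \<one>\<^bsub>Q\<^esub> \<longleftrightarrow> N #>\<^bsub>G\<^esub> x = \<one>\<^bsub>G Mod N\<^esub>"
      using bij x carrier e.hom_one N.factorgroup_is_group
      by (metis bij_betw_imp_inj_on group.is_monoid imageI inj_onD monoid.one_closed)
    also have "\<dots> \<longleftrightarrow> x \<in> N"
      using x assms(2) by (metis G.coset_join1 G.coset_join2 one_FactGroup subgroup.subset)
    finally show ?thesis .
  qed
  moreover have "(\<lambda>x. e (N #>\<^bsub>G\<^esub> x)) ` carrier G = carrier Q"
    using bij carrier by (auto simp: bij_betw_def)
  ultimately show thesis
    using that[OF Q hom] by simp
qed

section \<open>Products and direct limits of abelian groups, elementwise\<close>

lemma Ab_fun_eq: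
  assumes "n \<cdot>\<^bsub>Ab\<^esub> m = l" "m \<in> hom_set Ab G H" "x \<in> carrier G"
  shows "gfun n (gfun m x) = gfun l x"
  using Ab_comp_fun[OF assms(2,3), of n] unfolding assms(1) by (rule sym)

lemma is_product_factors:
  assumes "is_product C I X P \<pi>" "Z \<in> Obj C" "\<And>i. i \<in> I \<Longrightarrow> f i \<in> hom_set C Z (X i)"
  shows "\<exists>!u. u \<in> hom_set C Z P \<and> (\<forall>i\<in>I. \<pi> i \<cdot>\<^bsub>C\<^esub> u = f i)"
  using assms by (simp add: is_product_def)

lemma Ab_product_of_elementwise:
  assumes P: "P \<in> Obj Ab" and \<pi>: "\<And>i. i \<in> I \<Longrightarrow> \<pi> i \<in> hom_set Ab P (X i)"
    and families: "\<And>x. (\<And>i. i \<in> I \<Longrightarrow> x i \<in> carrier (X i)) \<Longrightarrow>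
          \<exists>!p. p \<in> carrier P \<and> (\<forall>i\<in>I. gfun (\<pi> i) p = x i)"
  shows "is_product Ab I X P \<pi>"
  unfolding is_product_def
proof (intro conjI ballI allI impI)
  fix i assume "i \<in> I"
  then show "\<pi> i \<in> hom_set Ab P (X i)" "X i \<in> Obj Ab"
    using \<pi> Ab_homD(2) by blast+
next
  fix Z :: "'a monoid" and f
  assume Z: "Z \<in> Obj Ab" and "\<forall>i\<in>I. f i \<in> hom_set Ab Z (X i)"
  then have f: "\<And>i. i \<in> I \<Longrightarrow> f i \<in> hom_set Ab Z (X i)" by blast
  interpret Z: comm_group Z using Z by (simp add: Ab_Obj_iff)
  interpret P: comm_group P using P by (simp add: Ab_Obj_iff)
  have unique: "\<exists>!p. p \<in> carrier P \<and> (\<forall>i\<in>I. gfun (\<pi> i) p = gfun (f i) z)" if "z \<in> carrier Z" for z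
    by (rule families) (rule Ab_hom_closed[OF f that])
  define u where "u z = (THE p. p \<in> carrier P \<and> (\<forall>i\<in>I. gfun (\<pi> i) p = gfun (f i) z))" for z
  have u: "u z \<in> carrier P" "\<And>i. i \<in> I \<Longrightarrow> gfun (\<pi> i) (u z) = gfun (f i) z"
    if "z \<in> carrier Z" for z
    using theI'[OF unique[OF that]] by (auto simp: u_def)
  have "u \<in> hom Z P"
  proof (rule homI)
    fix y z assume y: "y \<in> carrier Z" and z: "z \<in> carrier Z"
    have "gfun (\<pi> i) (u y \<otimes>\<^bsub>P\<^esub> u z) = gfun (f i) (y \<otimes>\<^bsub>Z\<^esub> z)" if "i \<in> I" for i
      using hom_mult[OF Ab_homD(5)[OF \<pi>[OF that]]] hom_mult[OF Ab_homD(5)[OF f[OF that]]] u y z that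
      by simp
    then show "u (y \<otimes>\<^bsub>Z\<^esub> z) = u y \<otimes>\<^bsub>P\<^esub> u z"
      using unique[OF Z.m_closed[OF y z]] u[OF Z.m_closed[OF y z]] P.m_closed[OF u(1)[OF y] u(1)[OF z]]
      by blast
  qed (rule u)
  then have hom: "GMap Z P (restrict u (carrier Z)) \<in> hom_set Ab Z P"
    by (rule GMap_hom_Ab[OF Z P])
  show "\<exists>!u. u \<in> hom_set Ab Z P \<and> (\<forall>i\<in>I. \<pi> i \<cdot>\<^bsub>Ab\<^esub> u = f i)"
  proof (rule ex1I)
    show "GMap Z P (restrict u (carrier Z)) \<in> hom_set Ab Z P \<and>
        (\<forall>i\<in>I. \<pi> i \<cdot>\<^bsub>Ab\<^esub> GMap Z P (restrict u (carrier Z)) = f i)"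
    proof (intro conjI ballI hom)
      fix i assume i: "i \<in> I"
      show "\<pi> i \<cdot>\<^bsub>Ab\<^esub> GMap Z P (restrict u (carrier Z)) = f i"
        by (rule Ab_arr_eqI[OF Ab_comp_hom[OF hom \<pi>[OF i]] f[OF i]])
           (use u i in \<open>simp add: Ab_comp_fun[OF hom] del: Ab_simps\<close>)
    qed
  next
    fix v assume v: "v \<in> hom_set Ab Z P \<and> (\<forall>i\<in>I. \<pi> i \<cdot>\<^bsub>Ab\<^esub> v = f i)"
    show "v = GMap Z P (restrict u (carrier Z))"
    proof (rule Ab_arr_eqI[OF _ hom])
      fix z assume z: "z \<in> carrier Z"
      have "gfun v z \<in> carrier P \<and> (\<forall>i\<in>I. gfun (\<pi> i) (gfun v z) = gfun (f i) z)"
        using v z Ab_hom_closed[of v Z P z] Ab_fun_eq[of _ v _ Z P z] by blast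
      then show "gfun v z = gfun (GMap Z P (restrict u (carrier Z))) z"
        using unique[OF z] u[OF z] z by (simp add: restrict_def) blast
    qed (use v in blast)
  qed
qed (rule P)

lemma Ab_product_exists:
  fixes I :: "'u set" and X :: "'u \<Rightarrow> 'u monoid"
  assumes universe: "universe TYPE('u)" and I: "small TYPE('u) I"
    and X: "\<And>i. i \<in> I \<Longrightarrow> X i \<in> Obj Ab"
  obtains W \<rho> where "W \<in> Obj Ab" "\<forall>i\<in>I. \<rho> i \<in> hom_set Ab W (X i)"
    "\<forall>x. (\<forall>i\<in>I. x i \<in> carrier (X i)) \<longrightarrow> (\<exists>!w. w \<in> carrier W \<and> (\<forall>i\<in>I. gfun (\<rho> i) w = x i))"
proof -
  let ?G = "product_group I X"
  have groups: "\<And>i. i \<in> I \<Longrightarrow> comm_group (X i)"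
    using X by (simp add: Ab_Obj_iff)
  interpret G: group ?G
    using groups by (intro product_group) (simp add: comm_group_def)
  have "comm_group ?G"
  proof (rule G.group_comm_groupI)
    fix x y assume "x \<in> carrier ?G" "y \<in> carrier ?G"
    then show "x \<otimes>\<^bsub>?G\<^esub> y = y \<otimes>\<^bsub>?G\<^esub> x"
      using groups by (auto intro!: restrict_ext comm_monoid.m_comm simp: comm_group_def PiE_iff)
  qed
  moreover have "small TYPE('u) (carrier ?G)"
    using X by (auto intro!: small_PiE[OF universe I] simp: Ab_Obj_iff)
  ultimately obtain W :: "'u monoid" and e where W: "W \<in> Obj Ab" and e: "e \<in> iso ?G W"
    by (rule Ab_copy)
  interpret W: comm_group W using W by (simp add: Ab_Obj_iff)
  define d where "d = inv_into (carrier ?G) e"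
  have d: "d \<in> iso W ?G" "\<And>x. x \<in> carrier ?G \<Longrightarrow> d (e x) = x" "\<And>w. w \<in> carrier W \<Longrightarrow> e (d w) = w"
    using e G.iso_set_sym[OF e] by (auto simp: d_def iso_def bij_betw_def f_inv_into_f)
  have d_closed: "\<And>w. w \<in> carrier W \<Longrightarrow> d w \<in> carrier ?G"
    using d(1) by (auto simp: iso_def hom_def)
  have e_closed: "\<And>x. x \<in> carrier ?G \<Longrightarrow> e x \<in> carrier W"
    using e by (auto simp: iso_def hom_def)
  define \<rho> where "\<rho> i = GMap W (X i) (\<lambda>w\<in>carrier W. d w i)" for i
  show thesis
  proof (rule that[OF W]; intro ballI allI impI)
    fix i assume i: "i \<in> I"
    have "(\<lambda>w. d w i) \<in> hom W (X i)"
    proof (rule homI)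
      fix v w assume "v \<in> carrier W" "w \<in> carrier W"
      then have "d (v \<otimes>\<^bsub>W\<^esub> w) = d v \<otimes>\<^bsub>?G\<^esub> d w"
        using d(1) by (auto simp: iso_def hom_def)
      then show "d (v \<otimes>\<^bsub>W\<^esub> w) i = d v i \<otimes>\<^bsub>X i\<^esub> d w i"
        using i by simp
    qed (use d_closed i in auto)
    then show "\<rho> i \<in> hom_set Ab W (X i)"
      unfolding \<rho>_def by (rule GMap_hom_Ab[OF W X[OF i]])
  next
    fix x assume x: "\<forall>i\<in>I. x i \<in> carrier (X i)"
    then have rx: "restrict x I \<in> carrier ?G"
      by auto
    show "\<exists>!w. w \<in> carrier W \<and> (\<forall>i\<in>I. gfun (\<rho> i) w = x i)"
    proof (rule ex1I[of _ "e (restrict x I)"])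
      show "e (restrict x I) \<in> carrier W \<and> (\<forall>i\<in>I. gfun (\<rho> i) (e (restrict x I)) = x i)"
        using d(2)[OF rx] e_closed[OF rx] by (simp add: \<rho>_def)
      fix w assume w: "w \<in> carrier W \<and> (\<forall>i\<in>I. gfun (\<rho> i) w = x i)"
      then have "d w = restrict x I"
        using d_closed[of w] by (intro PiE_ext[of _ I "\<lambda>i. carrier (X i)"]) (auto simp: \<rho>_def x)
      then show "w = e (restrict x I)"
        using d(3) w by metis
    qed
  qed
qed

text \<open>The free group on one generator is not small when \<open>'u\<close> is countable, so elements cannot be treated
  as arrows out of it.  Instead the product is compared with the group of all families, to which it is
  isomorphic.\<close>

lemma Ab_product_elementwise:
  fixes I :: "'u set" and X :: "'u \<Rightarrow> 'u monoid"
  assumes universe: "universe TYPE('u)" and I: "small TYPE('u) I" and product: "is_product Ab I X P \<pi>"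
    and x: "\<And>i. i \<in> I \<Longrightarrow> x i \<in> carrier (X i)"
  shows "\<exists>!p. p \<in> carrier P \<and> (\<forall>i\<in>I. gfun (\<pi> i) p = x i)"
proof -
  have P: "P \<in> Obj Ab" and X: "\<And>i. i \<in> I \<Longrightarrow> X i \<in> Obj Ab"
    and \<pi>: "\<And>i. i \<in> I \<Longrightarrow> \<pi> i \<in> hom_set Ab P (X i)"
    using product by (simp_all add: is_product_def)
  obtain W \<rho> where W: "W \<in> Obj Ab" and \<rho>: "\<forall>i\<in>I. \<rho> i \<in> hom_set Ab W (X i)"
    and families: "\<forall>x. (\<forall>i\<in>I. x i \<in> carrier (X i)) \<longrightarrow>
          (\<exists>!w. w \<in> carrier W \<and> (\<forall>i\<in>I. gfun (\<rho> i) w = x i))"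
    by (rule Ab_product_exists[OF universe I X])
  have "is_product Ab I X W \<rho>"
    by (rule Ab_product_of_elementwise[OF W]) (use \<rho> families in simp_all)
  from is_product_factors[OF this P \<pi>]
  obtain v where v: "v \<in> hom_set Ab P W" "\<And>i. i \<in> I \<Longrightarrow> \<rho> i \<cdot>\<^bsub>Ab\<^esub> v = \<pi> i"
    by blast
  obtain u where u: "u \<in> hom_set Ab W P" "\<And>i. i \<in> I \<Longrightarrow> \<pi> i \<cdot>\<^bsub>Ab\<^esub> u = \<rho> i"
    using is_product_factors[OF product W, of \<rho>] \<rho> by blast
  note v_fun = Ab_fun_eq[OF v(2) v(1)] and u_fun = Ab_fun_eq[OF u(2) u(1)]
  have uv: "u \<cdot>\<^bsub>Ab\<^esub> v \<in> hom_set Ab P P"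
    by (rule Ab_comp_hom[OF v(1) u(1)])
  have "\<pi> i \<cdot>\<^bsub>Ab\<^esub> (u \<cdot>\<^bsub>Ab\<^esub> v) = \<pi> i" if i: "i \<in> I" for i
    by (rule Ab_arr_eqI[OF Ab_comp_hom[OF uv \<pi>[OF i]] \<pi>[OF i]])
       (simp add: Ab_comp_fun[OF uv] Ab_comp_fun[OF v(1)] u_fun v_fun i Ab_hom_closed[OF v(1)] del: Ab_simps)
  moreover have "\<pi> i \<cdot>\<^bsub>Ab\<^esub> Ident Ab P = \<pi> i" if "i \<in> I" for i
    using \<pi>[OF that] by (rule preadditive_category.comp_ident_right[OF preadditive_Ab])
  ultimately have "u \<cdot>\<^bsub>Ab\<^esub> v = Ident Ab P"
    using is_product_factors[OF product P \<pi>] uv Ab_ident_hom[OF P] by blast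
  then have retract: "\<And>p. p \<in> carrier P \<Longrightarrow> gfun u (gfun v p) = p"
    using Ab_fun_eq[OF _ v(1)] by (simp add: Ab_ident_fun del: Ab_simps)
  obtain w where w: "w \<in> carrier W" "\<forall>i\<in>I. gfun (\<rho> i) w = x i"
    using families x by blast
  show ?thesis
  proof (rule ex1I[of _ "gfun u w"])
    show "gfun u w \<in> carrier P \<and> (\<forall>i\<in>I. gfun (\<pi> i) (gfun u w) = x i)"
      using w u_fun Ab_hom_closed[OF u(1)] by auto
    fix p assume p: "p \<in> carrier P \<and> (\<forall>i\<in>I. gfun (\<pi> i) p = x i)"
    then have "gfun v p \<in> carrier W \<and> (\<forall>i\<in>I. gfun (\<rho> i) (gfun v p) = x i)"
      using v_fun Ab_hom_closed[OF v(1)] by auto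
    then have "gfun v p = w"
      using families x w by blast
    then show "p = gfun u w"
      using retract p by metis
  qed
qed

lemma (in preadditive_category) directed_systemD:
  assumes "directed_system C I r X \<phi>"
  shows "I \<noteq> {}" "\<And>i. i \<in> I \<Longrightarrow> (i, i) \<in> r"
    "\<And>i j k. \<lbrakk>(i, j) \<in> r; (j, k) \<in> r\<rbrakk> \<Longrightarrow> (i, k) \<in> r"
    "\<And>i j. (i, j) \<in> r \<Longrightarrow> i \<in> I \<and> j \<in> I"
    "\<And>i j. \<lbrakk>i \<in> I; j \<in> I\<rbrakk> \<Longrightarrow> \<exists>k\<in>I. (i, k) \<in> r \<and> (j, k) \<in> r"
    "\<And>i. i \<in> I \<Longrightarrow> X i \<in> Obj C"
    "\<And>i j. (i, j) \<in> r \<Longrightarrow> \<phi> i j \<in> hom_set C (X i) (X j)"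
    "\<And>i j k. \<lbrakk>(i, j) \<in> r; (j, k) \<in> r\<rbrakk> \<Longrightarrow> \<phi> j k \<cdot> \<phi> i j = \<phi> i k"
  using assms unfolding directed_system_def preorder_on_def refl_on_def by (auto dest: transD)

locale Ab_directed_system =
  fixes I :: "'i set" and r and X :: "'i \<Rightarrow> 'u monoid" and \<phi>
  assumes directed_system: "directed_system Ab I r X \<phi>"
begin

lemmas system = preadditive_category.directed_systemD[OF preadditive_Ab directed_system]

lemma transition_comp:
  "\<lbrakk>(i, j) \<in> r; (j, k) \<in> r; x \<in> carrier (X i)\<rbrakk> \<Longrightarrow> gfun (\<phi> j k) (gfun (\<phi> i j) x) = gfun (\<phi> i k) x"
  by (rule Ab_fun_eq[OF system(8) system(7)])

lemma transition_closed: "\<lbrakk>(i, j) \<in> r; x \<in> carrier (X i)\<rbrakk> \<Longrightarrow> gfun (\<phi> i j) x \<in> carrier (X j)"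
  by (rule Ab_hom_closed[OF system(7)])

lemma comm_group_stage: "i \<in> I \<Longrightarrow> comm_group (X i)"
  using system(6) by (simp add: Ab_Obj_iff)

end

locale Ab_cocone = Ab_directed_system +
  fixes L :: "'u monoid" and c
  assumes cocone: "is_cocone Ab I r X \<phi> L c"
begin

lemma leg_hom: "i \<in> I \<Longrightarrow> c i \<in> hom_set Ab (X i) L"
  using cocone by (simp add: is_cocone_def)

lemma leg_closed: "\<lbrakk>i \<in> I; x \<in> carrier (X i)\<rbrakk> \<Longrightarrow> gfun (c i) x \<in> carrier L"
  by (rule Ab_hom_closed[OF leg_hom])

lemma leg_transition:
  assumes "(i, j) \<in> r" "x \<in> carrier (X i)" shows "gfun (c j) (gfun (\<phi> i j) x) = gfun (c i) x"
  by (rule Ab_fun_eq[OF _ system(7)]) (use assms cocone in \<open>simp_all add: is_cocone_def\<close>)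

text \<open>By directedness both elements can be moved to a common stage, and there the hypothesis applies to
  their difference.\<close>

lemma eventually_eq:
  assumes kernel: "\<And>i x. \<lbrakk>i \<in> I; x \<in> carrier (X i); gfun (c i) x = \<one>\<^bsub>L\<^esub>\<rbrakk> \<Longrightarrow>
        \<exists>j. (i, j) \<in> r \<and> gfun (\<phi> i j) x = \<one>\<^bsub>X j\<^esub>"
    and i: "i \<in> I" "x \<in> carrier (X i)" and j: "j \<in> I" "y \<in> carrier (X j)"
    and eq: "gfun (c i) x = gfun (c j) y"
  obtains k where "(i, k) \<in> r" "(j, k) \<in> r" "gfun (\<phi> i k) x = gfun (\<phi> j k) y"
proof -
  obtain k where k: "k \<in> I" "(i, k) \<in> r" "(j, k) \<in> r"
    using system(5)[OF i(1) j(1)] by blast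
  let ?x = "gfun (\<phi> i k) x" and ?y = "gfun (\<phi> j k) y"
  have x: "?x \<in> carrier (X k)" and y: "?y \<in> carrier (X k)"
    using transition_closed k i j by auto
  interpret X: comm_group "X k" using comm_group_stage[OF k(1)] .
  interpret c: group_hom "X k" L "gfun (c k)" using Ab_hom_group_hom[OF leg_hom[OF k(1)]] .
  have "gfun (c k) (?x \<otimes>\<^bsub>X k\<^esub> inv\<^bsub>X k\<^esub> ?y) = \<one>\<^bsub>L\<^esub>"
    using leg_transition k i j eq x y leg_closed[OF j] by simp
  then obtain l where l: "(k, l) \<in> r" "gfun (\<phi> k l) (?x \<otimes>\<^bsub>X k\<^esub> inv\<^bsub>X k\<^esub> ?y) = \<one>\<^bsub>X l\<^esub>"
    using kernel[OF k(1)] x y by blast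
  interpret \<phi>: group_hom "X k" "X l" "gfun (\<phi> k l)" using Ab_hom_group_hom[OF system(7)[OF l(1)]] .
  have "gfun (\<phi> k l) ?x = gfun (\<phi> k l) ?y"
    using l(2) x y \<phi>.H.inv_solve_right'[of "\<one>\<^bsub>X l\<^esub>"] by simp
  then have "gfun (\<phi> i l) x = gfun (\<phi> j l) y"
    using transition_comp[OF k(2) l(1) i(2)] transition_comp[OF k(3) l(1) j(2)] by simp
  then show thesis
    using that system(3) k l by blast
qed

end

lemma Ab_direct_limit_of_elementwise:
  fixes L :: "'u monoid"
  assumes "directed_system Ab I r X \<phi>" "is_cocone Ab I r X \<phi> L c"
    and surj: "\<And>l. l \<in> carrier L \<Longrightarrow> \<exists>i\<in>I. \<exists>x\<in>carrier (X i). gfun (c i) x = l"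
    and kernel: "\<And>i x. \<lbrakk>i \<in> I; x \<in> carrier (X i); gfun (c i) x = \<one>\<^bsub>L\<^esub>\<rbrakk> \<Longrightarrow>
        \<exists>j. (i, j) \<in> r \<and> gfun (\<phi> i j) x = \<one>\<^bsub>X j\<^esub>"
  shows "is_direct_limit Ab I r X \<phi> L c"
  unfolding is_direct_limit_def
proof (intro conjI allI impI assms(1,2))
  interpret c: Ab_cocone I r X \<phi> L c by standard fact+
  fix Z :: "'u monoid" and d
  assume "is_cocone Ab I r X \<phi> Z d"
  then interpret d: Ab_cocone I r X \<phi> Z d by unfold_locales
  have L: "L \<in> Obj Ab" using c.cocone by (simp add: is_cocone_def)
  have Z: "Z \<in> Obj Ab" using d.cocone by (simp add: is_cocone_def)
  interpret L: comm_group L using L by (simp add: Ab_Obj_iff)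
  interpret Z: comm_group Z using Z by (simp add: Ab_Obj_iff)
  have well_defined: "gfun (d i) x = gfun (d j) y"
    if "i \<in> I" "x \<in> carrier (X i)" "j \<in> I" "y \<in> carrier (X j)" "gfun (c i) x = gfun (c j) y" for i x j y
  proof (rule c.eventually_eq[OF kernel that])
    fix k assume "(i, k) \<in> r" "(j, k) \<in> r" "gfun (\<phi> i k) x = gfun (\<phi> j k) y"
    then show "gfun (d i) x = gfun (d j) y"
      using d.leg_transition[of i k x] d.leg_transition[of j k y] that by simp
  qed
  define u where "u l = (THE z. \<exists>i\<in>I. \<exists>x\<in>carrier (X i). gfun (c i) x = l \<and> z = gfun (d i) x)" for l
  have u: "u (gfun (c i) x) = gfun (d i) x" if "i \<in> I" "x \<in> carrier (X i)" for i x
    unfolding u_def using that well_defined[OF _ _ that] by (intro the_equality) blast+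
  have "u \<in> hom L Z"
  proof (rule homI)
    fix l m assume l: "l \<in> carrier L" and m: "m \<in> carrier L"
    show "u l \<in> carrier Z"
      using surj[OF l] u d.leg_closed by auto
    obtain i x where i: "i \<in> I" "x \<in> carrier (X i)" "gfun (c i) x = l"
      using surj[OF l] by blast
    obtain j y where j: "j \<in> I" "y \<in> carrier (X j)" "gfun (c j) y = m"
      using surj[OF m] by blast
    obtain k where k: "k \<in> I" "(i, k) \<in> r" "(j, k) \<in> r"
      using c.system(5)[OF i(1) j(1)] by blast
    let ?x = "gfun (\<phi> i k) x" and ?y = "gfun (\<phi> j k) y"
    have x: "?x \<in> carrier (X k)" and y: "?y \<in> carrier (X k)"
      using c.transition_closed k i j by auto
    have xy: "?x \<otimes>\<^bsub>X k\<^esub> ?y \<in> carrier (X k)"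
      using comm_groupE(1)[OF c.comm_group_stage[OF k(1)] x y] .
    have "l \<otimes>\<^bsub>L\<^esub> m = gfun (c k) (?x \<otimes>\<^bsub>X k\<^esub> ?y)"
      using hom_mult[OF Ab_homD(5)[OF c.leg_hom[OF k(1)]] x y] c.leg_transition k i j by simp
    moreover have "u l \<otimes>\<^bsub>Z\<^esub> u m = gfun (d k) (?x \<otimes>\<^bsub>X k\<^esub> ?y)"
      using hom_mult[OF Ab_homD(5)[OF d.leg_hom[OF k(1)]] x y] d.leg_transition k i j u by auto
    ultimately show "u (l \<otimes>\<^bsub>L\<^esub> m) = u l \<otimes>\<^bsub>Z\<^esub> u m"
      using u[OF k(1) xy] by simp
  qed
  then have hom: "GMap L Z (restrict u (carrier L)) \<in> hom_set Ab L Z"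
    by (rule GMap_hom_Ab[OF L Z])
  show "\<exists>!u. u \<in> hom_set Ab L Z \<and> (\<forall>i\<in>I. u \<cdot>\<^bsub>Ab\<^esub> c i = d i)"
  proof (rule ex1I)
    show "GMap L Z (restrict u (carrier L)) \<in> hom_set Ab L Z \<and>
        (\<forall>i\<in>I. GMap L Z (restrict u (carrier L)) \<cdot>\<^bsub>Ab\<^esub> c i = d i)"
    proof (intro conjI ballI hom)
      fix i assume i: "i \<in> I"
      show "GMap L Z (restrict u (carrier L)) \<cdot>\<^bsub>Ab\<^esub> c i = d i"
        by (rule Ab_arr_eqI[OF Ab_comp_hom[OF c.leg_hom[OF i] hom] d.leg_hom[OF i]])
           (use u i c.leg_closed in \<open>simp add: Ab_comp_fun[OF c.leg_hom[OF i]] del: Ab_simps\<close>)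
    qed
  next
    fix v assume v: "v \<in> hom_set Ab L Z \<and> (\<forall>i\<in>I. v \<cdot>\<^bsub>Ab\<^esub> c i = d i)"
    show "v = GMap L Z (restrict u (carrier L))"
    proof (rule Ab_arr_eqI[OF _ hom])
      fix l assume l: "l \<in> carrier L"
      then obtain i x where i: "i \<in> I" "x \<in> carrier (X i)" "gfun (c i) x = l"
        using surj by blast
      have "gfun v l = gfun (d i) x"
        using Ab_fun_eq[OF _ c.leg_hom[OF i(1)] i(2), of v "d i"] v i by blast
      then show "gfun v l = gfun (GMap L Z (restrict u (carrier L))) l"
        using u[OF i(1,2)] i l by simp
    qed (use v in blast)
  qed
qed

lemma is_direct_limit_factors:
  assumes "is_direct_limit C I r X \<phi> L c" "is_cocone C I r X \<phi> Z d"
  shows "\<exists>!u. u \<in> hom_set C L Z \<and> (\<forall>i\<in>I. u \<cdot>\<^bsub>C\<^esub> c i = d i)"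
  using assms by (simp add: is_direct_limit_def)

lemma (in Ab_directed_system) zero_cocone:
  assumes "Z \<in> Obj Ab" shows "is_cocone Ab I r X \<phi> Z (\<lambda>i. Zro Ab (X i) Z)"
  unfolding is_cocone_def
proof (intro conjI ballI allI impI assms)
  fix i assume "i \<in> I"
  then show "Zro Ab (X i) Z \<in> hom_set Ab (X i) Z"
    using Ab_zero_hom system(6) assms by blast
next
  fix i j assume ij: "(i, j) \<in> r"
  have zero: "Zro Ab (X i) Z \<in> hom_set Ab (X i) Z" "Zro Ab (X j) Z \<in> hom_set Ab (X j) Z"
    using Ab_zero_hom system(4)[OF ij] system(6) assms by blast+
  show "Zro Ab (X j) Z \<cdot>\<^bsub>Ab\<^esub> \<phi> i j = Zro Ab (X i) Z"
    by (rule Ab_arr_eqI[OF Ab_comp_hom[OF system(7)[OF ij] zero(2)] zero(1)])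
       (simp add: Ab_comp_fun[OF system(7)[OF ij]] Ab_zero_fun transition_closed[OF ij] del: Ab_simps)
qed

text \<open>The elements coming from some stage form a subgroup of the direct limit, and the quotient by it
  receives only the zero map.\<close>

lemma Ab_direct_limit_surj:
  fixes L :: "'u monoid"
  assumes limit: "is_direct_limit Ab I r X \<phi> L c" and l: "l \<in> carrier L"
  shows "\<exists>i\<in>I. \<exists>x\<in>carrier (X i). gfun (c i) x = l"
proof -
  interpret Ab_cocone I r X \<phi> L c
    using limit by unfold_locales (simp_all add: is_direct_limit_def)
  have L: "L \<in> Obj Ab" using cocone by (simp add: is_cocone_def)
  interpret L: comm_group L using L by (simp add: Ab_Obj_iff)
  define N where "N = {l. \<exists>i\<in>I. \<exists>x\<in>carrier (X i). gfun (c i) x = l}"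
  have N: "subgroup N L"
  proof (rule L.subgroupI)
    show "N \<subseteq> carrier L"
      using leg_closed by (auto simp: N_def)
    obtain i where i: "i \<in> I" using system(1) by blast
    show "N \<noteq> {}"
      using i comm_groupE(2)[OF comm_group_stage[OF i]] by (auto simp: N_def)
  next
    fix a assume "a \<in> N"
    then obtain i x where i: "i \<in> I" "x \<in> carrier (X i)" "gfun (c i) x = a"
      by (auto simp: N_def)
    interpret c: group_hom "X i" L "gfun (c i)" using Ab_hom_group_hom[OF leg_hom[OF i(1)]] .
    have "gfun (c i) (inv\<^bsub>X i\<^esub> x) = inv\<^bsub>L\<^esub> a" "inv\<^bsub>X i\<^esub> x \<in> carrier (X i)"
      using i by simp_all
    then show "inv\<^bsub>L\<^esub> a \<in> N"
      using i(1) by (auto simp: N_def)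
  next
    fix a b assume "a \<in> N" "b \<in> N"
    then obtain i x j y where i: "i \<in> I" "x \<in> carrier (X i)" "gfun (c i) x = a"
      and j: "j \<in> I" "y \<in> carrier (X j)" "gfun (c j) y = b"
      by (auto simp: N_def)
    obtain k where k: "k \<in> I" "(i, k) \<in> r" "(j, k) \<in> r"
      using system(5)[OF i(1) j(1)] by blast
    interpret c: group_hom "X k" L "gfun (c k)" using Ab_hom_group_hom[OF leg_hom[OF k(1)]] .
    let ?z = "gfun (\<phi> i k) x \<otimes>\<^bsub>X k\<^esub> gfun (\<phi> j k) y"
    have "gfun (c k) ?z = a \<otimes>\<^bsub>L\<^esub> b" "?z \<in> carrier (X k)"
      using transition_closed leg_transition i j k by simp_all
    then show "a \<otimes>\<^bsub>L\<^esub> b \<in> N"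
      using k(1) by (auto simp: N_def)
  qed
  obtain Q :: "'u monoid" and q where Q: "Q \<in> Obj Ab" and q: "q \<in> hom L Q" "q ` carrier L = carrier Q"
    and kernel: "\<forall>l\<in>carrier L. q l = \<one>\<^bsub>Q\<^esub> \<longleftrightarrow> l \<in> N"
    by (rule Ab_quotient[OF L N])
  define q' where "q' = GMap L Q (restrict q (carrier L))"
  have q': "q' \<in> hom_set Ab L Q" "\<And>l. l \<in> carrier L \<Longrightarrow> gfun q' l = q l"
    using GMap_hom_Ab[OF L Q q(1)] by (simp_all add: q'_def)
  have zero: "Zro Ab L Q \<in> hom_set Ab L Q"
    by (rule Ab_zero_hom[OF L Q])
  have stage_zero: "Zro Ab (X i) Q \<in> hom_set Ab (X i) Q" if "i \<in> I" for i
    by (rule Ab_zero_hom[OF system(6)[OF that] Q])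
  have "q' \<cdot>\<^bsub>Ab\<^esub> c i = Zro Ab (X i) Q" if i: "i \<in> I" for i
  proof (rule Ab_arr_eqI[OF Ab_comp_hom[OF leg_hom[OF i] q'(1)] stage_zero[OF i]])
    fix x assume x: "x \<in> carrier (X i)"
    then have "gfun (c i) x \<in> N"
      using i by (auto simp: N_def)
    then show "gfun (q' \<cdot>\<^bsub>Ab\<^esub> c i) x = gfun (Zro Ab (X i) Q) x"
      using kernel leg_closed[OF i x] x
      by (simp add: Ab_comp_fun[OF leg_hom[OF i]] q'(2) Ab_zero_fun del: Ab_simps)
  qed
  moreover have "Zro Ab L Q \<cdot>\<^bsub>Ab\<^esub> c i = Zro Ab (X i) Q" if i: "i \<in> I" for i
    by (rule Ab_arr_eqI[OF Ab_comp_hom[OF leg_hom[OF i] zero] stage_zero[OF i]])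
       (simp add: Ab_comp_fun[OF leg_hom[OF i]] Ab_zero_fun leg_closed[OF i] del: Ab_simps)
  ultimately have "q' = Zro Ab L Q"
    using is_direct_limit_factors[OF limit zero_cocone[OF Q]] q'(1) zero by blast
  then have "q l = \<one>\<^bsub>Q\<^esub>"
    using q'(2)[OF l] l by (simp add: Ab_zero_fun del: Ab_simps)
  then show ?thesis
    using kernel l by (simp add: N_def)
qed

text \<open>The group of families modulo those that vanish from some index on (the reduced product) receives a
  cocone in which only those elements die that die at some stage.\<close>

lemma Ab_direct_limit_kernel:
  fixes I :: "'u set" and X :: "'u \<Rightarrow> 'u monoid"
  assumes universe: "universe TYPE('u)" and I: "small TYPE('u) I"
    and limit: "is_direct_limit Ab I r X \<phi> L c"
    and i: "i \<in> I" and x: "x \<in> carrier (X i)" and dies: "gfun (c i) x = \<one>\<^bsub>L\<^esub>"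
  shows "\<exists>j. (i, j) \<in> r \<and> gfun (\<phi> i j) x = \<one>\<^bsub>X j\<^esub>"
proof -
  interpret Ab_cocone I r X \<phi> L c
    using limit by unfold_locales (simp_all add: is_direct_limit_def)
  obtain W \<rho> where W: "W \<in> Obj Ab" and \<rho>: "\<forall>i\<in>I. \<rho> i \<in> hom_set Ab W (X i)"
    and families: "\<forall>x. (\<forall>i\<in>I. x i \<in> carrier (X i)) \<longrightarrow>
          (\<exists>!w. w \<in> carrier W \<and> (\<forall>i\<in>I. gfun (\<rho> i) w = x i))"
    by (rule Ab_product_exists[OF universe I system(6)])
  interpret W: comm_group W using W by (simp add: Ab_Obj_iff)
  have \<rho>_group_hom: "group_hom W (X i) (gfun (\<rho> i))" if "i \<in> I" for i
    using \<rho> that Ab_hom_group_hom by blast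
  define N where "N = {w \<in> carrier W. \<exists>i\<in>I. \<forall>j. (i, j) \<in> r \<longrightarrow> gfun (\<rho> j) w = \<one>\<^bsub>X j\<^esub>}"
  have N: "subgroup N W"
  proof (rule W.subgroupI)
    have "gfun (\<rho> j) \<one>\<^bsub>W\<^esub> = \<one>\<^bsub>X j\<^esub>" if "(i, j) \<in> r" for j
      using group_hom.hom_one[OF \<rho>_group_hom] system(4)[OF that] by blast
    then show "N \<noteq> {}"
      using i by (auto simp: N_def)
  next
    fix w assume "w \<in> N"
    then obtain i where w: "w \<in> carrier W" and i: "i \<in> I"
      "\<And>j. (i, j) \<in> r \<Longrightarrow> gfun (\<rho> j) w = \<one>\<^bsub>X j\<^esub>"
      by (auto simp: N_def)
    have "gfun (\<rho> j) (inv\<^bsub>W\<^esub> w) = \<one>\<^bsub>X j\<^esub>" if j: "(i, j) \<in> r" for j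
    proof -
      interpret group_hom W "X j" "gfun (\<rho> j)" using \<rho>_group_hom system(4)[OF j] by blast
      show ?thesis using i(2)[OF j] w by simp
    qed
    then show "inv\<^bsub>W\<^esub> w \<in> N"
      using w i(1) by (auto simp: N_def)
  next
    fix v w assume "v \<in> N" "w \<in> N"
    then obtain i i' where v: "v \<in> carrier W" and i: "i \<in> I"
      "\<And>j. (i, j) \<in> r \<Longrightarrow> gfun (\<rho> j) v = \<one>\<^bsub>X j\<^esub>"
      and w: "w \<in> carrier W" and i': "i' \<in> I"
      "\<And>j. (i', j) \<in> r \<Longrightarrow> gfun (\<rho> j) w = \<one>\<^bsub>X j\<^esub>"
      by (auto simp: N_def)
    obtain k where k: "k \<in> I" "(i, k) \<in> r" "(i', k) \<in> r"
      using system(5)[OF i(1) i'(1)] by blast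
    have "gfun (\<rho> j) (v \<otimes>\<^bsub>W\<^esub> w) = \<one>\<^bsub>X j\<^esub>" if j: "(k, j) \<in> r" for j
    proof -
      interpret group_hom W "X j" "gfun (\<rho> j)" using \<rho>_group_hom system(4)[OF j] by blast
      show ?thesis using i(2)[OF system(3)[OF k(2) j]] i'(2)[OF system(3)[OF k(3) j]] v w by simp
    qed
    then show "v \<otimes>\<^bsub>W\<^esub> w \<in> N"
      using v w k(1) by (auto simp: N_def)
  qed (auto simp: N_def)
  obtain Q :: "'u monoid" and q where Q: "Q \<in> Obj Ab" and q: "q \<in> hom W Q" "q ` carrier W = carrier Q"
    and kernel: "\<forall>w\<in>carrier W. q w = \<one>\<^bsub>Q\<^esub> \<longleftrightarrow> w \<in> N"
    by (rule Ab_quotient[OF W N])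
  interpret q: group_hom W Q q
    using Q q by (auto simp: Ab_Obj_iff comm_group_def intro!: group_hom.intro group_hom_axioms.intro)
  define tail where "tail i x j = (if (i, j) \<in> r then gfun (\<phi> i j) x else \<one>\<^bsub>X j\<^esub>)" for i x j
  define t where "t i x = (THE w. w \<in> carrier W \<and> (\<forall>j\<in>I. gfun (\<rho> j) w = tail i x j))" for i x
  have tail_family: "\<exists>!w. w \<in> carrier W \<and> (\<forall>j\<in>I. gfun (\<rho> j) w = tail i x j)"
    if "x \<in> carrier (X i)" for i x
  proof -
    have "\<forall>j\<in>I. tail i x j \<in> carrier (X j)"
      using transition_closed that comm_groupE(2)[OF comm_group_stage] by (auto simp: tail_def)
    with families show ?thesis by blast
  qed
  have t: "t i x \<in> carrier W" "\<And>j. j \<in> I \<Longrightarrow> gfun (\<rho> j) (t i x) = tail i x j"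
    if "x \<in> carrier (X i)" for i x
    using theI'[OF tail_family[OF that]] by (auto simp: t_def)
  define d where "d i = GMap (X i) Q (\<lambda>x\<in>carrier (X i). q (t i x))" for i
  have d_hom: "d i \<in> hom_set Ab (X i) Q" if i: "i \<in> I" for i
    unfolding d_def
  proof (rule GMap_hom_Ab[OF system(6)[OF i] Q], rule homI)
    fix x y assume x: "x \<in> carrier (X i)" and y: "y \<in> carrier (X i)"
    interpret X: comm_group "X i" using comm_group_stage[OF i] .
    have "gfun (\<rho> j) (t i x \<otimes>\<^bsub>W\<^esub> t i y) = tail i (x \<otimes>\<^bsub>X i\<^esub> y) j" if j: "j \<in> I" for j
    proof -
      interpret \<rho>: group_hom W "X j" "gfun (\<rho> j)" using \<rho>_group_hom[OF j] .
      have "gfun (\<phi> i j) (x \<otimes>\<^bsub>X i\<^esub> y) = gfun (\<phi> i j) x \<otimes>\<^bsub>X j\<^esub> gfun (\<phi> i j) y" if "(i, j) \<in> r"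
        using hom_mult[OF Ab_homD(5)[OF system(7)[OF that]] x y] .
      then show ?thesis
        using t[OF x] t[OF y] j by (simp add: tail_def)
    qed
    then have "t i (x \<otimes>\<^bsub>X i\<^esub> y) = t i x \<otimes>\<^bsub>W\<^esub> t i y"
      using tail_family[OF X.m_closed[OF x y]] t[OF X.m_closed[OF x y]] t(1)[OF x] t(1)[OF y]
      by blast
    then show "q (t i (x \<otimes>\<^bsub>X i\<^esub> y)) = q (t i x) \<otimes>\<^bsub>Q\<^esub> q (t i y)"
      using t(1)[OF x] t(1)[OF y] by simp
  qed (use t in auto)
  have d_fun: "gfun (d i) x = q (t i x)" if "x \<in> carrier (X i)" for i x
    using that by (simp add: d_def)
  have "is_cocone Ab I r X \<phi> Q d"
    unfolding is_cocone_def
  proof (intro conjI ballI allI impI Q d_hom)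
    fix i j assume ij: "(i, j) \<in> r"
    have i: "i \<in> I" and j: "j \<in> I" using system(4)[OF ij] by auto
    show "d j \<cdot>\<^bsub>Ab\<^esub> \<phi> i j = d i"
    proof (rule Ab_arr_eqI[OF Ab_comp_hom[OF system(7)[OF ij] d_hom[OF j]] d_hom[OF i]])
      fix x assume x: "x \<in> carrier (X i)"
      let ?y = "gfun (\<phi> i j) x"
      have y: "?y \<in> carrier (X j)" by (rule transition_closed[OF ij x])
      have "gfun (\<rho> k) (t j ?y \<otimes>\<^bsub>W\<^esub> inv\<^bsub>W\<^esub> t i x) = \<one>\<^bsub>X k\<^esub>" if jk: "(j, k) \<in> r" for k
      proof -
        have k: "k \<in> I" using system(4)[OF jk] by blast
        interpret \<rho>: group_hom W "X k" "gfun (\<rho> k)" using \<rho>_group_hom[OF k] .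
        show ?thesis
          using t[OF x] t[OF y] k jk system(3)[OF ij jk] transition_comp[OF ij jk x]
            transition_closed[OF system(3)[OF ij jk] x] by (simp add: tail_def)
      qed
      then have "t j ?y \<otimes>\<^bsub>W\<^esub> inv\<^bsub>W\<^esub> t i x \<in> N"
        using t(1)[OF x] t(1)[OF y] j by (auto simp: N_def)
      then have "q (t j ?y) \<otimes>\<^bsub>Q\<^esub> inv\<^bsub>Q\<^esub> q (t i x) = \<one>\<^bsub>Q\<^esub>"
        using kernel t(1)[OF x] t(1)[OF y] by (simp flip: q.hom_inv q.hom_mult)
      then have "q (t j ?y) = q (t i x)"
        using t(1)[OF x] t(1)[OF y] q.H.inv_solve_right'[of "\<one>\<^bsub>Q\<^esub>"] by simp
      then show "gfun (d j \<cdot>\<^bsub>Ab\<^esub> \<phi> i j) x = gfun (d i) x"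
        using d_fun[OF x] d_fun[OF y] by (simp add: Ab_comp_fun[OF system(7)[OF ij] x] del: Ab_simps)
    qed
  qed
  from is_direct_limit_factors[OF limit this]
  obtain u where u: "u \<in> hom_set Ab L Q" "\<forall>i\<in>I. u \<cdot>\<^bsub>Ab\<^esub> c i = d i"
    by blast
  have "gfun (d i) x = \<one>\<^bsub>Q\<^esub>"
    using Ab_fun_eq[OF _ leg_hom[OF i] x, of u "d i"] u i dies group_hom.hom_one[OF Ab_hom_group_hom[OF u(1)]]
    by simp
  then have "t i x \<in> N"
    using d_fun[OF x] kernel t(1)[OF x] by simp
  then obtain i' where i': "i' \<in> I" "\<And>j. (i', j) \<in> r \<Longrightarrow> gfun (\<rho> j) (t i x) = \<one>\<^bsub>X j\<^esub>"
    by (auto simp: N_def)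
  obtain k where k: "k \<in> I" "(i, k) \<in> r" "(i', k) \<in> r"
    using system(5)[OF i i'(1)] by blast
  have "gfun (\<phi> i k) x = \<one>\<^bsub>X k\<^esub>"
    using t(2)[OF x k(1)] i'(2)[OF k(3)] k(2) by (simp add: tail_def)
  with k(2) show ?thesis by blast
qed

section \<open>Functors to abelian groups and their natural transformations\<close>

abbreviation act :: "('o, 'a, 'u monoid, 'u gmap) func \<Rightarrow> 'a \<Rightarrow> 'u \<Rightarrow> 'u" where
  "act F f \<equiv> gfun (FA F f)"

abbreviation cpt :: "('o, 'a, 'u monoid, 'u gmap) nat_trans \<Rightarrow> 'o \<Rightarrow> 'u \<Rightarrow> 'u" where
  "cpt \<alpha> A \<equiv> gfun (NMap \<alpha> A)"

lemma (in additive_functor) FA_directed_system: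
  assumes system: "directed_system C I r X \<phi>"
  shows "directed_system D I r (\<lambda>i. FO F (X i)) (\<lambda>i j. FA F (\<phi> i j))"
  using assms unfolding directed_system_def
proof (elim conjE, intro conjI)
  note sys = S.directed_systemD[OF system]
  show "\<forall>i\<in>I. FO F (X i) \<in> Obj D \<and> FA F (\<phi> i i) = Ident D (FO F (X i))"
    using system FO_obj FA_ident by (simp add: directed_system_def)
  show "\<forall>i j. (i, j) \<in> r \<longrightarrow> FA F (\<phi> i j) \<in> hom_set D (FO F (X i)) (FO F (X j))"
    using FA_hom[OF sys(7)] by blast
  show "\<forall>i j k. (i, j) \<in> r \<longrightarrow> (j, k) \<in> r \<longrightarrow> FA F (\<phi> j k) \<cdot>\<^bsub>D\<^esub> FA F (\<phi> i j) = FA F (\<phi> i k)"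
    using FA_comp[OF sys(7) sys(7)] sys(8) by simp
qed

lemma (in additive_functor) FA_cocone:
  assumes system: "directed_system C I r X \<phi>" and cocone: "is_cocone C I r X \<phi> L c"
  shows "is_cocone D I r (\<lambda>i. FO F (X i)) (\<lambda>i j. FA F (\<phi> i j)) (FO F L) (\<lambda>i. FA F (c i))"
proof -
  note sys = S.directed_systemD[OF system]
  have c: "L \<in> Obj C" "\<And>i. i \<in> I \<Longrightarrow> c i \<in> hom_set C (X i) L"
    "\<And>i j. (i, j) \<in> r \<Longrightarrow> c j \<cdot>\<^bsub>C\<^esub> \<phi> i j = c i"
    using cocone by (simp_all add: is_cocone_def)
  have "FA F (c j) \<cdot>\<^bsub>D\<^esub> FA F (\<phi> i j) = FA F (c i)" if "(i, j) \<in> r" for i j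
    using FA_comp[OF sys(7)[OF that] c(2)] c(3)[OF that] sys(4)[OF that] by simp
  then show ?thesis
    using c FO_obj FA_hom by (simp add: is_cocone_def)
qed

locale Ab_functor = additive_functor S Ab F
  for S :: "('o, 'a) precat" and F :: "('o, 'a, 'u monoid, 'u gmap) func"
begin

lemma value_comm_group: "A \<in> Obj S \<Longrightarrow> comm_group (FO F A)"
  using FO_obj by (simp add: Ab_Obj_iff)

lemma act_closed: "\<lbrakk>f \<in> hom_set S A B; x \<in> carrier (FO F A)\<rbrakk> \<Longrightarrow> act F f x \<in> carrier (FO F B)"
  by (rule Ab_hom_closed[OF FA_hom])

lemma act_hom: "f \<in> hom_set S A B \<Longrightarrow> act F f \<in> hom (FO F A) (FO F B)"
  by (rule Ab_homD(5)[OF FA_hom])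

lemma act_group_hom: "f \<in> hom_set S A B \<Longrightarrow> group_hom (FO F A) (FO F B) (act F f)"
  by (rule Ab_hom_group_hom[OF FA_hom])

lemma act_one: "f \<in> hom_set S A B \<Longrightarrow> act F f \<one>\<^bsub>FO F A\<^esub> = \<one>\<^bsub>FO F B\<^esub>"
  by (rule group_hom.hom_one[OF act_group_hom])

lemma act_ident: "\<lbrakk>A \<in> Obj S; x \<in> carrier (FO F A)\<rbrakk> \<Longrightarrow> act F (Ident S A) x = x"
  by (simp add: FA_ident)

lemma act_comp:
  assumes "f \<in> hom_set S A B" "g \<in> hom_set S B E" "x \<in> carrier (FO F A)"
  shows "act F (g \<cdot>\<^bsub>S\<^esub> f) x = act F g (act F f x)"
  unfolding FA_comp[OF assms(1,2)] by (rule Ab_comp_fun[OF FA_hom[OF assms(1)] assms(3)])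

lemma act_plus:
  assumes "f \<in> hom_set S A B" "g \<in> hom_set S A B" "x \<in> carrier (FO F A)"
  shows "act F (f \<boxplus>\<^bsub>S\<^esub> g) x = act F f x \<otimes>\<^bsub>FO F B\<^esub> act F g x"
  unfolding FA_plus[OF assms(1,2)] by (rule Ab_plus_fun[OF FA_hom[OF assms(1)] assms(3)])

end

lemma Ab_functor_iff: "additive_functor S Ab F \<longleftrightarrow> Ab_functor S F"
  by (simp add: Ab_functor_def)

text \<open>A functor given by its action on elements; the maps are cut down to the carriers because the arrows
  of \<open>Ab\<close> are extensional.\<close>

definition make_functor ::
    "('o, 'a) precat \<Rightarrow> ('o \<Rightarrow> 'u monoid) \<Rightarrow> ('a \<Rightarrow> 'u \<Rightarrow> 'u) \<Rightarrow> ('o, 'a, 'u monoid, 'u gmap) func" where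
  "make_functor S K t = \<lparr>FO = K,
     FA = (\<lambda>f. GMap (K (Src S f)) (K (Tgt S f)) (restrict (t f) (carrier (K (Src S f)))))\<rparr>"

lemma make_functor_simps:
  "FO (make_functor S K t) = K"
  "\<lbrakk>f \<in> hom_set S A B; x \<in> carrier (K A)\<rbrakk> \<Longrightarrow> act (make_functor S K t) f x = t f x"
  by (auto simp: make_functor_def hom_set_def)

lemma make_functor_Ab_functor:
  fixes S :: "('o, 'a) precat" and K :: "'o \<Rightarrow> 'u monoid"
  assumes "preadditive_category S"
    and obj: "\<And>A. A \<in> Obj S \<Longrightarrow> K A \<in> Obj Ab"
    and hom: "\<And>f A B. f \<in> hom_set S A B \<Longrightarrow> t f \<in> hom (K A) (K B)"
    and ident: "\<And>A x. \<lbrakk>A \<in> Obj S; x \<in> carrier (K A)\<rbrakk> \<Longrightarrow> t (Ident S A) x = x"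
    and comp: "\<And>f g A B E x. \<lbrakk>f \<in> hom_set S A B; g \<in> hom_set S B E; x \<in> carrier (K A)\<rbrakk>
        \<Longrightarrow> t (g \<cdot>\<^bsub>S\<^esub> f) x = t g (t f x)"
    and plus: "\<And>f g A B x. \<lbrakk>f \<in> hom_set S A B; g \<in> hom_set S A B; x \<in> carrier (K A)\<rbrakk>
        \<Longrightarrow> t (f \<boxplus>\<^bsub>S\<^esub> g) x = t f x \<otimes>\<^bsub>K B\<^esub> t g x"
  shows "Ab_functor S (make_functor S K t)"
proof -
  interpret S: preadditive_category S by fact
  let ?F = "make_functor S K t"
  have FA: "FA ?F f \<in> hom_set Ab (K A) (K B)" if f: "f \<in> hom_set S A B" for f A B
    using GMap_hom_Ab[OF obj obj hom[OF f]] S.hom_set_objs[OF f] hom_setD[OF f]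
    by (simp add: make_functor_def)
  note fun_simps = make_functor_simps(2)
  show ?thesis
    unfolding Ab_functor_iff[symmetric]
  proof (rule additive_functor.intro[OF S.preadditive_category_axioms preadditive_Ab],
      rule additive_functor_axioms.intro, unfold make_functor_simps(1))
    fix A assume A: "A \<in> Obj S"
    show "FA ?F (Ident S A) = Ident Ab (K A)"
      by (rule Ab_arr_eqI[OF FA[OF S.ident_hom[OF A]] Ab_ident_hom[OF obj[OF A]]])
         (simp add: fun_simps[OF S.ident_hom[OF A]] ident[OF A] Ab_ident_fun del: Ab_simps)
  next
    fix f g A B E assume f: "f \<in> hom_set S A B" and g: "g \<in> hom_set S B E"
    note gf = S.comp_hom[OF f g]
    show "FA ?F (g \<cdot>\<^bsub>S\<^esub> f) = FA ?F g \<cdot>\<^bsub>Ab\<^esub> FA ?F f"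
      by (rule Ab_arr_eqI[OF FA[OF gf] Ab_comp_hom[OF FA[OF f] FA[OF g]]])
         (simp add: fun_simps[OF f] fun_simps[OF g] fun_simps[OF gf] Ab_comp_fun[OF FA[OF f]]
            comp[OF f g] hom_in_carrier[OF hom[OF f]] del: Ab_simps)
  next
    fix f g A B assume f: "f \<in> hom_set S A B" and g: "g \<in> hom_set S A B"
    have "comm_group (hom_group S A B)"
      using S.hom_comm_group S.hom_set_objs[OF f] by blast
    then have fg: "f \<boxplus>\<^bsub>S\<^esub> g \<in> hom_set S A B"
      using comm_groupE(1)[of "hom_group S A B" f g] f g by (simp add: hom_group_def)
    show "FA ?F (f \<boxplus>\<^bsub>S\<^esub> g) = FA ?F f \<boxplus>\<^bsub>Ab\<^esub> FA ?F g"
      by (rule Ab_arr_eqI[OF FA[OF fg] Ab_plus_hom[OF FA[OF f] FA[OF g]]])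
         (simp add: fun_simps[OF f] fun_simps[OF g] fun_simps[OF fg] Ab_plus_fun[OF FA[OF f]]
            plus[OF f g] del: Ab_simps)
  qed (use obj FA in auto)
qed

lemma hom_set_functor_cat:
  "\<alpha> \<in> hom_set (functor_cat S D) F G \<longleftrightarrow>
     additive_functor S D F \<and> additive_functor S D G \<and> NSrc \<alpha> = F \<and> NTgt \<alpha> = G \<and> natural S D \<alpha>"
  by (auto simp: hom_set_def functor_cat_def)

lemma Obj_functor_cat: "F \<in> Obj (functor_cat S D) \<longleftrightarrow> additive_functor S D F"
  by (simp add: functor_cat_def)

lemma Src_Tgt_functor_cat [simp]: "Src (functor_cat S D) = NSrc" "Tgt (functor_cat S D) = NTgt"
  by (simp_all add: functor_cat_def)

definition make_nat :: "('o, 'a) precat \<Rightarrow> ('o, 'a, 'u monoid, 'u gmap) func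
    \<Rightarrow> ('o, 'a, 'u monoid, 'u gmap) func \<Rightarrow> ('o \<Rightarrow> 'u \<Rightarrow> 'u) \<Rightarrow> ('o, 'a, 'u monoid, 'u gmap) nat_trans" where
  "make_nat S F G t = \<lparr>NSrc = F, NTgt = G,
     NMap = (\<lambda>A\<in>Obj S. GMap (FO F A) (FO G A) (restrict (t A) (carrier (FO F A))))\<rparr>"

lemma cpt_make_nat: "\<lbrakk>A \<in> Obj S; x \<in> carrier (FO F A)\<rbrakk> \<Longrightarrow> cpt (make_nat S F G t) A x = t A x"
  by (simp add: make_nat_def)

lemma NMap_hom:
  "\<lbrakk>\<alpha> \<in> hom_set (functor_cat S D) F G; A \<in> Obj S\<rbrakk> \<Longrightarrow> NMap \<alpha> A \<in> hom_set D (FO F A) (FO G A)"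
  by (auto simp: hom_set_functor_cat natural_def)

lemma cpt_closed:
  "\<lbrakk>\<alpha> \<in> hom_set (functor_cat S Ab) F G; A \<in> Obj S; x \<in> carrier (FO F A)\<rbrakk>
    \<Longrightarrow> cpt \<alpha> A x \<in> carrier (FO G A)"
  by (rule Ab_hom_closed[OF NMap_hom])

lemma cpt_group_hom:
  "\<lbrakk>\<alpha> \<in> hom_set (functor_cat S Ab) F G; A \<in> Obj S\<rbrakk> \<Longrightarrow> group_hom (FO F A) (FO G A) (cpt \<alpha> A)"
  by (rule Ab_hom_group_hom[OF NMap_hom])

lemma cpt_natural:
  assumes \<alpha>: "\<alpha> \<in> hom_set (functor_cat S Ab) F G" and f: "f \<in> hom_set S A B" and x: "x \<in> carrier (FO F A)"
  shows "cpt \<alpha> B (act F f x) = act G f (cpt \<alpha> A x)"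
proof -
  interpret F: additive_functor S Ab F using \<alpha> by (simp add: hom_set_functor_cat)
  have "NMap \<alpha> B \<cdot>\<^bsub>Ab\<^esub> FA F f = FA G f \<cdot>\<^bsub>Ab\<^esub> NMap \<alpha> A"
    using \<alpha> hom_setD[OF f] by (auto simp: hom_set_functor_cat natural_def)
  from Ab_fun_eq[OF this F.FA_hom[OF f] x] show ?thesis
    using Ab_comp_fun[OF NMap_hom[OF \<alpha> F.S.hom_set_objs(1)[OF f]] x] by simp
qed

lemma make_nat_hom:
  assumes F: "Ab_functor S F" and G: "Ab_functor S G"
    and hom: "\<And>A. A \<in> Obj S \<Longrightarrow> t A \<in> hom (FO F A) (FO G A)"
    and natural: "\<And>f A B x. \<lbrakk>f \<in> hom_set S A B; x \<in> carrier (FO F A)\<rbrakk>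
        \<Longrightarrow> t B (act F f x) = act G f (t A x)"
  shows "make_nat S F G t \<in> hom_set (functor_cat S Ab) F G"
proof -
  interpret F: Ab_functor S F by fact
  interpret G: Ab_functor S G by fact
  let ?\<alpha> = "make_nat S F G t"
  have NMap: "NMap ?\<alpha> A \<in> hom_set Ab (FO F A) (FO G A)" if "A \<in> Obj S" for A
    using GMap_hom_Ab[OF F.FO_obj G.FO_obj hom] that by (simp add: make_nat_def)
  have "NMap ?\<alpha> (Tgt S f) \<cdot>\<^bsub>Ab\<^esub> FA F f = FA G f \<cdot>\<^bsub>Ab\<^esub> NMap ?\<alpha> (Src S f)" if "f \<in> Arr S" for f
  proof -
    have f: "f \<in> hom_set S (Src S f) (Tgt S f)"
      using that by (simp add: hom_set_def)
    note AB = F.S.hom_set_objs[OF f]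
    show ?thesis
      by (rule Ab_arr_eqI[OF Ab_comp_hom[OF F.FA_hom[OF f] NMap] Ab_comp_hom[OF NMap G.FA_hom[OF f]]])
         (simp_all add: AB Ab_comp_fun[OF F.FA_hom[OF f]] Ab_comp_fun[OF NMap[OF AB(1)]] F.act_closed[OF f]
            cpt_make_nat natural[OF f] del: Ab_simps)
  qed
  moreover have "NSrc ?\<alpha> = F" "NTgt ?\<alpha> = G" "NMap ?\<alpha> \<in> extensional (Obj S)"
    by (simp_all add: make_nat_def)
  ultimately show ?thesis
    using NMap F.additive_functor_axioms G.additive_functor_axioms
    by (simp add: hom_set_functor_cat natural_def del: Ab_simps)
qed

lemma nat_trans_eqI:
  assumes "\<alpha> \<in> hom_set (functor_cat S Ab) F G" "\<beta> \<in> hom_set (functor_cat S Ab) F G"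
    and eq: "\<And>A x. \<lbrakk>A \<in> Obj S; x \<in> carrier (FO F A)\<rbrakk> \<Longrightarrow> cpt \<alpha> A x = cpt \<beta> A x"
  shows "\<alpha> = \<beta>"
proof (rule nat_trans.equality)
  show "NMap \<alpha> = NMap \<beta>"
  proof (rule extensionalityI[of _ "Obj S"])
    fix A assume A: "A \<in> Obj S"
    show "NMap \<alpha> A = NMap \<beta> A"
      by (rule Ab_arr_eqI[OF NMap_hom[OF assms(1) A] NMap_hom[OF assms(2) A] eq[OF A]])
  qed (use assms in \<open>simp_all add: hom_set_functor_cat natural_def\<close>)
qed (use assms in \<open>simp_all add: hom_set_functor_cat\<close>)

lemma cpt_comp:
  assumes "\<alpha> \<in> hom_set (functor_cat S Ab) F G" "A \<in> Obj S" "x \<in> carrier (FO F A)"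
  shows "cpt (\<beta> \<cdot>\<^bsub>functor_cat S Ab\<^esub> \<alpha>) A x = cpt \<beta> A (cpt \<alpha> A x)"
  using Ab_comp_fun[OF NMap_hom[OF assms(1,2)] assms(3)] assms(2) by (simp add: functor_cat_def)

lemma cpt_ident: "\<lbrakk>A \<in> Obj S; x \<in> carrier (FO F A)\<rbrakk> \<Longrightarrow> cpt (Ident (functor_cat S Ab) F) A x = x"
  by (simp add: functor_cat_def)

lemma cpt_zero:
  "\<lbrakk>A \<in> Obj S; x \<in> carrier (FO F A)\<rbrakk> \<Longrightarrow> cpt (Zro (functor_cat S Ab) F G) A x = \<one>\<^bsub>FO G A\<^esub>"
  by (simp add: functor_cat_def)

lemma functor_cat_comp: "\<beta> \<cdot>\<^bsub>functor_cat S D\<^esub> \<alpha> =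
    \<lparr>NSrc = NSrc \<alpha>, NTgt = NTgt \<beta>, NMap = \<lambda>A\<in>Obj S. NMap \<beta> A \<cdot>\<^bsub>D\<^esub> NMap \<alpha> A\<rparr>"
  by (simp add: functor_cat_def)

lemma nat_trans_comp:
  assumes \<alpha>: "\<alpha> \<in> hom_set (functor_cat S Ab) F G" and \<beta>: "\<beta> \<in> hom_set (functor_cat S Ab) G H"
  shows "\<beta> \<cdot>\<^bsub>functor_cat S Ab\<^esub> \<alpha> \<in> hom_set (functor_cat S Ab) F H"
proof -
  interpret F: Ab_functor S F using \<alpha> by (simp add: hom_set_functor_cat Ab_functor_iff)
  interpret G: Ab_functor S G using \<alpha> by (simp add: hom_set_functor_cat Ab_functor_iff)
  interpret H: Ab_functor S H using \<beta> by (simp add: hom_set_functor_cat Ab_functor_iff)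
  have "NMap \<beta> (Tgt S f) \<cdot>\<^bsub>Ab\<^esub> NMap \<alpha> (Tgt S f) \<cdot>\<^bsub>Ab\<^esub> FA F f =
        FA H f \<cdot>\<^bsub>Ab\<^esub> (NMap \<beta> (Src S f) \<cdot>\<^bsub>Ab\<^esub> NMap \<alpha> (Src S f))" if "f \<in> Arr S" for f
  proof -
    have f: "f \<in> hom_set S (Src S f) (Tgt S f)"
      using that by (simp add: hom_set_def)
    note AB = F.S.hom_set_objs[OF f]
    note homs = NMap_hom[OF \<alpha> AB(1)] NMap_hom[OF \<beta> AB(1)] NMap_hom[OF \<alpha> AB(2)] NMap_hom[OF \<beta> AB(2)]
    note comps = Ab_comp_hom[OF homs(1,2)] Ab_comp_hom[OF homs(3,4)]
    show ?thesis
      by (rule Ab_arr_eqI[OF Ab_comp_hom[OF F.FA_hom[OF f] comps(2)]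
            Ab_comp_hom[OF comps(1) H.FA_hom[OF f]]])
         (simp add: Ab_comp_fun[OF F.FA_hom[OF f]] Ab_comp_fun[OF homs(1)] Ab_comp_fun[OF homs(3)]
            Ab_comp_fun[OF comps(1)] F.act_closed[OF f] cpt_natural[OF \<alpha> f] cpt_natural[OF \<beta> f]
            cpt_closed[OF \<alpha> AB(1)] del: Ab_simps)
  qed
  moreover have "NMap \<beta> A \<cdot>\<^bsub>Ab\<^esub> NMap \<alpha> A \<in> hom_set Ab (FO F A) (FO H A)" if "A \<in> Obj S" for A
    using Ab_comp_hom NMap_hom[OF \<alpha> that] NMap_hom[OF \<beta> that] by blast
  moreover have "NSrc (\<beta> \<cdot>\<^bsub>functor_cat S Ab\<^esub> \<alpha>) = F" "NTgt (\<beta> \<cdot>\<^bsub>functor_cat S Ab\<^esub> \<alpha>) = H"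
    "NMap (\<beta> \<cdot>\<^bsub>functor_cat S Ab\<^esub> \<alpha>) = (\<lambda>A\<in>Obj S. NMap \<beta> A \<cdot>\<^bsub>Ab\<^esub> NMap \<alpha> A)"
    using \<alpha> \<beta> by (simp_all add: hom_set_functor_cat functor_cat_comp del: Ab_simps)
  ultimately show ?thesis
    using F.additive_functor_axioms H.additive_functor_axioms F.S.src_obj F.S.tgt_obj
    by (simp add: hom_set_functor_cat natural_def del: Ab_simps)
qed

lemma nat_trans_zero:
  assumes "Ab_functor S F" "Ab_functor S G"
  shows "Zro (functor_cat S Ab) F G \<in> hom_set (functor_cat S Ab) F G"
proof -
  interpret F: Ab_functor S F by fact
  interpret G: Ab_functor S G by fact
  have "Zro (functor_cat S Ab) F G = make_nat S F G (\<lambda>A x. \<one>\<^bsub>FO G A\<^esub>)"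
    by (simp add: functor_cat_def make_nat_def)
  moreover have "make_nat S F G (\<lambda>A x. \<one>\<^bsub>FO G A\<^esub>) \<in> hom_set (functor_cat S Ab) F G"
  proof (rule make_nat_hom[OF assms])
    show "(\<lambda>x. \<one>\<^bsub>FO G A\<^esub>) \<in> hom (FO F A) (FO G A)" if "A \<in> Obj S" for A
      using trivial_hom G.value_comm_group[OF that] by (auto simp: comm_group_def)
  qed (use G.act_one in simp)
  ultimately show ?thesis by simp
qed

section \<open>Pointwise kernels and cokernels\<close>

definition pointwise_kernel ::
    "('o, 'a) precat \<Rightarrow> ('o, 'a, 'u monoid, 'u gmap) nat_trans \<Rightarrow> ('o, 'a, 'u monoid, 'u gmap) nat_trans \<Rightarrow> bool" where
  "pointwise_kernel S \<alpha> k \<longleftrightarrow> (\<forall>A\<in>Obj S. inj_on (cpt k A) (carrier (FO (NSrc k) A)) \<and>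
     cpt k A ` carrier (FO (NSrc k) A) =
       {x \<in> carrier (FO (NSrc \<alpha>) A). cpt \<alpha> A x = \<one>\<^bsub>FO (NTgt \<alpha>) A\<^esub>})"

definition pointwise_cokernel ::
    "('o, 'a) precat \<Rightarrow> ('o, 'a, 'u monoid, 'u gmap) nat_trans \<Rightarrow> ('o, 'a, 'u monoid, 'u gmap) nat_trans \<Rightarrow> bool" where
  "pointwise_cokernel S \<alpha> c \<longleftrightarrow> (\<forall>A\<in>Obj S.
     cpt c A ` carrier (FO (NTgt \<alpha>) A) = carrier (FO (NTgt c) A) \<and>
     {y \<in> carrier (FO (NTgt \<alpha>) A). cpt c A y = \<one>\<^bsub>FO (NTgt c) A\<^esub>} = cpt \<alpha> A ` carrier (FO (NSrc \<alpha>) A))"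

locale Ab_nat =
  fixes S :: "('o, 'a) precat" and F G :: "('o, 'a, 'u monoid, 'u gmap) func"
    and \<alpha> :: "('o, 'a, 'u monoid, 'u gmap) nat_trans"
  assumes nat: "\<alpha> \<in> hom_set (functor_cat S Ab) F G"
begin

sublocale F: Ab_functor S F
  using nat by (simp add: hom_set_functor_cat Ab_functor_iff)

sublocale G: Ab_functor S G
  using nat by (simp add: hom_set_functor_cat Ab_functor_iff)

lemma NSrc: "NSrc \<alpha> = F" and NTgt: "NTgt \<alpha> = G"
  using nat by (simp_all add: hom_set_functor_cat)

lemmas closed = cpt_closed[OF nat] and natural = cpt_natural[OF nat]
  and comp_fun = cpt_comp[OF nat] and at_group_hom = cpt_group_hom[OF nat]

lemma at_one: "A \<in> Obj S \<Longrightarrow> cpt \<alpha> A \<one>\<^bsub>FO F A\<^esub> = \<one>\<^bsub>FO G A\<^esub>"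
  by (rule group_hom.hom_one[OF at_group_hom])

lemma at_mult:
  "\<lbrakk>A \<in> Obj S; x \<in> carrier (FO F A); y \<in> carrier (FO F A)\<rbrakk>
    \<Longrightarrow> cpt \<alpha> A (x \<otimes>\<^bsub>FO F A\<^esub> y) = cpt \<alpha> A x \<otimes>\<^bsub>FO G A\<^esub> cpt \<alpha> A y"
  using group_hom.hom_mult[OF at_group_hom] by simp

end

locale Ab_nat_kernel = Ab_nat + k: Ab_nat S K F k for K k +
  assumes pointwise: "pointwise_kernel S \<alpha> k"
begin

lemma inj: "\<lbrakk>A \<in> Obj S; x \<in> carrier (FO K A); y \<in> carrier (FO K A); cpt k A x = cpt k A y\<rbrakk> \<Longrightarrow> x = y"
  using pointwise k.NSrc by (auto simp: pointwise_kernel_def dest: inj_onD)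

lemma image: "A \<in> Obj S \<Longrightarrow>
    cpt k A ` carrier (FO K A) = {x \<in> carrier (FO F A). cpt \<alpha> A x = \<one>\<^bsub>FO G A\<^esub>}"
  using pointwise NSrc NTgt k.NSrc by (simp add: pointwise_kernel_def)

lemma lift:
  assumes "A \<in> Obj S" "x \<in> carrier (FO F A)" "cpt \<alpha> A x = \<one>\<^bsub>FO G A\<^esub>"
  obtains y where "y \<in> carrier (FO K A)" "cpt k A y = x"
proof -
  have "x \<in> cpt k A ` carrier (FO K A)"
    unfolding image[OF assms(1)] using assms by blast
  then show thesis using that by blast
qed

lemma kills: "\<lbrakk>A \<in> Obj S; y \<in> carrier (FO K A)\<rbrakk> \<Longrightarrow> cpt \<alpha> A (cpt k A y) = \<one>\<^bsub>FO G A\<^esub>"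
  using image by blast

end

locale Ab_nat_cokernel = Ab_nat + c: Ab_nat S G Q c for Q c +
  assumes pointwise: "pointwise_cokernel S \<alpha> c"
begin

lemma lift:
  assumes "A \<in> Obj S" "q \<in> carrier (FO Q A)"
  obtains y where "y \<in> carrier (FO G A)" "cpt c A y = q"
proof -
  have "q \<in> cpt c A ` carrier (FO G A)"
    using pointwise NTgt c.NTgt assms by (simp add: pointwise_cokernel_def)
  then show thesis using that by blast
qed

lemma kernel: "A \<in> Obj S \<Longrightarrow>
    {y \<in> carrier (FO G A). cpt c A y = \<one>\<^bsub>FO Q A\<^esub>} = cpt \<alpha> A ` carrier (FO F A)"
  using pointwise NSrc NTgt c.NTgt by (simp add: pointwise_cokernel_def)

lemma kills: "\<lbrakk>A \<in> Obj S; x \<in> carrier (FO F A)\<rbrakk> \<Longrightarrow> cpt c A (cpt \<alpha> A x) = \<one>\<^bsub>FO Q A\<^esub>"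
  using kernel by blast

lemma killed:
  assumes "A \<in> Obj S" "y \<in> carrier (FO G A)" "cpt c A y = \<one>\<^bsub>FO Q A\<^esub>"
  obtains x where "x \<in> carrier (FO F A)" "cpt \<alpha> A x = y"
proof -
  have "y \<in> cpt \<alpha> A ` carrier (FO F A)"
    unfolding kernel[OF assms(1), symmetric] using assms by blast
  then show thesis using that by blast
qed

end

lemma (in group_hom) eq_iff_divide:
  "\<lbrakk>x \<in> carrier G; y \<in> carrier G\<rbrakk> \<Longrightarrow> h x = h y \<longleftrightarrow> h (x \<otimes> inv y) = \<one>\<^bsub>H\<^esub>"
  using H.inv_solve_right'[of "\<one>\<^bsub>H\<^esub>" "h x" "h y"] by simp

text \<open>The subgroups \<open>ker \<alpha>\<^sub>A\<close> are preserved by the action of \<open>F\<close>, by naturality of \<open>\<alpha>\<close>.\<close>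

lemma pointwise_kernel_exists:
  fixes F G :: "('o, 'a, 'u monoid, 'u gmap) func"
  assumes \<alpha>: "\<alpha> \<in> hom_set (functor_cat S Ab) F G"
  obtains K k where "k \<in> hom_set (functor_cat S Ab) K F" "pointwise_kernel S \<alpha> k"
proof -
  interpret Ab_nat S F G \<alpha> by standard fact
  define N where "N A = {x \<in> carrier (FO F A). cpt \<alpha> A x = \<one>\<^bsub>FO G A\<^esub>}" for A
  define V where "V A = (FO F A)\<lparr>carrier := N A\<rparr>" for A
  have sub: "subgroup (N A) (FO F A)" if A: "A \<in> Obj S" for A
  proof -
    interpret group_hom "FO F A" "FO G A" "cpt \<alpha> A" using at_group_hom[OF A] .
    show ?thesis
      by (rule G.subgroupI) (auto simp: N_def intro!: exI[of _ "\<one>\<^bsub>FO F A\<^esub>"])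
  qed
  define K where "K = make_functor S V (act F)"
  have K: "Ab_functor S K"
    unfolding K_def
  proof (rule make_functor_Ab_functor[OF F.S.preadditive_category_axioms])
    fix A assume A: "A \<in> Obj S"
    show "V A \<in> Obj Ab"
      unfolding V_def by (rule Ab_subgroup[OF F.FO_obj[OF A] sub[OF A]])
    show "act F (Ident S A) x = x" if "x \<in> carrier (V A)" for x
      using that by (auto simp: V_def N_def intro: F.act_ident[OF A])
  next
    fix f A B assume f: "f \<in> hom_set S A B"
    note AB = F.S.hom_set_objs[OF f]
    show "act F f \<in> hom (V A) (V B)"
    proof (rule homI)
      fix x assume "x \<in> carrier (V A)"
      then show "act F f x \<in> carrier (V B)"
        using natural[OF f, of x] F.act_closed[OF f] G.act_one[OF f] by (simp add: V_def N_def)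
    next
      fix x y assume "x \<in> carrier (V A)" "y \<in> carrier (V A)"
      then show "act F f (x \<otimes>\<^bsub>V A\<^esub> y) = act F f x \<otimes>\<^bsub>V B\<^esub> act F f y"
        using hom_mult[OF F.act_hom[OF f], of x y] by (simp add: V_def N_def)
    qed
    show "act F (f \<boxplus>\<^bsub>S\<^esub> g) x = act F f x \<otimes>\<^bsub>V B\<^esub> act F g x"
      if "g \<in> hom_set S A B" "x \<in> carrier (V A)" for g x
      using F.act_plus[OF f that(1), of x] that(2) by (simp add: V_def N_def)
    show "act F (g \<cdot>\<^bsub>S\<^esub> f) x = act F g (act F f x)"
      if "g \<in> hom_set S B E" "x \<in> carrier (V A)" for g x E
      using F.act_comp[OF f that(1), of x] that(2) by (simp add: V_def N_def)
  qed
  have carrier_at: "FO K A = V A" for A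
    by (simp add: K_def make_functor_simps)
  define k where "k = make_nat S K F (\<lambda>A x. x)"
  have k: "k \<in> hom_set (functor_cat S Ab) K F"
    unfolding k_def
  proof (rule make_nat_hom[OF K F.Ab_functor_axioms])
    fix A show "(\<lambda>x. x) \<in> hom (FO K A) (FO F A)"
      by (auto simp: hom_def carrier_at V_def N_def)
  next
    fix f A B x assume "f \<in> hom_set S A B" "x \<in> carrier (FO K A)"
    then show "act K f x = act F f x"
      by (simp add: K_def make_functor_simps)
  qed
  have "pointwise_kernel S \<alpha> k"
    unfolding pointwise_kernel_def
  proof
    fix A assume A: "A \<in> Obj S"
    have "NSrc k = K" by (simp add: k_def make_nat_def)
    moreover have "cpt k A x = x" if "x \<in> carrier (FO K A)" for x
      unfolding k_def using A that by (rule cpt_make_nat)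
    ultimately show "inj_on (cpt k A) (carrier (FO (NSrc k) A)) \<and> cpt k A ` carrier (FO (NSrc k) A) =
        {x \<in> carrier (FO (NSrc \<alpha>) A). cpt \<alpha> A x = \<one>\<^bsub>FO (NTgt \<alpha>) A\<^esub>}"
      using NSrc NTgt by (simp add: inj_on_def) (simp add: carrier_at V_def N_def)
  qed
  with k show thesis by (rule that)
qed

text \<open>The quotient groups have to be chosen as groups on subsets of \<open>'u\<close>, so the induced action is described
  through chosen preimages \<open>r\<close>; naturality of \<open>\<alpha>\<close> makes it independent of this choice.\<close>

lemma pointwise_cokernel_exists:
  fixes F G :: "('o, 'a, 'u monoid, 'u gmap) func"
  assumes \<alpha>: "\<alpha> \<in> hom_set (functor_cat S Ab) F G"
  obtains Q c where "c \<in> hom_set (functor_cat S Ab) G Q" "pointwise_cokernel S \<alpha> c"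
proof -
  interpret Ab_nat S F G \<alpha> by standard fact
  define N where "N A = cpt \<alpha> A ` carrier (FO F A)" for A
  have "\<exists>V q. V \<in> (Obj Ab :: 'u monoid set) \<and> q \<in> hom (FO G A) V \<and> q ` carrier (FO G A) = carrier V \<and>
      (\<forall>y\<in>carrier (FO G A). q y = \<one>\<^bsub>V\<^esub> \<longleftrightarrow> y \<in> N A)" if A: "A \<in> Obj S" for A
  proof -
    have "subgroup (N A) (FO G A)"
      unfolding N_def by (rule group_hom.img_is_subgroup[OF at_group_hom[OF A]])
    then obtain V :: "'u monoid" and q where "V \<in> Obj Ab" "q \<in> hom (FO G A) V"
      "q ` carrier (FO G A) = carrier V" "\<forall>y\<in>carrier (FO G A). q y = \<one>\<^bsub>V\<^esub> \<longleftrightarrow> y \<in> N A"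
      by (rule Ab_quotient[OF G.FO_obj[OF A]])
    then show ?thesis by blast
  qed
  then have "\<forall>A\<in>Obj S. \<exists>V q. V \<in> (Obj Ab :: 'u monoid set) \<and> q \<in> hom (FO G A) V \<and>
      q ` carrier (FO G A) = carrier V \<and> (\<forall>y\<in>carrier (FO G A). q y = \<one>\<^bsub>V\<^esub> \<longleftrightarrow> y \<in> N A)"
    by blast
  from bchoice[OF this] obtain V :: "'o \<Rightarrow> 'u monoid" where "\<forall>A\<in>Obj S. \<exists>q. V A \<in> Obj Ab \<and>
      q \<in> hom (FO G A) (V A) \<and>
      q ` carrier (FO G A) = carrier (V A) \<and> (\<forall>y\<in>carrier (FO G A). q y = \<one>\<^bsub>V A\<^esub> \<longleftrightarrow> y \<in> N A)"
    by blast
  from bchoice[OF this] obtain q where "\<forall>A\<in>Obj S. V A \<in> Obj Ab \<and> q A \<in> hom (FO G A) (V A) \<and>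
      q A ` carrier (FO G A) = carrier (V A) \<and> (\<forall>y\<in>carrier (FO G A). q A y = \<one>\<^bsub>V A\<^esub> \<longleftrightarrow> y \<in> N A)"
    by blast
  then have V: "V A \<in> Obj Ab" and q: "q A \<in> hom (FO G A) (V A)"
    and surj: "q A ` carrier (FO G A) = carrier (V A)"
    and kernel: "\<And>y. y \<in> carrier (FO G A) \<Longrightarrow> q A y = \<one>\<^bsub>V A\<^esub> \<longleftrightarrow> y \<in> N A"
    if "A \<in> Obj S" for A
    using that by simp_all
  have q_group_hom: "group_hom (FO G A) (V A) (q A)" if "A \<in> Obj S" for A
    using q[OF that] V[OF that] G.value_comm_group[OF that]
    by (auto simp: Ab_Obj_iff comm_group_def intro!: group_hom.intro group_hom_axioms.intro)
  have q_closed: "q A y \<in> carrier (V A)" if "A \<in> Obj S" "y \<in> carrier (FO G A)" for A y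
    using hom_in_carrier[OF q] that by blast
  define r where "r A = inv_into (carrier (FO G A)) (q A)" for A
  have r: "r A v \<in> carrier (FO G A)" "q A (r A v) = v" if "A \<in> Obj S" "v \<in> carrier (V A)" for A v
    using that surj[OF that(1)] inv_into_into[of v "q A"] f_inv_into_f[of v "q A"] by (auto simp: r_def)
  define t where "t f v = q (Tgt S f) (act G f (r (Src S f) v))" for f v
  \<comment> \<open>Independence of the chosen preimages.\<close>
  have t: "t f (q A y) = q B (act G f y)" if f: "f \<in> hom_set S A B" and y: "y \<in> carrier (FO G A)" for f A B y
  proof -
    note AB = F.S.hom_set_objs[OF f]
    let ?y = "r A (q A y)"
    note y' = r[OF AB(1) q_closed[OF AB(1) y]]
    interpret qA: group_hom "FO G A" "V A" "q A" using q_group_hom[OF AB(1)] .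
    interpret qB: group_hom "FO G B" "V B" "q B" using q_group_hom[OF AB(2)] .
    interpret f: group_hom "FO G A" "FO G B" "act G f" using G.act_group_hom[OF f] .
    have "q A (?y \<otimes>\<^bsub>FO G A\<^esub> inv\<^bsub>FO G A\<^esub> y) = \<one>\<^bsub>V A\<^esub>"
      using qA.eq_iff_divide[OF y'(1) y] y'(2) by blast
    then have "?y \<otimes>\<^bsub>FO G A\<^esub> inv\<^bsub>FO G A\<^esub> y \<in> N A"
      by (rule iffD1[OF kernel[OF AB(1) qA.G.m_closed[OF y'(1) qA.G.inv_closed[OF y]]]])
    then obtain x where x: "x \<in> carrier (FO F A)" "?y \<otimes>\<^bsub>FO G A\<^esub> inv\<^bsub>FO G A\<^esub> y = cpt \<alpha> A x"
      by (auto simp: N_def)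
    have "act G f ?y \<otimes>\<^bsub>FO G B\<^esub> inv\<^bsub>FO G B\<^esub> act G f y = cpt \<alpha> B (act F f x)"
      using natural[OF f x(1)] x(2)[symmetric] y'(1) y by simp
    then have "act G f ?y \<otimes>\<^bsub>FO G B\<^esub> inv\<^bsub>FO G B\<^esub> act G f y \<in> N B"
      using F.act_closed[OF f x(1)] by (simp add: N_def)
    then have "q B (act G f ?y \<otimes>\<^bsub>FO G B\<^esub> inv\<^bsub>FO G B\<^esub> act G f y) = \<one>\<^bsub>V B\<^esub>"
      by (rule iffD2[OF kernel[OF AB(2) qB.G.m_closed[OF f.hom_closed[OF y'(1)]
              qB.G.inv_closed[OF f.hom_closed[OF y]]]]])
    then have "q B (act G f ?y) = q B (act G f y)"
      using qB.eq_iff_divide[OF f.hom_closed[OF y'(1)] f.hom_closed[OF y]] by blast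
    then show ?thesis
      using hom_setD[OF f] by (simp add: t_def)
  qed
  define Q where "Q = make_functor S V t"
  have Q: "Ab_functor S Q"
    unfolding Q_def
  proof (rule make_functor_Ab_functor[OF F.S.preadditive_category_axioms V])
    fix A v assume A: "A \<in> Obj S" and v: "v \<in> carrier (V A)"
    show "t (Ident S A) v = v"
      using t[OF F.S.ident_hom[OF A] r(1)[OF A v]] r[OF A v] G.act_ident[OF A] by simp
  next
    fix f A B assume f: "f \<in> hom_set S A B"
    note AB = F.S.hom_set_objs[OF f]
    have t': "t f v = q B (act G f (r A v))" for v
      using hom_setD[OF f] by (simp add: t_def)
    interpret qA: group_hom "FO G A" "V A" "q A" using q_group_hom[OF AB(1)] .
    interpret qB: group_hom "FO G B" "V B" "q B" using q_group_hom[OF AB(2)] .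
    interpret f: group_hom "FO G A" "FO G B" "act G f" using G.act_group_hom[OF f] .
    show "t f \<in> hom (V A) (V B)"
    proof (rule homI)
      fix v w assume v: "v \<in> carrier (V A)" and w: "w \<in> carrier (V A)"
      note v' = r[OF AB(1) v] and w' = r[OF AB(1) w]
      show "t f v \<in> carrier (V B)"
        using v'(1) by (simp add: t')
      have "t f (v \<otimes>\<^bsub>V A\<^esub> w) = t f (q A (r A v \<otimes>\<^bsub>FO G A\<^esub> r A w))"
        using v' w' by simp
      also have "\<dots> = q B (act G f (r A v \<otimes>\<^bsub>FO G A\<^esub> r A w))"
        using v' w' by (intro t[OF f]) simp
      finally show "t f (v \<otimes>\<^bsub>V A\<^esub> w) = t f v \<otimes>\<^bsub>V B\<^esub> t f w"
        using v'(1) w'(1) by (simp add: t')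
    qed
    fix v assume v: "v \<in> carrier (V A)"
    note v' = r[OF AB(1) v]
    show "t (f \<boxplus>\<^bsub>S\<^esub> g) v = t f v \<otimes>\<^bsub>V B\<^esub> t g v" if g: "g \<in> hom_set S A B" for g
    proof -
      have "comm_group (hom_group S A B)"
        using F.S.hom_comm_group AB by blast
      then have fg: "f \<boxplus>\<^bsub>S\<^esub> g \<in> hom_set S A B"
        using comm_groupE(1)[of "hom_group S A B" f g] f g by (simp add: hom_group_def)
      show ?thesis
        using t[OF fg v'(1)] t[OF f v'(1)] t[OF g v'(1)] v' G.act_plus[OF f g v'(1)]
          G.act_closed[OF f v'(1)] G.act_closed[OF g v'(1)] by simp
    qed
    show "t (g \<cdot>\<^bsub>S\<^esub> f) v = t g (t f v)" if g: "g \<in> hom_set S B E" for g E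
      using t[OF F.S.comp_hom[OF f g] v'(1)] t[OF f v'(1)] t[OF g G.act_closed[OF f v'(1)]] v'
        G.act_comp[OF f g v'(1)] by simp
  qed
  have carrier_at: "FO Q A = V A" for A
    by (simp add: Q_def make_functor_simps)
  define c where "c = make_nat S G Q q"
  have c: "c \<in> hom_set (functor_cat S Ab) G Q"
    unfolding c_def
  proof (rule make_nat_hom[OF G.Ab_functor_axioms Q])
    fix f A B y assume f: "f \<in> hom_set S A B" and y: "y \<in> carrier (FO G A)"
    show "q B (act G f y) = act Q f (q A y)"
      using t[OF f y] make_functor_simps(2)[where K = V and t = t, OF f q_closed[OF F.S.hom_set_objs(1)[OF f] y]]
      by (simp add: Q_def)
  qed (use q carrier_at in simp)
  have "pointwise_cokernel S \<alpha> c"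
    unfolding pointwise_cokernel_def
  proof
    fix A assume A: "A \<in> Obj S"
    have "NTgt c = Q" by (simp add: c_def make_nat_def)
    moreover have "cpt c A y = q A y" if "y \<in> carrier (FO G A)" for y
      unfolding c_def using A that by (rule cpt_make_nat)
    moreover have "N A \<subseteq> carrier (FO G A)"
      using closed[OF A] by (auto simp: N_def)
    ultimately show "cpt c A ` carrier (FO (NTgt \<alpha>) A) = carrier (FO (NTgt c) A) \<and>
       {y \<in> carrier (FO (NTgt \<alpha>) A). cpt c A y = \<one>\<^bsub>FO (NTgt c) A\<^esub>} = cpt \<alpha> A ` carrier (FO (NSrc \<alpha>) A)"
      using NSrc NTgt kernel[OF A] surj[OF A] by (auto simp: carrier_at N_def)
  qed
  with c show thesis by (rule that)
qed

section \<open>Universal properties of pointwise kernels and cokernels\<close>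

text \<open>Injectivity of \<open>k\<close> at each object forces the mediating transformation, and makes it additive and natural.
  It lies in every full subcategory that contains its source and target.\<close>

lemma is_kernel_of_pointwise:
  assumes \<alpha>: "\<alpha> \<in> hom_set (full_sub (functor_cat S Ab) P) F G"
    and k: "k \<in> hom_set (full_sub (functor_cat S Ab) P) K F" and pointwise: "pointwise_kernel S \<alpha> k"
  shows "is_kernel (full_sub (functor_cat S Ab) P) \<alpha> k"
proof -
  interpret Ab_nat_kernel S F G \<alpha> K k
    using assms by unfold_locales (auto simp: hom_set_full_sub_iff)
  let ?A = "functor_cat S Ab"
  have factor: "\<exists>!u. u \<in> hom_set ?A Z K \<and> k \<cdot>\<^bsub>?A\<^esub> u = g"
    if g: "g \<in> hom_set ?A Z F" and zero: "\<alpha> \<cdot>\<^bsub>?A\<^esub> g = Zro ?A Z G" for Z g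
  proof -
    interpret g: Ab_nat S Z F g by standard fact
    have \<alpha>g: "cpt \<alpha> A (cpt g A z) = \<one>\<^bsub>FO G A\<^esub>" if "A \<in> Obj S" "z \<in> carrier (FO Z A)" for A z
      using g.comp_fun[OF that, of \<alpha>] that by (simp add: zero cpt_zero)
    define u where "u A z = (SOME y. y \<in> carrier (FO K A) \<and> cpt k A y = cpt g A z)" for A z
    have u: "u A z \<in> carrier (FO K A)" "cpt k A (u A z) = cpt g A z"
      if "A \<in> Obj S" "z \<in> carrier (FO Z A)" for A z
    proof -
      have "\<exists>y. y \<in> carrier (FO K A) \<and> cpt k A y = cpt g A z"
        by (rule lift[OF that(1) g.closed[OF that] \<alpha>g[OF that]]) blast
      from someI_ex[OF this] show "u A z \<in> carrier (FO K A)" "cpt k A (u A z) = cpt g A z"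
        by (simp_all add: u_def)
    qed
    have hom: "make_nat S Z K u \<in> hom_set ?A Z K"
    proof (rule make_nat_hom[OF g.F.Ab_functor_axioms k.F.Ab_functor_axioms])
      fix A assume A: "A \<in> Obj S"
      interpret Z: comm_group "FO Z A" using g.F.value_comm_group[OF A] .
      interpret K: comm_group "FO K A" using k.F.value_comm_group[OF A] .
      show "u A \<in> hom (FO Z A) (FO K A)"
      proof (rule homI)
        fix y z assume y: "y \<in> carrier (FO Z A)" and z: "z \<in> carrier (FO Z A)"
        show "u A (y \<otimes>\<^bsub>FO Z A\<^esub> z) = u A y \<otimes>\<^bsub>FO K A\<^esub> u A z"
          by (rule inj[OF A]) (use u[OF A] y z in \<open>simp_all add: k.at_mult[OF A] g.at_mult[OF A]\<close>)
      qed (rule u[OF A])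
    next
      fix f A B z assume f: "f \<in> hom_set S A B" and z: "z \<in> carrier (FO Z A)"
      note AB = F.S.hom_set_objs[OF f]
      note fz = g.F.act_closed[OF f z]
      show "u B (act Z f z) = act K f (u A z)"
        by (rule inj[OF AB(2)])
           (use u[OF AB(1) z] u[OF AB(2) fz] k.F.act_closed[OF f]
             in \<open>simp_all add: k.natural[OF f] g.natural[OF f z]\<close>)
    qed
    show ?thesis
    proof (rule ex1I[of _ "make_nat S Z K u"], intro conjI hom)
      show "k \<cdot>\<^bsub>?A\<^esub> make_nat S Z K u = g"
        by (rule nat_trans_eqI[OF nat_trans_comp[OF hom k.nat] g])
           (simp add: cpt_comp[OF hom] cpt_make_nat u)
    next
      fix v assume v: "v \<in> hom_set ?A Z K \<and> k \<cdot>\<^bsub>?A\<^esub> v = g"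
      show "v = make_nat S Z K u"
      proof (rule nat_trans_eqI[OF _ hom])
        fix A z assume A: "A \<in> Obj S" and z: "z \<in> carrier (FO Z A)"
        have "cpt k A (cpt v A z) = cpt g A z"
          using v cpt_comp[of v S Z K A z k] A z by simp
        then have "cpt v A z = u A z"
          using inj[OF A cpt_closed[OF _ A z] u(1)[OF A z]] v u(2)[OF A z] by simp
        then show "cpt v A z = cpt (make_nat S Z K u) A z"
          using A z by (simp add: cpt_make_nat)
      qed (use v in blast)
    qed
  qed
  moreover have "\<alpha> \<cdot>\<^bsub>?A\<^esub> k = Zro ?A K G"
    by (rule nat_trans_eqI[OF nat_trans_comp[OF k.nat nat]
          nat_trans_zero[OF k.F.Ab_functor_axioms G.Ab_functor_axioms]])
       (simp add: k.comp_fun cpt_zero kills)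
  ultimately show ?thesis
    using hom_setD[OF \<alpha>] hom_setD[OF k] \<alpha> k NSrc NTgt k.NSrc k.NTgt factor
    by (simp add: is_kernel_def hom_set_full_sub_iff)
qed

text \<open>Dually, surjectivity of \<open>c\<close> at each object forces the mediating transformation; it is well defined because
  two preimages differ by an element of the image of \<open>\<alpha>\<close>.\<close>

lemma is_cokernel_of_pointwise:
  assumes \<alpha>: "\<alpha> \<in> hom_set (full_sub (functor_cat S Ab) P) F G"
    and c: "c \<in> hom_set (full_sub (functor_cat S Ab) P) G Q" and pointwise: "pointwise_cokernel S \<alpha> c"
  shows "is_cokernel (full_sub (functor_cat S Ab) P) \<alpha> c"
proof -
  interpret Ab_nat_cokernel S F G \<alpha> Q c
    using assms by unfold_locales (auto simp: hom_set_full_sub_iff)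
  let ?A = "functor_cat S Ab"
  have factor: "\<exists>!u. u \<in> hom_set ?A Q Z \<and> u \<cdot>\<^bsub>?A\<^esub> c = g"
    if g: "g \<in> hom_set ?A G Z" and zero: "g \<cdot>\<^bsub>?A\<^esub> \<alpha> = Zro ?A F Z" for Z g
  proof -
    interpret g: Ab_nat S G Z g by standard fact
    have g\<alpha>: "cpt g A (cpt \<alpha> A x) = \<one>\<^bsub>FO Z A\<^esub>" if "A \<in> Obj S" "x \<in> carrier (FO F A)" for A x
      using comp_fun[OF that, of g] that by (simp add: zero cpt_zero)
    have well_defined: "cpt g A y = cpt g A y'"
      if A: "A \<in> Obj S" and y: "y \<in> carrier (FO G A)" and y': "y' \<in> carrier (FO G A)"
        and eq: "cpt c A y = cpt c A y'" for A y y'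
    proof -
      interpret c: group_hom "FO G A" "FO Q A" "cpt c A" using c.at_group_hom[OF A] .
      interpret g: group_hom "FO G A" "FO Z A" "cpt g A" using g.at_group_hom[OF A] .
      have diff: "y \<otimes>\<^bsub>FO G A\<^esub> inv\<^bsub>FO G A\<^esub> y' \<in> carrier (FO G A)"
        using y y' by simp
      obtain x where "x \<in> carrier (FO F A)" "cpt \<alpha> A x = y \<otimes>\<^bsub>FO G A\<^esub> inv\<^bsub>FO G A\<^esub> y'"
        by (rule killed[OF A diff iffD1[OF c.eq_iff_divide[OF y y'] eq]])
      with g\<alpha>[OF A] have "cpt g A (y \<otimes>\<^bsub>FO G A\<^esub> inv\<^bsub>FO G A\<^esub> y') = \<one>\<^bsub>FO Z A\<^esub>"
        by metis
      then show ?thesis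
        by (rule iffD2[OF g.eq_iff_divide[OF y y']])
    qed
    define u where "u A q = cpt g A (SOME y. y \<in> carrier (FO G A) \<and> cpt c A y = q)" for A q
    have u: "u A (cpt c A y) = cpt g A y" if A: "A \<in> Obj S" and y: "y \<in> carrier (FO G A)" for A y
    proof -
      let ?y = "SOME y'. y' \<in> carrier (FO G A) \<and> cpt c A y' = cpt c A y"
      have "?y \<in> carrier (FO G A) \<and> cpt c A ?y = cpt c A y"
        by (rule someI[of _ y]) (simp add: y)
      then show ?thesis
        unfolding u_def by (intro well_defined[OF A _ y]) simp_all
    qed
    have hom: "make_nat S Q Z u \<in> hom_set ?A Q Z"
    proof (rule make_nat_hom[OF c.G.Ab_functor_axioms g.G.Ab_functor_axioms])
      fix A assume A: "A \<in> Obj S"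
      interpret G: comm_group "FO G A" using G.value_comm_group[OF A] .
      show "u A \<in> hom (FO Q A) (FO Z A)"
      proof (rule homI)
        fix p q assume p: "p \<in> carrier (FO Q A)" and q: "q \<in> carrier (FO Q A)"
        obtain x where x: "x \<in> carrier (FO G A)" "cpt c A x = p" by (rule lift[OF A p])
        obtain y where y: "y \<in> carrier (FO G A)" "cpt c A y = q" by (rule lift[OF A q])
        show "u A p \<in> carrier (FO Z A)"
          using u[OF A x(1)] x g.closed[OF A] by simp
        have "u A (p \<otimes>\<^bsub>FO Q A\<^esub> q) = cpt g A (x \<otimes>\<^bsub>FO G A\<^esub> y)"
          using u[OF A G.m_closed[OF x(1) y(1)]] c.at_mult[OF A x(1) y(1)] x y by simp
        then show "u A (p \<otimes>\<^bsub>FO Q A\<^esub> q) = u A p \<otimes>\<^bsub>FO Z A\<^esub> u A q"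
          using u[OF A x(1)] u[OF A y(1)] x y g.at_mult[OF A] by simp
      qed
    next
      fix f A B q assume f: "f \<in> hom_set S A B" and q: "q \<in> carrier (FO Q A)"
      note AB = F.S.hom_set_objs[OF f]
      obtain y where y: "y \<in> carrier (FO G A)" "cpt c A y = q" by (rule lift[OF AB(1) q])
      show "u B (act Q f q) = act Z f (u A q)"
        using u[OF AB(1) y(1)] u[OF AB(2) G.act_closed[OF f y(1)]] c.natural[OF f y(1)]
          g.natural[OF f y(1)] y(2) by simp
    qed
    show ?thesis
    proof (rule ex1I[of _ "make_nat S Q Z u"], intro conjI hom)
      show "make_nat S Q Z u \<cdot>\<^bsub>?A\<^esub> c = g"
        by (rule nat_trans_eqI[OF nat_trans_comp[OF c.nat hom] g])
           (simp add: c.comp_fun cpt_make_nat c.closed u)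
    next
      fix v assume v: "v \<in> hom_set ?A Q Z \<and> v \<cdot>\<^bsub>?A\<^esub> c = g"
      show "v = make_nat S Q Z u"
      proof (rule nat_trans_eqI[OF _ hom])
        fix A q assume A: "A \<in> Obj S" and q: "q \<in> carrier (FO Q A)"
        obtain y where y: "y \<in> carrier (FO G A)" "cpt c A y = q" by (rule lift[OF A q])
        have "cpt v A q = cpt g A y"
          using v c.comp_fun[OF A y(1), of v] y(2) by simp
        then show "cpt v A q = cpt (make_nat S Q Z u) A q"
          using A q u[OF A y(1)] y(2) by (simp add: cpt_make_nat)
      qed (use v in blast)
    qed
  qed
  moreover have "c \<cdot>\<^bsub>?A\<^esub> \<alpha> = Zro ?A F Q"
    by (rule nat_trans_eqI[OF nat_trans_comp[OF nat c.nat]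
          nat_trans_zero[OF F.Ab_functor_axioms c.G.Ab_functor_axioms]])
       (simp add: comp_fun cpt_zero kills)
  ultimately show ?thesis
    using hom_setD[OF \<alpha>] hom_setD[OF c] \<alpha> c NSrc NTgt c.NSrc c.NTgt factor
    by (simp add: is_cokernel_def hom_set_full_sub_iff)
qed

section \<open>Functors commuting with products and direct limits\<close>

text \<open>The functors that commute with products and direct limits; for \<open>S = full_sub C D\<close> they form
  \<open>fun_cat C D\<close>.\<close>

definition continuous_functors :: "('o, 'u) precat \<Rightarrow> ('o, 'u) abfunc set" where
  "continuous_functors S = {F. preserves_products S Ab F \<and> preserves_direct_limits S Ab F}"

lemma is_productD:
  assumes "is_product C I X P \<pi>"
  shows "P \<in> Obj C" "\<And>i. i \<in> I \<Longrightarrow> X i \<in> Obj C" "\<And>i. i \<in> I \<Longrightarrow> \<pi> i \<in> hom_set C P (X i)"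
  using assms by (simp_all add: is_product_def)

lemma is_direct_limitD:
  assumes "is_direct_limit C I r X \<phi> L c"
  shows "directed_system C I r X \<phi>" "is_cocone C I r X \<phi> L c" "L \<in> Obj C"
    "\<And>i. i \<in> I \<Longrightarrow> c i \<in> hom_set C (X i) L" "\<And>i j. (i, j) \<in> r \<Longrightarrow> c j \<cdot>\<^bsub>C\<^esub> \<phi> i j = c i"
  using assms by (simp_all add: is_direct_limit_def is_cocone_def)

lemma
  fixes F :: "('o, 'u) abfunc"
  assumes universe: "universe TYPE('u)" and F: "F \<in> continuous_functors S" and I: "small TYPE('u) (I :: 'u set)"
  shows continuous_product: "\<lbrakk>is_product S I X P \<pi>; \<And>i. i \<in> I \<Longrightarrow> x i \<in> carrier (FO F (X i))\<rbrakk>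
      \<Longrightarrow> \<exists>!p. p \<in> carrier (FO F P) \<and> (\<forall>i\<in>I. act F (\<pi> i) p = x i)"
    and continuous_limit_surj: "\<lbrakk>is_direct_limit S I r X \<phi> L c; l \<in> carrier (FO F L)\<rbrakk>
      \<Longrightarrow> \<exists>i\<in>I. \<exists>x\<in>carrier (FO F (X i)). act F (c i) x = l"
    and continuous_limit_kernel: "\<lbrakk>is_direct_limit S I r X \<phi> L c; i \<in> I; y \<in> carrier (FO F (X i));
        act F (c i) y = \<one>\<^bsub>FO F L\<^esub>\<rbrakk> \<Longrightarrow> \<exists>j. (i, j) \<in> r \<and> act F (\<phi> i j) y = \<one>\<^bsub>FO F (X j)\<^esub>"
proof -
  have "is_product Ab I (\<lambda>i. FO F (X i)) (FO F P) (\<lambda>i. FA F (\<pi> i))" if "is_product S I X P \<pi>"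
    using F I that by (simp add: continuous_functors_def preserves_products_def)
  from Ab_product_elementwise[OF universe I this]
  show "\<exists>!p. p \<in> carrier (FO F P) \<and> (\<forall>i\<in>I. act F (\<pi> i) p = x i)"
    if "is_product S I X P \<pi>" "\<And>i. i \<in> I \<Longrightarrow> x i \<in> carrier (FO F (X i))"
    using that by simp
  have limit: "is_direct_limit Ab I r (\<lambda>i. FO F (X i)) (\<lambda>i j. FA F (\<phi> i j)) (FO F L) (\<lambda>i. FA F (c i))"
    if "is_direct_limit S I r X \<phi> L c"
    using F I that by (simp add: continuous_functors_def preserves_direct_limits_def)
  show "\<exists>i\<in>I. \<exists>x\<in>carrier (FO F (X i)). act F (c i) x = l"
    if "is_direct_limit S I r X \<phi> L c" "l \<in> carrier (FO F L)"
    by (rule Ab_direct_limit_surj[OF limit[OF that(1)] that(2)])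
  show "\<exists>j. (i, j) \<in> r \<and> act F (\<phi> i j) y = \<one>\<^bsub>FO F (X j)\<^esub>"
    if "is_direct_limit S I r X \<phi> L c" "i \<in> I" "y \<in> carrier (FO F (X i))"
        "act F (c i) y = \<one>\<^bsub>FO F L\<^esub>"
    by (rule Ab_direct_limit_kernel[OF universe I limit[OF that(1)] that(2-)])
qed

text \<open>The converse: in this form, membership in the class is a matter of diagram chases.\<close>

lemma continuous_functorI:
  fixes F :: "('o, 'u) abfunc"
  assumes "Ab_functor S F"
    and products: "\<And>(I :: 'u set) X P \<pi> x. \<lbrakk>small TYPE('u) I; is_product S I X P \<pi>;
        \<And>i. i \<in> I \<Longrightarrow> x i \<in> carrier (FO F (X i))\<rbrakk>
        \<Longrightarrow> \<exists>!p. p \<in> carrier (FO F P) \<and> (\<forall>i\<in>I. act F (\<pi> i) p = x i)"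
    and limits_surj: "\<And>(I :: 'u set) r X \<phi> L c l. \<lbrakk>small TYPE('u) I; is_direct_limit S I r X \<phi> L c;
        l \<in> carrier (FO F L)\<rbrakk> \<Longrightarrow> \<exists>i\<in>I. \<exists>x\<in>carrier (FO F (X i)). act F (c i) x = l"
    and limits_kernel: "\<And>(I :: 'u set) r X \<phi> L c i y. \<lbrakk>small TYPE('u) I; is_direct_limit S I r X \<phi> L c;
        i \<in> I; y \<in> carrier (FO F (X i)); act F (c i) y = \<one>\<^bsub>FO F L\<^esub>\<rbrakk>
        \<Longrightarrow> \<exists>j. (i, j) \<in> r \<and> act F (\<phi> i j) y = \<one>\<^bsub>FO F (X j)\<^esub>"
  shows "F \<in> continuous_functors S"
  unfolding continuous_functors_def preserves_products_def preserves_direct_limits_def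
proof (intro CollectI conjI allI impI; elim conjE)
  interpret Ab_functor S F by fact
  fix I :: "'u set" and X P \<pi>
  assume I: "small TYPE('u) I" and product: "is_product S I X P \<pi>"
  show "is_product Ab I (\<lambda>i. FO F (X i)) (FO F P) (\<lambda>i. FA F (\<pi> i))"
    by (rule Ab_product_of_elementwise[OF FO_obj FA_hom products[OF I product]])
       (use is_productD[OF product] in simp_all)
next
  interpret Ab_functor S F by fact
  fix I :: "'u set" and r X \<phi> L c
  assume I: "small TYPE('u) I" and limit: "is_direct_limit S I r X \<phi> L c"
  show "is_direct_limit Ab I r (\<lambda>i. FO F (X i)) (\<lambda>i j. FA F (\<phi> i j)) (FO F L) (\<lambda>i. FA F (c i))"
    by (rule Ab_direct_limit_of_elementwise[OF FA_directed_system[OF is_direct_limitD(1)[OF limit]]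
          FA_cocone[OF is_direct_limitD(1,2)[OF limit]] limits_surj[OF I limit] limits_kernel[OF I limit]])
qed

text \<open>Products and direct limits of abelian groups are left exact.  A family in \<open>K\<close> is glued in \<open>F\<close>, and the
  result dies in \<open>G\<close> as all its projections do.  An element of the limit that comes from \<open>F\<close> at some stage and
  dies in \<open>G\<close> already dies in \<open>G\<close> at a later stage, so it comes from \<open>K\<close> there.\<close>

lemma pointwise_kernel_continuous:
  fixes F :: "('o, 'u) abfunc"
  assumes universe: "universe TYPE('u)"
    and \<alpha>: "\<alpha> \<in> hom_set (functor_cat S Ab) F G" and F: "F \<in> continuous_functors S" and G: "G \<in> continuous_functors S"
    and k: "k \<in> hom_set (functor_cat S Ab) K F" and pointwise: "pointwise_kernel S \<alpha> k"
  shows "K \<in> continuous_functors S"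
proof -
  interpret Ab_nat_kernel S F G \<alpha> K k by standard fact+
  note F_rules = universe F and G_rules = universe G
  show ?thesis
  proof (rule continuous_functorI[OF k.F.Ab_functor_axioms])
    fix I :: "'u set" and X P \<pi> x
    assume I: "small TYPE('u) I" and product: "is_product S I X P \<pi>"
      and x: "\<And>i. i \<in> I \<Longrightarrow> x i \<in> carrier (FO K (X i))"
    note P = is_productD(1)[OF product] and X = is_productD(2)[OF product] and \<pi> = is_productD(3)[OF product]
    have "\<And>i. i \<in> I \<Longrightarrow> cpt k (X i) (x i) \<in> carrier (FO F (X i))"
      using k.closed[OF X] x by simp
    note family = continuous_product[OF F_rules I product this]
    then obtain p where p: "p \<in> carrier (FO F P)" "\<And>i. i \<in> I \<Longrightarrow> act F (\<pi> i) p = cpt k (X i) (x i)"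
      by blast
    have "act G (\<pi> i) (cpt \<alpha> P p) = \<one>\<^bsub>FO G (X i)\<^esub>" "act G (\<pi> i) \<one>\<^bsub>FO G P\<^esub> = \<one>\<^bsub>FO G (X i)\<^esub>" if i: "i \<in> I" for i
      using natural[OF \<pi>[OF i] p(1)] p(2)[OF i] kills[OF X[OF i] x[OF i]] G.act_one[OF \<pi>[OF i]] by simp_all
    moreover have "\<exists>!q. q \<in> carrier (FO G P) \<and> (\<forall>i\<in>I. act G (\<pi> i) q = \<one>\<^bsub>FO G (X i)\<^esub>)"
      by (rule continuous_product[OF G_rules I product]) (use G.value_comm_group[OF X] comm_groupE(2) in blast)
    ultimately have "cpt \<alpha> P p = \<one>\<^bsub>FO G P\<^esub>"
      using closed[OF P p(1)] comm_groupE(2)[OF G.value_comm_group[OF P]] by blast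
    then obtain y where y: "y \<in> carrier (FO K P)" "cpt k P y = p"
      by (rule lift[OF P p(1)])
    show "\<exists>!p. p \<in> carrier (FO K P) \<and> (\<forall>i\<in>I. act K (\<pi> i) p = x i)"
    proof (rule ex1I[of _ y], intro conjI ballI y(1))
      fix i assume i: "i \<in> I"
      show "act K (\<pi> i) y = x i"
        by (rule inj[OF X[OF i] k.F.act_closed[OF \<pi>[OF i] y(1)] x[OF i]])
           (use k.natural[OF \<pi>[OF i] y(1)] y(2) p(2)[OF i] in simp)
    next
      fix y' assume y': "y' \<in> carrier (FO K P) \<and> (\<forall>i\<in>I. act K (\<pi> i) y' = x i)"
      then have "act F (\<pi> i) (cpt k P y') = cpt k (X i) (x i)" if "i \<in> I" for i
        using k.natural[OF \<pi>[OF that], of y'] that by simp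
      then have "cpt k P y' = p"
        using family p k.closed[OF P] y' by blast
      then show "y' = y"
        using inj[OF P] y y' by simp
    qed
  next
    fix I :: "'u set" and r X \<phi> L c l
    assume I: "small TYPE('u) I" and limit: "is_direct_limit S I r X \<phi> L c" and l: "l \<in> carrier (FO K L)"
    note system = F.S.directed_systemD[OF is_direct_limitD(1)[OF limit]]
    note L = is_direct_limitD(3)[OF limit] and c = is_direct_limitD(4)[OF limit]
    obtain i x where i: "i \<in> I" and x: "x \<in> carrier (FO F (X i))" "act F (c i) x = cpt k L l"
      using continuous_limit_surj[OF F_rules I limit k.closed[OF L l]] by blast
    have "act G (c i) (cpt \<alpha> (X i) x) = \<one>\<^bsub>FO G L\<^esub>"
      using natural[OF c[OF i] x(1)] x(2) kills[OF L l] by simp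
    then obtain j where j: "(i, j) \<in> r" "act G (\<phi> i j) (cpt \<alpha> (X i) x) = \<one>\<^bsub>FO G (X j)\<^esub>"
      using continuous_limit_kernel[OF G_rules I limit i closed[OF system(6)[OF i] x(1)]] by blast
    note jI = conjunct2[OF system(4)[OF j(1)]] and \<phi> = system(7)[OF j(1)]
    obtain y where y: "y \<in> carrier (FO K (X j))" "cpt k (X j) y = act F (\<phi> i j) x"
      by (rule lift[OF system(6)[OF jI] F.act_closed[OF \<phi> x(1)]]) (use natural[OF \<phi> x(1)] j(2) in simp_all)
    have "act K (c j) y = l"
      by (rule inj[OF L k.F.act_closed[OF c[OF jI] y(1)] l])
         (use k.natural[OF c[OF jI] y(1)] y(2) F.act_comp[OF \<phi> c[OF jI] x(1)]
            is_direct_limitD(5)[OF limit j(1)] x(2) in simp)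
    then show "\<exists>i\<in>I. \<exists>x\<in>carrier (FO K (X i)). act K (c i) x = l"
      using jI y(1) by blast
  next
    fix I :: "'u set" and r X \<phi> L c i y
    assume I: "small TYPE('u) I" and limit: "is_direct_limit S I r X \<phi> L c" and i: "i \<in> I"
      and y: "y \<in> carrier (FO K (X i))" and dies: "act K (c i) y = \<one>\<^bsub>FO K L\<^esub>"
    note system = F.S.directed_systemD[OF is_direct_limitD(1)[OF limit]]
    note L = is_direct_limitD(3)[OF limit] and c = is_direct_limitD(4)[OF limit]
    have "act F (c i) (cpt k (X i) y) = \<one>\<^bsub>FO F L\<^esub>"
      using k.natural[OF c[OF i] y] dies k.at_one[OF L] by simp
    then obtain j where j: "(i, j) \<in> r" "act F (\<phi> i j) (cpt k (X i) y) = \<one>\<^bsub>FO F (X j)\<^esub>"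
      using continuous_limit_kernel[OF F_rules I limit i k.closed[OF system(6)[OF i] y]] by blast
    note jI = conjunct2[OF system(4)[OF j(1)]] and \<phi> = system(7)[OF j(1)]
    have "act K (\<phi> i j) y = \<one>\<^bsub>FO K (X j)\<^esub>"
      by (rule inj[OF system(6)[OF jI] k.F.act_closed[OF \<phi> y]
            comm_groupE(2)[OF k.F.value_comm_group[OF system(6)[OF jI]]]])
         (use k.natural[OF \<phi> y] j(2) k.at_one[OF system(6)[OF jI]] in simp)
    with j(1) show "\<exists>j. (i, j) \<in> r \<and> act K (\<phi> i j) y = \<one>\<^bsub>FO K (X j)\<^esub>"
      by blast
  qed
qed

text \<open>Products and direct limits of abelian groups are right exact as well.  For products this is the axiom of
  choice: families in \<open>Q\<close> are lifted to \<open>G\<close>, and a family of elements of the image of \<open>\<alpha>\<close> is lifted to \<open>F\<close>.\<close>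

lemma pointwise_cokernel_continuous:
  fixes F :: "('o, 'u) abfunc"
  assumes universe: "universe TYPE('u)"
    and \<alpha>: "\<alpha> \<in> hom_set (functor_cat S Ab) F G" and F: "F \<in> continuous_functors S" and G: "G \<in> continuous_functors S"
    and p: "p \<in> hom_set (functor_cat S Ab) G Q" and pointwise: "pointwise_cokernel S \<alpha> p"
  shows "Q \<in> continuous_functors S"
proof -
  interpret Ab_nat_cokernel S F G \<alpha> Q p by standard fact+
  note F_rules = universe F and G_rules = universe G
  show ?thesis
  proof (rule continuous_functorI[OF c.G.Ab_functor_axioms])
    fix I :: "'u set" and X P \<pi> x
    assume I: "small TYPE('u) I" and product: "is_product S I X P \<pi>"
      and x: "\<And>i. i \<in> I \<Longrightarrow> x i \<in> carrier (FO Q (X i))"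
    note P = is_productD(1)[OF product] and X = is_productD(2)[OF product] and \<pi> = is_productD(3)[OF product]
    have "\<forall>i\<in>I. \<exists>y. y \<in> carrier (FO G (X i)) \<and> cpt p (X i) y = x i"
    proof
      fix i assume i: "i \<in> I"
      obtain y where "y \<in> carrier (FO G (X i))" "cpt p (X i) y = x i"
        by (rule lift[OF X[OF i] x[OF i]])
      then show "\<exists>y. y \<in> carrier (FO G (X i)) \<and> cpt p (X i) y = x i" by blast
    qed
    from bchoice[OF this] obtain y where y: "\<And>i. i \<in> I \<Longrightarrow> y i \<in> carrier (FO G (X i))"
      "\<And>i. i \<in> I \<Longrightarrow> cpt p (X i) (y i) = x i"
      by blast
    obtain z where z: "z \<in> carrier (FO G P)" "\<And>i. i \<in> I \<Longrightarrow> act G (\<pi> i) z = y i"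
      using continuous_product[OF G_rules I product y(1)] by blast
    show "\<exists>!q. q \<in> carrier (FO Q P) \<and> (\<forall>i\<in>I. act Q (\<pi> i) q = x i)"
    proof (rule ex1I[of _ "cpt p P z"], intro conjI ballI c.closed[OF P z(1)])
      show "act Q (\<pi> i) (cpt p P z) = x i" if "i \<in> I" for i
        using c.natural[OF \<pi>[OF that] z(1)] z(2)[OF that] y(2)[OF that] by simp
    next
      fix q assume q: "q \<in> carrier (FO Q P) \<and> (\<forall>i\<in>I. act Q (\<pi> i) q = x i)"
      then obtain w where w: "w \<in> carrier (FO G P)" "cpt p P w = q"
        using lift[OF P, of q] by blast
      interpret pP: group_hom "FO G P" "FO Q P" "cpt p P" using c.at_group_hom[OF P] .
      let ?d = "w \<otimes>\<^bsub>FO G P\<^esub> inv\<^bsub>FO G P\<^esub> z"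
      have d: "?d \<in> carrier (FO G P)" using w z by simp
      \<comment> \<open>The projections of the difference of the two lifts come from \<open>F\<close>, hence so does the difference.\<close>
      have "\<forall>i\<in>I. \<exists>g. g \<in> carrier (FO F (X i)) \<and> cpt \<alpha> (X i) g = act G (\<pi> i) ?d"
      proof
        fix i assume i: "i \<in> I"
        interpret pX: group_hom "FO G (X i)" "FO Q (X i)" "cpt p (X i)" using c.at_group_hom[OF X[OF i]] .
        interpret \<pi>: group_hom "FO G P" "FO G (X i)" "act G (\<pi> i)" using G.act_group_hom[OF \<pi>[OF i]] .
        have "cpt p (X i) (act G (\<pi> i) w) = cpt p (X i) (act G (\<pi> i) z)"
          using c.natural[OF \<pi>[OF i] w(1)] w(2) q i z(2)[OF i] y(2)[OF i] by simp
        then have "cpt p (X i) (act G (\<pi> i) ?d) = \<one>\<^bsub>FO Q (X i)\<^esub>"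
          using pX.eq_iff_divide[OF \<pi>.hom_closed[OF w(1)] \<pi>.hom_closed[OF z(1)]] w(1) z(1) by simp
        from killed[OF X[OF i] \<pi>.hom_closed[OF d] this]
        obtain g where "g \<in> carrier (FO F (X i))" "cpt \<alpha> (X i) g = act G (\<pi> i) ?d" .
        then show "\<exists>g. g \<in> carrier (FO F (X i)) \<and> cpt \<alpha> (X i) g = act G (\<pi> i) ?d" by blast
      qed
      from bchoice[OF this] obtain g where g: "\<And>i. i \<in> I \<Longrightarrow> g i \<in> carrier (FO F (X i))"
        "\<And>i. i \<in> I \<Longrightarrow> cpt \<alpha> (X i) (g i) = act G (\<pi> i) ?d"
        by blast
      obtain h where h: "h \<in> carrier (FO F P)" "\<And>i. i \<in> I \<Longrightarrow> act F (\<pi> i) h = g i"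
        using continuous_product[OF F_rules I product g(1)] by blast
      have "\<exists>!e. e \<in> carrier (FO G P) \<and> (\<forall>i\<in>I. act G (\<pi> i) e = act G (\<pi> i) ?d)"
        by (rule continuous_product[OF G_rules I product]) (rule G.act_closed[OF \<pi> d])
      moreover have "act G (\<pi> i) (cpt \<alpha> P h) = act G (\<pi> i) ?d" if "i \<in> I" for i
        using natural[OF \<pi>[OF that] h(1)] h(2)[OF that] g(2)[OF that] by simp
      ultimately have "cpt \<alpha> P h = ?d"
        using closed[OF P h(1)] d by blast
      then have "cpt p P ?d = \<one>\<^bsub>FO Q P\<^esub>"
        using kills[OF P h(1)] by simp
      then show "q = cpt p P z"
        using pP.eq_iff_divide[OF w(1) z(1)] w(2) by blast
    qed
  next
    fix I :: "'u set" and r X \<phi> L c l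
    assume I: "small TYPE('u) I" and limit: "is_direct_limit S I r X \<phi> L c" and l: "l \<in> carrier (FO Q L)"
    note system = F.S.directed_systemD[OF is_direct_limitD(1)[OF limit]]
    note L = is_direct_limitD(3)[OF limit] and c = is_direct_limitD(4)[OF limit]
    obtain y where y: "y \<in> carrier (FO G L)" "cpt p L y = l"
      by (rule lift[OF L l])
    obtain i z where i: "i \<in> I" and z: "z \<in> carrier (FO G (X i))" "act G (c i) z = y"
      using continuous_limit_surj[OF G_rules I limit y(1)] by blast
    have "act Q (c i) (cpt p (X i) z) = l" "cpt p (X i) z \<in> carrier (FO Q (X i))"
      using c.natural[OF c[OF i] z(1)] z(2) y(2) c.closed[OF system(6)[OF i] z(1)] by simp_all
    with i show "\<exists>i\<in>I. \<exists>x\<in>carrier (FO Q (X i)). act Q (c i) x = l" by blast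
  next
    fix I :: "'u set" and r X \<phi> L c i x
    assume I: "small TYPE('u) I" and limit: "is_direct_limit S I r X \<phi> L c" and i: "i \<in> I"
      and x: "x \<in> carrier (FO Q (X i))" and dies: "act Q (c i) x = \<one>\<^bsub>FO Q L\<^esub>"
    note system = F.S.directed_systemD[OF is_direct_limitD(1)[OF limit]]
    note L = is_direct_limitD(3)[OF limit] and c = is_direct_limitD(4)[OF limit]
    interpret G_cocone: Ab_cocone I r "\<lambda>i. FO G (X i)" "\<lambda>i j. FA G (\<phi> i j)" "FO G L" "\<lambda>i. FA G (c i)"
      using G.FA_directed_system[OF is_direct_limitD(1)[OF limit]]
        G.FA_cocone[OF is_direct_limitD(1,2)[OF limit]] by unfold_locales
    obtain y where y: "y \<in> carrier (FO G (X i))" "cpt p (X i) y = x"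
      by (rule lift[OF system(6)[OF i] x])
    have "cpt p L (act G (c i) y) = \<one>\<^bsub>FO Q L\<^esub>"
      using c.natural[OF c[OF i] y(1)] y(2) dies by simp
    then obtain g where g: "g \<in> carrier (FO F L)" "cpt \<alpha> L g = act G (c i) y"
      by (rule killed[OF L G.act_closed[OF c[OF i] y(1)]])
    obtain j z where j: "j \<in> I" and z: "z \<in> carrier (FO F (X j))" "act F (c j) z = g"
      using continuous_limit_surj[OF F_rules I limit g(1)] by blast
    have z': "cpt \<alpha> (X j) z \<in> carrier (FO G (X j))"
      by (rule closed[OF system(6)[OF j] z(1)])
    have "act G (c i) y = act G (c j) (cpt \<alpha> (X j) z)"
      using natural[OF c[OF j] z(1)] z(2) g(2) by simp
    from G_cocone.eventually_eq[OF continuous_limit_kernel[OF G_rules I limit] i y(1) j z' this]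
    obtain k where k: "(i, k) \<in> r" "(j, k) \<in> r" "act G (\<phi> i k) y = act G (\<phi> j k) (cpt \<alpha> (X j) z)" .
    note kI = conjunct2[OF system(4)[OF k(1)]]
    have "act Q (\<phi> i k) x = cpt p (X k) (act G (\<phi> i k) y)"
      using c.natural[OF system(7)[OF k(1)] y(1)] y(2) by simp
    also have "\<dots> = cpt p (X k) (cpt \<alpha> (X k) (act F (\<phi> j k) z))"
      using k(3) natural[OF system(7)[OF k(2)] z(1)] by simp
    also have "\<dots> = \<one>\<^bsub>FO Q (X k)\<^esub>"
      by (rule kills[OF system(6)[OF kI] F.act_closed[OF system(7)[OF k(2)] z(1)]])
    finally show "\<exists>j. (i, j) \<in> r \<and> act Q (\<phi> i j) x = \<one>\<^bsub>FO Q (X j)\<^esub>"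
      using k(1) by blast
  qed
qed

section \<open>Categorical kernels and cokernels are pointwise\<close>

abbreviation continuous_functor_cat :: "('o, 'u) precat \<Rightarrow> (('o, 'u) abfunc, ('o, 'u) abnat) precat" where
  "continuous_functor_cat S \<equiv> full_sub (functor_cat S Ab) (continuous_functors S)"

lemma is_kernel_factors:
  assumes "is_kernel C f k" "Z \<in> Obj C" "g \<in> hom_set C Z (Src C f)" "f \<cdot>\<^bsub>C\<^esub> g = Zro C Z (Tgt C f)"
  shows "\<exists>!u. u \<in> hom_set C Z (Src C k) \<and> k \<cdot>\<^bsub>C\<^esub> u = g"
  using assms by (simp add: is_kernel_def)

lemma is_cokernel_factors:
  assumes "is_cokernel C f p" "Z \<in> Obj C" "g \<in> hom_set C (Tgt C f) Z" "g \<cdot>\<^bsub>C\<^esub> f = Zro C (Src C f) Z"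
  shows "\<exists>!u. u \<in> hom_set C (Tgt C p) Z \<and> u \<cdot>\<^bsub>C\<^esub> p = g"
  using assms by (simp add: is_cokernel_def)

lemma continuous_kernel_exists:
  fixes F :: "('o, 'u) abfunc"
  assumes "universe TYPE('u)" and \<alpha>: "\<alpha> \<in> hom_set (continuous_functor_cat S) F G"
  obtains K k where "k \<in> hom_set (continuous_functor_cat S) K F" "pointwise_kernel S \<alpha> k"
    "is_kernel (continuous_functor_cat S) \<alpha> k"
proof -
  have \<alpha>': "\<alpha> \<in> hom_set (functor_cat S Ab) F G" and FG: "F \<in> continuous_functors S" "G \<in> continuous_functors S"
    using \<alpha> by (simp_all add: hom_set_full_sub_iff)
  obtain K k where k: "k \<in> hom_set (functor_cat S Ab) K F" "pointwise_kernel S \<alpha> k"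
    by (rule pointwise_kernel_exists[OF \<alpha>'])
  have k': "k \<in> hom_set (continuous_functor_cat S) K F"
    using k(1) pointwise_kernel_continuous[OF assms(1) \<alpha>' FG k] FG(1) by (simp add: hom_set_full_sub_iff)
  show thesis
    by (rule that[OF k' k(2) is_kernel_of_pointwise[OF \<alpha> k' k(2)]])
qed

lemma continuous_cokernel_exists:
  fixes F :: "('o, 'u) abfunc"
  assumes "universe TYPE('u)" and \<alpha>: "\<alpha> \<in> hom_set (continuous_functor_cat S) F G"
  obtains Q c where "c \<in> hom_set (continuous_functor_cat S) G Q" "pointwise_cokernel S \<alpha> c"
    "is_cokernel (continuous_functor_cat S) \<alpha> c"
proof -
  have \<alpha>': "\<alpha> \<in> hom_set (functor_cat S Ab) F G" and FG: "F \<in> continuous_functors S" "G \<in> continuous_functors S"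
    using \<alpha> by (simp_all add: hom_set_full_sub_iff)
  obtain Q c where c: "c \<in> hom_set (functor_cat S Ab) G Q" "pointwise_cokernel S \<alpha> c"
    by (rule pointwise_cokernel_exists[OF \<alpha>'])
  have c': "c \<in> hom_set (continuous_functor_cat S) G Q"
    using c(1) pointwise_cokernel_continuous[OF assms(1) \<alpha>' FG c] FG(2) by (simp add: hom_set_full_sub_iff)
  show thesis
    by (rule that[OF c' c(2) is_cokernel_of_pointwise[OF \<alpha> c' c(2)]])
qed

lemma Obj_of_hom_continuous:
  assumes "\<alpha> \<in> hom_set (full_sub (functor_cat S D) P) F G"
  shows "F \<in> Obj (full_sub (functor_cat S D) P)" "G \<in> Obj (full_sub (functor_cat S D) P)"
  using assms by (auto simp: hom_set_full_sub_iff hom_set_functor_cat Obj_functor_cat)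

lemma (in preadditive_category) is_kernel_unique:
  assumes k: "is_kernel C f k" and k': "is_kernel C f k'"
  obtains u v where "u \<in> hom_set C (Src C k) (Src C k')" "v \<in> hom_set C (Src C k') (Src C k)"
    "k' \<cdot> u = k" "k \<cdot> v = k'" "v \<cdot> u = Ident C (Src C k)"
proof -
  have hom: "l \<in> hom_set C (Src C l) (Src C f)" "Src C l \<in> Obj C" "f \<cdot> l = Zro C (Src C l) (Tgt C f)"
    if "is_kernel C f l" for l
    using that src_obj by (auto simp: is_kernel_def hom_set_def)
  obtain u where u: "u \<in> hom_set C (Src C k) (Src C k')" "k' \<cdot> u = k"
    using is_kernel_factors[OF k' hom(2,1,3)[OF k]] by blast
  obtain v where v: "v \<in> hom_set C (Src C k') (Src C k)" "k \<cdot> v = k'"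
    using is_kernel_factors[OF k hom(2,1,3)[OF k']] by blast
  have "k \<cdot> (v \<cdot> u) = k"
    using comp_assoc[OF u(1) v(1) hom(1)[OF k]] u(2) v(2) by simp
  then have "v \<cdot> u = Ident C (Src C k)"
    using is_kernel_factors[OF k hom(2,1,3)[OF k]] comp_hom[OF u(1) v(1)] ident_hom[OF hom(2)[OF k]]
      comp_ident_right[OF hom(1)[OF k]] by blast
  with u v show thesis using that by blast
qed

lemma (in preadditive_category) is_cokernel_unique:
  assumes c: "is_cokernel C f c" and c': "is_cokernel C f c'"
  obtains u v where "u \<in> hom_set C (Tgt C c) (Tgt C c')" "v \<in> hom_set C (Tgt C c') (Tgt C c)"
    "u \<cdot> c = c'" "v \<cdot> c' = c" "v \<cdot> u = Ident C (Tgt C c)"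
proof -
  have hom: "l \<in> hom_set C (Tgt C f) (Tgt C l)" "Tgt C l \<in> Obj C" "l \<cdot> f = Zro C (Src C f) (Tgt C l)"
    if "is_cokernel C f l" for l
    using that tgt_obj by (auto simp: is_cokernel_def hom_set_def)
  obtain u where u: "u \<in> hom_set C (Tgt C c) (Tgt C c')" "u \<cdot> c = c'"
    using is_cokernel_factors[OF c hom(2,1,3)[OF c']] by blast
  obtain v where v: "v \<in> hom_set C (Tgt C c') (Tgt C c)" "v \<cdot> c' = c"
    using is_cokernel_factors[OF c' hom(2,1,3)[OF c]] by blast
  have "(v \<cdot> u) \<cdot> c = c"
    using comp_assoc[OF hom(1)[OF c] u(1) v(1)] u(2) v(2) by simp
  then have "v \<cdot> u = Ident C (Tgt C c)"
    using is_cokernel_factors[OF c hom(2,1,3)[OF c]] comp_hom[OF u(1) v(1)] ident_hom[OF hom(2)[OF c]]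
      comp_ident_left[OF hom(1)[OF c]] by blast
  with u v show thesis using that by blast
qed

text \<open>A categorical kernel is isomorphic to the pointwise one, hence is pointwise itself.\<close>

lemma is_kernel_pointwise:
  fixes F :: "('o, 'u) abfunc"
  assumes universe: "universe TYPE('u)" and preadditive: "preadditive_category (continuous_functor_cat S)"
    and \<alpha>: "\<alpha> \<in> hom_set (continuous_functor_cat S) F G"
    and kernel: "is_kernel (continuous_functor_cat S) \<alpha> k"
  shows "pointwise_kernel S \<alpha> k"
proof -
  let ?A = "continuous_functor_cat S"
  obtain K' k' where k'_hom: "k' \<in> hom_set ?A K' F" and pointwise: "pointwise_kernel S \<alpha> k'"
    and kernel': "is_kernel ?A \<alpha> k'"
    by (rule continuous_kernel_exists[OF universe \<alpha>])
  obtain u v where "u \<in> hom_set ?A (Src ?A k) (Src ?A k')" "v \<in> hom_set ?A (Src ?A k') (Src ?A k)"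
    and u_comp: "k' \<cdot>\<^bsub>?A\<^esub> u = k" and v_comp: "k \<cdot>\<^bsub>?A\<^esub> v = k'" and vu_comp: "v \<cdot>\<^bsub>?A\<^esub> u = Ident ?A (Src ?A k)"
    by (rule preadditive_category.is_kernel_unique[OF preadditive kernel kernel'])
  moreover define K where "K = NSrc k"
  ultimately have u: "u \<in> hom_set ?A K K'" and v: "v \<in> hom_set ?A K' K"
    using hom_setD[OF k'_hom] by simp_all
  have k_hom: "k \<in> hom_set ?A K F"
    using kernel hom_setD[OF \<alpha>] by (simp add: is_kernel_def hom_set_def K_def)
  interpret Ab_nat_kernel S F G \<alpha> K' k'
    using \<alpha> k'_hom pointwise by unfold_locales (auto simp: hom_set_full_sub_iff)
  interpret k2: Ab_nat S K F k
    using k_hom by unfold_locales (auto simp: hom_set_full_sub_iff)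
  interpret u: Ab_nat S K K' u
    using u by unfold_locales (auto simp: hom_set_full_sub_iff)
  interpret v: Ab_nat S K' K v
    using v by unfold_locales (auto simp: hom_set_full_sub_iff)
  have ku: "cpt k' A (cpt u A x) = cpt k A x" if "A \<in> Obj S" "x \<in> carrier (FO K A)" for A x
    using u.comp_fun[OF that, of k'] u_comp by simp
  have kv: "cpt k A (cpt v A x) = cpt k' A x" if "A \<in> Obj S" "x \<in> carrier (FO K' A)" for A x
    using v.comp_fun[OF that, of k] v_comp by simp
  have vu: "cpt v A (cpt u A x) = x" if "A \<in> Obj S" "x \<in> carrier (FO K A)" for A x
    using u.comp_fun[OF that, of v] cpt_ident[OF that] vu_comp by (simp add: K_def)
  show ?thesis
    unfolding pointwise_kernel_def k2.NSrc NSrc NTgt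
  proof
    fix A assume A: "A \<in> Obj S"
    have "inj_on (cpt k A) (carrier (FO K A))"
    proof (rule inj_onI)
      fix x y assume x: "x \<in> carrier (FO K A)" and y: "y \<in> carrier (FO K A)" and "cpt k A x = cpt k A y"
      then have "cpt u A x = cpt u A y"
        using inj[OF A u.closed[OF A x] u.closed[OF A y]] ku[OF A] by simp
      then have "cpt v A (cpt u A x) = cpt v A (cpt u A y)"
        by (rule arg_cong)
      then show "x = y"
        unfolding vu[OF A x] vu[OF A y] .
    qed
    moreover have "cpt k A ` carrier (FO K A) = cpt k' A ` carrier (FO K' A)"
    proof (intro equalityI image_subsetI)
      fix x assume x: "x \<in> carrier (FO K A)"
      show "cpt k A x \<in> cpt k' A ` carrier (FO K' A)"
        by (rule image_eqI[where f = "cpt k' A", OF ku[OF A x, symmetric] u.closed[OF A x]])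
    next
      fix x assume x: "x \<in> carrier (FO K' A)"
      show "cpt k' A x \<in> cpt k A ` carrier (FO K A)"
        by (rule image_eqI[where f = "cpt k A", OF kv[OF A x, symmetric] v.closed[OF A x]])
    qed
    ultimately show "inj_on (cpt k A) (carrier (FO K A)) \<and>
        cpt k A ` carrier (FO K A) = {x \<in> carrier (FO F A). cpt \<alpha> A x = \<one>\<^bsub>FO G A\<^esub>}"
      using image[OF A] by simp
  qed
qed

text \<open>Two cokernels of the same arrow are isomorphic, and the pointwise one is onto.\<close>

lemma is_cokernel_surj:
  fixes F :: "('o, 'u) abfunc"
  assumes universe: "universe TYPE('u)" and preadditive: "preadditive_category (continuous_functor_cat S)"
    and \<alpha>: "\<alpha> \<in> hom_set (continuous_functor_cat S) F G"
    and c_hom: "c \<in> hom_set (continuous_functor_cat S) G Q"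
    and cokernel: "is_cokernel (continuous_functor_cat S) \<alpha> c"
    and A: "A \<in> Obj S" and q: "q \<in> carrier (FO Q A)"
  obtains y where "y \<in> carrier (FO G A)" "cpt c A y = q"
proof -
  let ?A = "continuous_functor_cat S"
  obtain Q' c' where c'_hom: "c' \<in> hom_set ?A G Q'" and pointwise: "pointwise_cokernel S \<alpha> c'"
    and cokernel': "is_cokernel ?A \<alpha> c'"
    by (rule continuous_cokernel_exists[OF universe \<alpha>])
  obtain u v where "u \<in> hom_set ?A (Tgt ?A c) (Tgt ?A c')" "v \<in> hom_set ?A (Tgt ?A c') (Tgt ?A c)"
    and u_comp: "u \<cdot>\<^bsub>?A\<^esub> c = c'" and v_comp: "v \<cdot>\<^bsub>?A\<^esub> c' = c" and vu_comp: "v \<cdot>\<^bsub>?A\<^esub> u = Ident ?A (Tgt ?A c)"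
    by (rule preadditive_category.is_cokernel_unique[OF preadditive cokernel cokernel'])
  then have u: "u \<in> hom_set ?A Q Q'" and v: "v \<in> hom_set ?A Q' Q"
    using hom_setD[OF c_hom] hom_setD[OF c'_hom] by simp_all
  interpret Ab_nat_cokernel S F G \<alpha> Q' c'
    using \<alpha> c'_hom pointwise by unfold_locales (auto simp: hom_set_full_sub_iff)
  interpret c2: Ab_nat S G Q c
    using c_hom by unfold_locales (auto simp: hom_set_full_sub_iff)
  interpret u: Ab_nat S Q Q' u
    using u by unfold_locales (auto simp: hom_set_full_sub_iff)
  have vc: "cpt v A (cpt c' A y) = cpt c A y" if "A \<in> Obj S" "y \<in> carrier (FO G A)" for A y
    using c.comp_fun[OF that, of v] v_comp by simp
  have vu: "cpt v A (cpt u A q) = q"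
    using u.comp_fun[OF A q, of v] cpt_ident[OF A q] vu_comp c2.NTgt by simp
  obtain y where y: "y \<in> carrier (FO G A)" "cpt c' A y = cpt u A q"
    by (rule lift[OF A u.closed[OF A q]])
  then have "cpt c A y = q"
    using vc[OF A y(1)] vu by simp
  with y(1) show thesis by (rule that)
qed

section \<open>Exact tensor products and intersections of images\<close>

lemma short_exact_of_pointwise:
  fixes F :: "('o, 'u) abfunc"
  assumes p: "p \<in> hom_set (continuous_functor_cat S) F G" and k: "k \<in> hom_set (continuous_functor_cat S) K F"
    and kernel: "pointwise_kernel S p k"
    and surj: "\<And>A y. \<lbrakk>A \<in> Obj S; y \<in> carrier (FO G A)\<rbrakk> \<Longrightarrow> \<exists>x\<in>carrier (FO F A). cpt p A x = y"
  shows "short_exact (continuous_functor_cat S) k p"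
proof -
  interpret Ab_nat_kernel S F G p K k
    using p k kernel by unfold_locales (auto simp: hom_set_full_sub_iff)
  have "cpt p A ` carrier (FO F A) = carrier (FO G A)" if "A \<in> Obj S" for A
    using surj[OF that] closed[OF that] by auto
  then have "pointwise_cokernel S k p"
    using NSrc NTgt k.NSrc k.NTgt image by (simp add: pointwise_cokernel_def)
  then show ?thesis
    using is_kernel_of_pointwise[OF p k kernel] is_cokernel_of_pointwise[OF k p] by (simp add: short_exact_def)
qed

text \<open>The image is the kernel of the cokernel; as both are pointwise, the first factor is onto at each object
  and hence is the cokernel of its own kernel.\<close>

lemma image_factorisation:
  fixes F :: "('o, 'u) abfunc"
  assumes universe: "universe TYPE('u)" and \<alpha>: "\<alpha> \<in> hom_set (continuous_functor_cat S) F G"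
  obtains K J Q k e m q where
    "k \<in> hom_set (continuous_functor_cat S) K F" "e \<in> hom_set (continuous_functor_cat S) F J"
    "m \<in> hom_set (continuous_functor_cat S) J G" "q \<in> hom_set (continuous_functor_cat S) G Q"
    "m \<cdot>\<^bsub>continuous_functor_cat S\<^esub> e = \<alpha>"
    "short_exact (continuous_functor_cat S) k e" "short_exact (continuous_functor_cat S) m q"
proof -
  let ?A = "continuous_functor_cat S"
  obtain Q q where q: "q \<in> hom_set ?A G Q" "pointwise_cokernel S \<alpha> q" "is_cokernel ?A \<alpha> q"
    by (rule continuous_cokernel_exists[OF universe \<alpha>])
  obtain J m where m: "m \<in> hom_set ?A J G" "pointwise_kernel S q m" "is_kernel ?A q m"
    by (rule continuous_kernel_exists[OF universe q(1)])
  have "q \<cdot>\<^bsub>?A\<^esub> \<alpha> = Zro ?A F Q"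
    using q(3) hom_setD[OF \<alpha>] hom_setD[OF q(1)] by (simp add: is_cokernel_def)
  then obtain e where e: "e \<in> hom_set ?A F J" "m \<cdot>\<^bsub>?A\<^esub> e = \<alpha>"
    using is_kernel_factors[OF m(3) Obj_of_hom_continuous(1)[OF \<alpha>], of \<alpha>] \<alpha>
      hom_setD[OF q(1)] hom_setD[OF m(1)] by auto
  obtain K k where k: "k \<in> hom_set ?A K F" "pointwise_kernel S e k" "is_kernel ?A e k"
    by (rule continuous_kernel_exists[OF universe e(1)])
  interpret q: Ab_nat_cokernel S F G \<alpha> Q q
    using \<alpha> q by unfold_locales (auto simp: hom_set_full_sub_iff)
  interpret m: Ab_nat_kernel S G Q q J m
    using q m by unfold_locales (auto simp: hom_set_full_sub_iff)
  interpret e: Ab_nat S F J e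
    using e by unfold_locales (auto simp: hom_set_full_sub_iff)
  have "short_exact ?A k e"
  proof (rule short_exact_of_pointwise[OF e(1) k(1,2)])
    fix A y assume A: "A \<in> Obj S" and y: "y \<in> carrier (FO J A)"
    obtain x where x: "x \<in> carrier (FO F A)" "cpt \<alpha> A x = cpt m A y"
      by (rule q.killed[OF A m.k.closed[OF A y] m.kills[OF A y]])
    have "cpt m A (cpt e A x) = cpt m A y"
      using e.comp_fun[OF A x(1), of m] e(2) x(2) by simp
    then have "cpt e A x = y"
      by (rule m.inj[OF A e.closed[OF A x(1)] y])
    with x(1) show "\<exists>x\<in>carrier (FO F A). cpt e A x = y" by blast
  qed
  moreover have "short_exact ?A m q"
  proof (rule short_exact_of_pointwise[OF q(1) m(1,2)])
    fix A y assume A: "A \<in> Obj S" and y: "y \<in> carrier (FO Q A)"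
    obtain x where "x \<in> carrier (FO G A)" "cpt q A x = y" by (rule q.lift[OF A y])
    then show "\<exists>x\<in>carrier (FO G A). cpt q A x = y" by blast
  qed
  ultimately show thesis
    by (rule that[OF k(1) e(1) m(1) q(1) e(2)])
qed

text \<open>With images \<open>J\<close> of \<open>\<alpha>\<close> and \<open>J'\<close> of \<open>\<beta>\<close> this is the statement that \<open>J \<otimes> G'\<close> and \<open>F' \<otimes> J'\<close> meet in
  \<open>J \<otimes> J'\<close> inside \<open>F' \<otimes> G'\<close>.  The square formed by these four objects has cokernels \<open>J \<otimes> Q'\<close> and
  \<open>F' \<otimes> Q'\<close> in the direction of \<open>G'\<close>, where \<open>Q'\<close> is the cokernel of \<open>\<beta>\<close>, and it is a pullback because
  \<open>J \<otimes> Q' \<rightarrow> F' \<otimes> Q'\<close> is a monomorphism.\<close>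

lemma exact_tensor_image_intersection:
  fixes F :: "('o, 'u) abfunc"
  assumes universe: "universe TYPE('u)"
    and monoidal: "additive_symmetric_monoidal_category (continuous_functor_cat S) T"
    and exact: "exact_in_each_variable (continuous_functor_cat S) T"
    and \<alpha>: "\<alpha> \<in> hom_set (continuous_functor_cat S) F F'"
    and \<beta>: "\<beta> \<in> hom_set (continuous_functor_cat S) G G'"
    and A: "A \<in> Obj S"
    and x: "x \<in> carrier (FO (F \<odot>\<^bsub>T\<^esub> G') A)"
      "cpt (\<alpha> \<boxtimes>\<^bsub>T\<^esub> Ident (continuous_functor_cat S) G') A x = z"
    and y: "y \<in> carrier (FO (F' \<odot>\<^bsub>T\<^esub> G) A)"
      "cpt (Ident (continuous_functor_cat S) F' \<boxtimes>\<^bsub>T\<^esub> \<beta>) A y = z"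
  obtains w where "w \<in> carrier (FO (F \<odot>\<^bsub>T\<^esub> G) A)" "cpt (\<alpha> \<boxtimes>\<^bsub>T\<^esub> \<beta>) A w = z"
proof -
  let ?A = "continuous_functor_cat S"
  interpret T: additive_symmetric_monoidal_category ?A T by fact
  obtain K J Q k e m q where
    k: "k \<in> hom_set ?A K F" and e: "e \<in> hom_set ?A F J" and m: "m \<in> hom_set ?A J F'" and q: "q \<in> hom_set ?A F' Q"
    and me: "m \<cdot>\<^bsub>?A\<^esub> e = \<alpha>" and ke_exact: "short_exact ?A k e" and mq_exact: "short_exact ?A m q"
    by (rule image_factorisation[OF universe \<alpha>])
  obtain K' J' Q' k' e' m' q' where
    k': "k' \<in> hom_set ?A K' G" and e': "e' \<in> hom_set ?A G J'" and m': "m' \<in> hom_set ?A J' G'"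
    and q': "q' \<in> hom_set ?A G' Q'"
    and me': "m' \<cdot>\<^bsub>?A\<^esub> e' = \<beta>" and ke'_exact: "short_exact ?A k' e'" and mq'_exact: "short_exact ?A m' q'"
    by (rule image_factorisation[OF universe \<beta>])
  note objs = T.hom_set_objs[OF \<alpha>] T.hom_set_objs[OF \<beta>] T.hom_set_objs[OF m] T.hom_set_objs[OF m']
    T.hom_set_objs[OF q] T.hom_set_objs[OF q']
  have id: "Ident ?A F \<in> hom_set ?A F F" "Ident ?A F' \<in> hom_set ?A F' F'" "Ident ?A G \<in> hom_set ?A G G"
    "Ident ?A G' \<in> hom_set ?A G' G'" "Ident ?A J \<in> hom_set ?A J J" "Ident ?A J' \<in> hom_set ?A J' J'"
    "Ident ?A Q \<in> hom_set ?A Q Q" "Ident ?A Q' \<in> hom_set ?A Q' Q'"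
    by (rule T.ident_hom, rule objs)+
  note th = T.tensor_hom
  have comp: "cpt (g \<boxtimes>\<^bsub>T\<^esub> g') A (cpt (f \<boxtimes>\<^bsub>T\<^esub> f') A t) = cpt (h \<boxtimes>\<^bsub>T\<^esub> h') A t"
    if "f \<in> hom_set ?A X Y" "g \<in> hom_set ?A Y Z" "f' \<in> hom_set ?A X' Y'" "g' \<in> hom_set ?A Y' Z'"
      and "t \<in> carrier (FO (X \<odot>\<^bsub>T\<^esub> X') A)" and "g \<cdot>\<^bsub>?A\<^esub> f = h" "g' \<cdot>\<^bsub>?A\<^esub> f' = h'"
    for f g h f' g' h' X Y Z X' Y' Z' t
  proof -
    have ff': "f \<boxtimes>\<^bsub>T\<^esub> f' \<in> hom_set (functor_cat S Ab) (X \<odot>\<^bsub>T\<^esub> X') (Y \<odot>\<^bsub>T\<^esub> Y')"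
      using th[OF that(1,3)] by (simp add: hom_set_full_sub_iff)
    show ?thesis
      using T.tensor_comp[OF that(1-4)] cpt_comp[OF ff' A that(5), of "g \<boxtimes>\<^bsub>T\<^esub> g'"] that(6,7) by simp
  qed
  have closed: "cpt (f \<boxtimes>\<^bsub>T\<^esub> f') A t \<in> carrier (FO (Y \<odot>\<^bsub>T\<^esub> Y') A)"
    if "f \<in> hom_set ?A X Y" "f' \<in> hom_set ?A X' Y'" "t \<in> carrier (FO (X \<odot>\<^bsub>T\<^esub> X') A)" for f f' X Y X' Y' t
    using cpt_closed[OF _ A that(3), of "f \<boxtimes>\<^bsub>T\<^esub> f'" "Y \<odot>\<^bsub>T\<^esub> Y'"] th[OF that(1,2)] by (simp add: hom_set_full_sub_iff)
  have exact_left: "short_exact ?A (f \<boxtimes>\<^bsub>T\<^esub> Ident ?A X) (g \<boxtimes>\<^bsub>T\<^esub> Ident ?A X)"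
    and exact_right: "short_exact ?A (Ident ?A X \<boxtimes>\<^bsub>T\<^esub> f) (Ident ?A X \<boxtimes>\<^bsub>T\<^esub> g)"
    if "X \<in> Obj ?A" "short_exact ?A f g" for f g X
    using exact that by (simp_all add: exact_in_each_variable_def)
  note idl = T.comp_ident_left and idr = T.comp_ident_right
  \<comment> \<open>\<open>z\<close> comes from \<open>J \<otimes> G'\<close> and from \<open>F' \<otimes> J'\<close>, where \<open>J\<close> and \<open>J'\<close> are the images of \<open>\<alpha>\<close> and \<open>\<beta>\<close>.\<close>
  define a where "a = cpt (e \<boxtimes>\<^bsub>T\<^esub> Ident ?A G') A x"
  define b where "b = cpt (Ident ?A F' \<boxtimes>\<^bsub>T\<^esub> e') A y"
  have a: "a \<in> carrier (FO (J \<odot>\<^bsub>T\<^esub> G') A)" and za: "cpt (m \<boxtimes>\<^bsub>T\<^esub> Ident ?A G') A a = z"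
    unfolding a_def using closed[OF e id(4) x(1)] comp[OF e m id(4) id(4) x(1) me idl[OF id(4)]] x(2) by simp_all
  have b: "b \<in> carrier (FO (F' \<odot>\<^bsub>T\<^esub> J') A)" and zb: "cpt (Ident ?A F' \<boxtimes>\<^bsub>T\<^esub> m') A b = z"
    unfolding b_def using closed[OF id(2) e' y(1)] comp[OF id(2) id(2) e' m' y(1) idl[OF id(2)] me'] y(2) by simp_all
  \<comment> \<open>Hence the image of \<open>a\<close> in \<open>F' \<otimes> Q'\<close> vanishes, and as \<open>J \<otimes> Q'\<close> embeds there, \<open>a\<close> comes from
    \<open>J \<otimes> J'\<close>.\<close>
  interpret M1: Ab_nat_kernel S "F' \<odot>\<^bsub>T\<^esub> G'" "F' \<odot>\<^bsub>T\<^esub> Q'" "Ident ?A F' \<boxtimes>\<^bsub>T\<^esub> q'"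
      "F' \<odot>\<^bsub>T\<^esub> J'" "Ident ?A F' \<boxtimes>\<^bsub>T\<^esub> m'"
    using th[OF id(2) q'] th[OF id(2) m'] is_kernel_pointwise[OF universe T.preadditive_category_axioms th[OF id(2) q']]
      exact_right[OF objs(2) mq'_exact]
    by unfold_locales (auto simp: hom_set_full_sub_iff short_exact_def)
  interpret M2: Ab_nat_kernel S "F' \<odot>\<^bsub>T\<^esub> Q'" "Q \<odot>\<^bsub>T\<^esub> Q'" "q \<boxtimes>\<^bsub>T\<^esub> Ident ?A Q'"
      "J \<odot>\<^bsub>T\<^esub> Q'" "m \<boxtimes>\<^bsub>T\<^esub> Ident ?A Q'"
    using th[OF q id(8)] th[OF m id(8)] is_kernel_pointwise[OF universe T.preadditive_category_axioms th[OF q id(8)]]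
      exact_left[OF objs(12) mq_exact]
    by unfold_locales (auto simp: hom_set_full_sub_iff short_exact_def)
  interpret M3: Ab_nat_kernel S "J \<odot>\<^bsub>T\<^esub> G'" "J \<odot>\<^bsub>T\<^esub> Q'" "Ident ?A J \<boxtimes>\<^bsub>T\<^esub> q'"
      "J \<odot>\<^bsub>T\<^esub> J'" "Ident ?A J \<boxtimes>\<^bsub>T\<^esub> m'"
    using th[OF id(5) q'] th[OF id(5) m'] is_kernel_pointwise[OF universe T.preadditive_category_axioms th[OF id(5) q']]
      exact_right[OF objs(5) mq'_exact]
    by unfold_locales (auto simp: hom_set_full_sub_iff short_exact_def)
  have "cpt (Ident ?A F' \<boxtimes>\<^bsub>T\<^esub> q') A z = \<one>\<^bsub>FO (F' \<odot>\<^bsub>T\<^esub> Q') A\<^esub>"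
    using M1.kills[OF A b] zb by simp
  moreover have "cpt (Ident ?A F' \<boxtimes>\<^bsub>T\<^esub> q') A z = cpt (m \<boxtimes>\<^bsub>T\<^esub> q') A a"
    using comp[OF m id(2) id(4) q' a idl[OF m] idr[OF q']] za by simp
  moreover have "\<dots> = cpt (m \<boxtimes>\<^bsub>T\<^esub> Ident ?A Q') A (cpt (Ident ?A J \<boxtimes>\<^bsub>T\<^esub> q') A a)"
    using comp[OF id(5) m q' id(8) a idr[OF m] idl[OF q']] by simp
  ultimately have "cpt (m \<boxtimes>\<^bsub>T\<^esub> Ident ?A Q') A (cpt (Ident ?A J \<boxtimes>\<^bsub>T\<^esub> q') A a) =
      cpt (m \<boxtimes>\<^bsub>T\<^esub> Ident ?A Q') A \<one>\<^bsub>FO (J \<odot>\<^bsub>T\<^esub> Q') A\<^esub>"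
    using M2.k.at_one[OF A] by simp
  then have "cpt (Ident ?A J \<boxtimes>\<^bsub>T\<^esub> q') A a = \<one>\<^bsub>FO (J \<odot>\<^bsub>T\<^esub> Q') A\<^esub>"
    by (rule M2.inj[OF A M3.closed[OF A a] comm_groupE(2)[OF M2.k.F.value_comm_group[OF A]]])
  then obtain c where c: "c \<in> carrier (FO (J \<odot>\<^bsub>T\<^esub> J') A)" "cpt (Ident ?A J \<boxtimes>\<^bsub>T\<^esub> m') A c = a"
    by (rule M3.lift[OF A a])
  \<comment> \<open>The tensor product of the two epimorphisms onto the images is onto.\<close>
  obtain d where d: "d \<in> carrier (FO (J \<odot>\<^bsub>T\<^esub> G) A)" "cpt (Ident ?A J \<boxtimes>\<^bsub>T\<^esub> e') A d = c"
    using exact_right[OF objs(5) ke'_exact] unfolding short_exact_def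
    by (elim conjE) (rule is_cokernel_surj[OF universe T.preadditive_category_axioms th[OF id(5) k'] th[OF id(5) e'] _ A c(1)])
  obtain w where w: "w \<in> carrier (FO (F \<odot>\<^bsub>T\<^esub> G) A)" "cpt (e \<boxtimes>\<^bsub>T\<^esub> Ident ?A G) A w = d"
    using exact_left[OF objs(3) ke_exact] unfolding short_exact_def
    by (elim conjE) (rule is_cokernel_surj[OF universe T.preadditive_category_axioms th[OF k id(3)] th[OF e id(3)] _ A d(1)])
  have "cpt (\<alpha> \<boxtimes>\<^bsub>T\<^esub> \<beta>) A w = cpt (m \<boxtimes>\<^bsub>T\<^esub> m') A (cpt (e \<boxtimes>\<^bsub>T\<^esub> e') A w)"
    using comp[OF e m e' m' w(1) me me'] by simp
  also have "cpt (e \<boxtimes>\<^bsub>T\<^esub> e') A w = c"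
    using comp[OF e id(5) id(3) e' w(1) idl[OF e] idr[OF e']] w(2) d(2) by simp
  also have "cpt (m \<boxtimes>\<^bsub>T\<^esub> m') A c = z"
    using comp[OF id(5) m m' id(4) c(1) idr[OF m] idl[OF m']] c(2) za by simp
  finally show thesis
    by (rule that[OF w(1)])
qed

section \<open>Representable functors and their extensions\<close>

lemma carrier_hom_group [simp]: "carrier (hom_group C A B) = hom_set C A B"
  and mult_hom_group [simp]: "mult (hom_group C A B) = Plus C"
  and one_hom_group [simp]: "one (hom_group C A B) = Zro C A B"
  by (simp_all add: hom_group_def)

lemma hom_functor_make_functor:
  "hom_functor C A = make_functor C (hom_group C A) (\<lambda>f h. f \<cdot>\<^bsub>C\<^esub> h)"
  by (simp add: hom_functor_def make_functor_def)

lemma FO_hom_functor [simp]: "FO (hom_functor C A) X = hom_group C A X"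
  by (simp add: hom_functor_def)

lemma act_hom_functor:
  "\<lbrakk>f \<in> hom_set C X Y; h \<in> hom_set C A X\<rbrakk> \<Longrightarrow> act (hom_functor C A) f h = f \<cdot>\<^bsub>C\<^esub> h"
  by (auto simp: hom_functor_def hom_set_def)

lemma (in preadditive_category) hom_functor_Ab_functor:
  assumes "locally_small C" "A \<in> Obj C"
  shows "Ab_functor C (hom_functor C A)"
  unfolding hom_functor_make_functor
proof (rule make_functor_Ab_functor[OF preadditive_category_axioms])
  show "hom_group C A X \<in> Obj Ab" if "X \<in> Obj C" for X
    using assms that hom_comm_group by (simp add: Ab_Obj_iff locally_small_def)
qed (auto simp: hom_def intro: comp_hom comp_plus_right comp_plus_left comp_ident_left comp_assoc)

lemma (in Ab_nat) pointwise_inverse: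
  assumes bij: "\<And>A. A \<in> Obj S \<Longrightarrow> bij_betw (cpt \<alpha> A) (carrier (FO F A)) (carrier (FO G A))"
  shows "make_nat S G F (\<lambda>A. inv_into (carrier (FO F A)) (cpt \<alpha> A)) \<in> hom_set (functor_cat S Ab) G F"
proof (rule make_nat_hom[OF G.Ab_functor_axioms F.Ab_functor_axioms])
  let ?inv = "\<lambda>A. inv_into (carrier (FO F A)) (cpt \<alpha> A)"
  fix A assume A: "A \<in> Obj S"
  interpret group_hom "FO F A" "FO G A" "cpt \<alpha> A" by (rule at_group_hom[OF A])
  have "cpt \<alpha> A \<in> iso (FO F A) (FO G A)"
    using bij[OF A] homh by (simp add: iso_def)
  from G.iso_set_sym[OF this] show "?inv A \<in> hom (FO G A) (FO F A)"
    by (simp add: iso_def)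
next
  let ?inv = "\<lambda>A. inv_into (carrier (FO F A)) (cpt \<alpha> A)"
  fix f A B y assume f: "f \<in> hom_set S A B" and y: "y \<in> carrier (FO G A)"
  note AB = F.S.hom_set_objs[OF f]
  have inj: "inj_on (cpt \<alpha> B) (carrier (FO F B))" and surj: "cpt \<alpha> A ` carrier (FO F A) = carrier (FO G A)"
    using bij AB by (auto simp: bij_betw_def)
  have x: "?inv A y \<in> carrier (FO F A)" "cpt \<alpha> A (?inv A y) = y"
    using surj y by (auto intro: inv_into_into f_inv_into_f)
  have "act G f y = cpt \<alpha> B (act F f (?inv A y))"
    using natural[OF f x(1)] x(2) by simp
  then show "?inv B (act G f y) = act F f (?inv A y)"
    using inv_into_f_f[OF inj F.act_closed[OF f x(1)]] by simp
qed

locale finitely_accessible_category = preadditive_category C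
  for C :: "('o, 'u) precat" +
  assumes universe: "universe TYPE('u)" and locally_small: "locally_small C"
    and finitely_accessible: "finitely_accessible C"
begin

lemma fp_Obj: "A \<in> fp_objects C \<Longrightarrow> A \<in> Obj C"
  by (simp add: fp_objects_def)

lemma fp_presentation:
  assumes "X \<in> Obj C"
  obtains I :: "'u set" and r Y \<phi> c where "small TYPE('u) I" "is_direct_limit C I r Y \<phi> X c"
    "\<forall>i\<in>I. Y i \<in> fp_objects C"
proof -
  obtain G where G: "G \<subseteq> fp_objects C" and presentations: "\<forall>X\<in>Obj C. \<exists>(I :: 'u set) r Y \<phi> c. small TYPE('u) I \<and>
            is_direct_limit C I r Y \<phi> X c \<and> (\<forall>i\<in>I. Y i \<in> G)"
    using finitely_accessible by (auto simp: finitely_accessible_def)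
  from bspec[OF presentations assms]
  obtain I :: "'u set" and r Y \<phi> c where I: "small TYPE('u) I" "is_direct_limit C I r Y \<phi> X c"
    and Y: "\<forall>i\<in>I. Y i \<in> G"
    by (elim exE conjE)
  have "\<forall>i\<in>I. Y i \<in> fp_objects C"
    using G Y by blast
  with I show thesis
    by (rule that)
qed

abbreviation rep :: "'o \<Rightarrow> ('o, 'u) abfunc" where
  "rep A \<equiv> hom_functor C A"

text \<open>The extension of the representable functor on finitely presented objects; it is only known up to
  isomorphism.\<close>

abbreviation ext :: "'o \<Rightarrow> ('o, 'u) abfunc" where
  "ext A \<equiv> extend C (hom_functor (fp_cat C) A)"

lemma rep_Ab_functor: "A \<in> fp_objects C \<Longrightarrow> Ab_functor C (rep A)"
  using hom_functor_Ab_functor[OF locally_small] fp_Obj by blast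

text \<open>The representable functor on all of \<open>C\<close> is an extension: it commutes with direct limits as \<open>A\<close> is finitely
  presented.  So the chosen extension is one too.\<close>

lemma is_extension_ext:
  assumes A: "A \<in> fp_objects C"
  shows "is_extension C (hom_functor (fp_cat C) A) (ext A)"
proof -
  have "is_extension C (hom_functor (fp_cat C) A) (rep A)"
    unfolding is_extension_def
  proof (intro conjI ballI)
    show "additive_functor C Ab (rep A)"
      using rep_Ab_functor[OF A] by (simp add: Ab_functor_iff)
    show "preserves_direct_limits C Ab (rep A)"
      using A by (simp add: fp_objects_def)
    show "FO (rep A) B = FO (hom_functor (fp_cat C) A) B" if "B \<in> Obj (fp_cat C)" for B
      using A that by (simp add: hom_group_def hom_set_full_sub)
    show "FA (rep A) f = FA (hom_functor (fp_cat C) A) f" if "f \<in> Arr (fp_cat C)" for f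
      using A that by (simp add: hom_functor_def hom_group_def hom_set_full_sub)
  qed
  then show ?thesis
    unfolding extend_def by (rule someI)
qed

lemma ext_Ab_functor: "A \<in> fp_objects C \<Longrightarrow> Ab_functor C (ext A)"
  using is_extension_ext by (simp add: is_extension_def Ab_functor_iff)

lemma FO_ext: "\<lbrakk>A \<in> fp_objects C; X \<in> fp_objects C\<rbrakk> \<Longrightarrow> FO (ext A) X = hom_group C A X"
  using is_extension_ext[of A] fp_Obj by (simp add: is_extension_def hom_group_def hom_set_full_sub)

lemma act_ext:
  assumes "A \<in> fp_objects C" "X \<in> fp_objects C" "Y \<in> fp_objects C" "f \<in> hom_set C X Y" "h \<in> hom_set C A X"
  shows "act (ext A) f h = f \<cdot>\<^bsub>C\<^esub> h"
proof -
  have "f \<in> Arr (fp_cat C)"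
    using assms by (auto simp: hom_set_def)
  then have "FA (ext A) f = FA (hom_functor (fp_cat C) A) f"
    using is_extension_ext[OF assms(1)] by (simp add: is_extension_def)
  then show ?thesis
    using assms act_hom_functor[of f "fp_cat C" X Y h A] by (simp add: hom_set_full_sub)
qed

lemma
  fixes I :: "'u set"
  assumes A: "A \<in> fp_objects C" and I: "small TYPE('u) I" and limit: "is_direct_limit C I r Y \<phi> X c"
  shows rep_limit_surj: "h \<in> hom_set C A X \<Longrightarrow> \<exists>i\<in>I. \<exists>y\<in>hom_set C A (Y i). c i \<cdot>\<^bsub>C\<^esub> y = h"
    and ext_limit_surj: "e \<in> carrier (FO (ext A) X) \<Longrightarrow>
      \<exists>i\<in>I. \<exists>y\<in>carrier (FO (ext A) (Y i)). act (ext A) (c i) y = e"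
    and ext_limit_kernel: "\<lbrakk>i \<in> I; y \<in> carrier (FO (ext A) (Y i)); act (ext A) (c i) y = \<one>\<^bsub>FO (ext A) X\<^esub>\<rbrakk>
      \<Longrightarrow> \<exists>j. (i, j) \<in> r \<and> act (ext A) (\<phi> i j) y = \<one>\<^bsub>FO (ext A) (Y j)\<^esub>"
proof -
  have c: "\<And>i. i \<in> I \<Longrightarrow> c i \<in> hom_set C (Y i) X"
    using is_direct_limitD(4)[OF limit] .
  have "is_direct_limit Ab I r (\<lambda>i. FO (rep A) (Y i)) (\<lambda>i j. FA (rep A) (\<phi> i j)) (FO (rep A) X) (\<lambda>i. FA (rep A) (c i))"
    using A I limit by (simp add: fp_objects_def preserves_direct_limits_def)
  from Ab_direct_limit_surj[OF this, of h] show "\<exists>i\<in>I. \<exists>y\<in>hom_set C A (Y i). c i \<cdot>\<^bsub>C\<^esub> y = h"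
    if "h \<in> hom_set C A X"
    using that act_hom_functor[OF c] by simp
  have ext_limit: "is_direct_limit Ab I r (\<lambda>i. FO (ext A) (Y i)) (\<lambda>i j. FA (ext A) (\<phi> i j)) (FO (ext A) X)
      (\<lambda>i. FA (ext A) (c i))"
    using is_extension_ext[OF A] I limit by (simp add: is_extension_def preserves_direct_limits_def)
  show "e \<in> carrier (FO (ext A) X) \<Longrightarrow>
      \<exists>i\<in>I. \<exists>y\<in>carrier (FO (ext A) (Y i)). act (ext A) (c i) y = e"
    by (rule Ab_direct_limit_surj[OF ext_limit])
  show "\<lbrakk>i \<in> I; y \<in> carrier (FO (ext A) (Y i)); act (ext A) (c i) y = \<one>\<^bsub>FO (ext A) X\<^esub>\<rbrakk>
      \<Longrightarrow> \<exists>j. (i, j) \<in> r \<and> act (ext A) (\<phi> i j) y = \<one>\<^bsub>FO (ext A) (Y j)\<^esub>"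
    by (rule Ab_direct_limit_kernel[OF universe I ext_limit])
qed

text \<open>The comparison of Yoneda: the natural map out of a representable functor that sends the identity to
  itself.\<close>

definition comparison :: "'o \<Rightarrow> 'u \<Rightarrow> 'u" where
  "comparison A h = act (ext A) h (Ident C A)"

lemma Ident_ext: "A \<in> fp_objects C \<Longrightarrow> Ident C A \<in> carrier (FO (ext A) A)"
  by (simp add: FO_ext ident_hom fp_Obj)

lemma comparison_closed: "\<lbrakk>A \<in> fp_objects C; h \<in> hom_set C A X\<rbrakk> \<Longrightarrow> comparison A h \<in> carrier (FO (ext A) X)"
  unfolding comparison_def by (rule Ab_functor.act_closed[OF ext_Ab_functor _ Ident_ext])

lemma comparison_fp: "\<lbrakk>A \<in> fp_objects C; X \<in> fp_objects C; h \<in> hom_set C A X\<rbrakk> \<Longrightarrow> comparison A h = h"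
  by (simp add: comparison_def act_ext[of A A X] ident_hom fp_Obj comp_ident_right)

lemma comparison_comp:
  assumes "A \<in> fp_objects C" "h \<in> hom_set C A X" "g \<in> hom_set C X Y"
  shows "comparison A (g \<cdot>\<^bsub>C\<^esub> h) = act (ext A) g (comparison A h)"
  unfolding comparison_def
  by (rule Ab_functor.act_comp[OF ext_Ab_functor[OF assms(1)] assms(2,3) Ident_ext[OF assms(1)]])

lemma comparison_nat:
  assumes A: "A \<in> fp_objects C"
  shows "make_nat C (rep A) (ext A) (\<lambda>X. comparison A) \<in> hom_set (functor_cat C Ab) (rep A) (ext A)"
proof (rule make_nat_hom[OF rep_Ab_functor[OF A] ext_Ab_functor[OF A]])
  interpret E: Ab_functor C "ext A" by (rule ext_Ab_functor[OF A])
  fix X assume "X \<in> Obj C"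
  show "comparison A \<in> hom (FO (rep A) X) (FO (ext A) X)"
    by (rule homI) (simp_all add: comparison_closed[OF A], simp add: comparison_def E.act_plus[OF _ _ Ident_ext[OF A]])
next
  fix f X Y h assume "f \<in> hom_set C X Y" "h \<in> carrier (FO (rep A) X)"
  then show "comparison A (act (rep A) f h) = act (ext A) f (comparison A h)"
    using comparison_comp[OF A, of h X f Y] act_hom_functor[of f C X Y h A] by simp
qed

text \<open>Both functors commute with the presentation of \<open>X\<close> as a direct limit of finitely presented objects, at
  which the comparison is the identity; this makes it bijective at \<open>X\<close>.\<close>

lemma comparison_surj:
  assumes A: "A \<in> fp_objects C" and X: "X \<in> Obj C" and e: "e \<in> carrier (FO (ext A) X)"
  obtains h where "h \<in> hom_set C A X" "comparison A h = e"
proof -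
  obtain I :: "'u set" and r Y \<phi> c where I: "small TYPE('u) I" and limit: "is_direct_limit C I r Y \<phi> X c"
    and Y: "\<forall>i\<in>I. Y i \<in> fp_objects C"
    by (rule fp_presentation[OF X])
  obtain i y where i: "i \<in> I" and y: "y \<in> carrier (FO (ext A) (Y i))" "act (ext A) (c i) y = e"
    using ext_limit_surj[OF A I limit e] by blast
  have y': "y \<in> hom_set C A (Y i)"
    using y(1) by (simp add: FO_ext[OF A bspec[OF Y i]])
  have c: "c i \<in> hom_set C (Y i) X"
    using is_direct_limitD(4)[OF limit i] .
  have "comparison A (c i \<cdot>\<^bsub>C\<^esub> y) = e"
    using comparison_comp[OF A y' c] comparison_fp[OF A bspec[OF Y i] y'] y(2) by simp
  with comp_hom[OF y' c] show thesis by (rule that)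
qed

lemma comparison_inj:
  assumes A: "A \<in> fp_objects C" and X: "X \<in> Obj C"
  shows "inj_on (comparison A) (hom_set C A X)"
proof -
  interpret \<theta>: Ab_nat C "rep A" "ext A" "make_nat C (rep A) (ext A) (\<lambda>X. comparison A)"
    by unfold_locales (rule comparison_nat[OF A])
  interpret X: group_hom "hom_group C A X" "FO (ext A) X" "comparison A"
  proof -
    have "group_hom (FO (rep A) X) (FO (ext A) X) (cpt (make_nat C (rep A) (ext A) (\<lambda>X. comparison A)) X)"
      by (rule \<theta>.at_group_hom[OF X])
    then show "group_hom (hom_group C A X) (FO (ext A) X) (comparison A)"
      using cpt_make_nat[OF X, of _ "rep A" "ext A" "\<lambda>X. comparison A"]
      by (simp add: group_hom_def group_hom_axioms_def hom_def Pi_iff \<theta>.F.value_comm_group group.is_monoid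
          monoid.m_closed comm_groupE(1)[OF hom_comm_group[OF fp_Obj[OF A] X], simplified])
  qed
  have "h = \<one>\<^bsub>hom_group C A X\<^esub>"
    if h: "h \<in> hom_set C A X" and zero: "comparison A h = \<one>\<^bsub>FO (ext A) X\<^esub>" for h
  proof -
    obtain I :: "'u set" and r Y \<phi> c where I: "small TYPE('u) I" and limit: "is_direct_limit C I r Y \<phi> X c"
      and Y: "\<forall>i\<in>I. Y i \<in> fp_objects C"
      by (rule fp_presentation[OF X])
    note system = directed_systemD[OF is_direct_limitD(1)[OF limit]]
    note c = is_direct_limitD(4)[OF limit]
    obtain i y where i: "i \<in> I" and y: "y \<in> hom_set C A (Y i)" "c i \<cdot>\<^bsub>C\<^esub> y = h"
      using rep_limit_surj[OF A I limit h] by blast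
    have "act (ext A) (c i) y = \<one>\<^bsub>FO (ext A) X\<^esub>"
      using comparison_comp[OF A y(1) c[OF i]] comparison_fp[OF A bspec[OF Y i] y(1)] y(2) zero by simp
    then obtain j where j: "(i, j) \<in> r" "act (ext A) (\<phi> i j) y = \<one>\<^bsub>FO (ext A) (Y j)\<^esub>"
      using ext_limit_kernel[OF A I limit i, of y] y(1) by (auto simp: FO_ext[OF A bspec[OF Y i]])
    note jI = conjunct2[OF system(4)[OF j(1)]]
    have "\<phi> i j \<cdot>\<^bsub>C\<^esub> y = Zro C A (Y j)"
      using j(2) act_ext[OF A bspec[OF Y i] bspec[OF Y jI] system(7)[OF j(1)] y(1)] by (simp add: FO_ext[OF A bspec[OF Y jI]])
    then have "h = c j \<cdot>\<^bsub>C\<^esub> Zro C A (Y j)"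
      using y(2) is_direct_limitD(5)[OF limit j(1)] comp_assoc[OF y(1) system(7)[OF j(1)] c[OF jI]] by simp
    also have "\<dots> = Zro C A X"
    proof -
      have "Zro C A (Y j) \<in> hom_set C A (Y j)"
        using comm_groupE(2)[OF hom_comm_group[OF fp_Obj[OF A] fp_Obj[OF bspec[OF Y jI]]]] by simp
      then show ?thesis
        using Ab_functor.act_one[OF rep_Ab_functor[OF A] c[OF jI]] act_hom_functor[OF c[OF jI]] by simp
    qed
    finally show ?thesis by simp
  qed
  then show ?thesis
    using X.inj_on_one_iff by simp
qed

lemma comparison_bij: "\<lbrakk>A \<in> fp_objects C; X \<in> Obj C\<rbrakk>
    \<Longrightarrow> bij_betw (comparison A) (hom_set C A X) (carrier (FO (ext A) X))"
  unfolding bij_betw_def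
  by (intro conjI comparison_inj equalityI image_subsetI subsetI comparison_closed)
     (auto elim: comparison_surj)

text \<open>Every element of an extension comes from a finitely presented object, because the extension commutes
  with direct limits.\<close>

lemma ext_nat_eqI:
  assumes A: "A \<in> fp_objects C" and \<eta>: "\<eta> \<in> hom_set (functor_cat C Ab) (ext A) G"
    and \<eta>': "\<eta>' \<in> hom_set (functor_cat C Ab) (ext A) G"
    and eq: "\<And>X. X \<in> fp_objects C \<Longrightarrow> NMap \<eta> X = NMap \<eta>' X"
  shows "\<eta> = \<eta>'"
proof (rule nat_trans_eqI[OF \<eta> \<eta>'])
  fix X e assume X: "X \<in> Obj C" and e: "e \<in> carrier (FO (ext A) X)"
  obtain I :: "'u set" and r Y \<phi> c where I: "small TYPE('u) I" and limit: "is_direct_limit C I r Y \<phi> X c"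
    and Y: "\<forall>i\<in>I. Y i \<in> fp_objects C"
    by (rule fp_presentation[OF X])
  obtain i y where i: "i \<in> I" and y: "y \<in> carrier (FO (ext A) (Y i))" "act (ext A) (c i) y = e"
    using ext_limit_surj[OF A I limit e] by blast
  note c = is_direct_limitD(4)[OF limit i]
  show "cpt \<eta> X e = cpt \<eta>' X e"
    using cpt_natural[OF \<eta> c y(1)] cpt_natural[OF \<eta>' c y(1)] y(2) eq[OF bspec[OF Y i]] by simp
qed

text \<open>Conjugating precomposition with \<open>f\<close> by the comparison maps gives a transformation between the
  extensions that has the prescribed components at finitely presented objects, so it is the extension.\<close>

lemma extend_nat_yoneda:
  assumes A: "A \<in> fp_objects C" and B: "B \<in> fp_objects C" and f: "f \<in> hom_set C A B"
    and X: "X \<in> Obj C" and h: "h \<in> hom_set C B X"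
  shows "cpt (extend_nat C (FA (yoneda (fp_cat C)) f)) X (comparison B h) = comparison A (h \<cdot>\<^bsub>C\<^esub> f)"
proof -
  let ?\<alpha> = "FA (yoneda (fp_cat C)) f"
  have src: "NSrc ?\<alpha> = hom_functor (fp_cat C) B" and tgt: "NTgt ?\<alpha> = hom_functor (fp_cat C) A"
    using hom_setD[OF f] by (simp_all add: yoneda_def)
  have \<alpha>_at: "NMap ?\<alpha> Y = GMap (hom_group C B Y) (hom_group C A Y) (\<lambda>h\<in>hom_set C B Y. h \<cdot>\<^bsub>C\<^esub> f)"
    if "Y \<in> fp_objects C" for Y
    using hom_setD[OF f] that A B fp_Obj[OF that] by (simp add: yoneda_def hom_group_def hom_set_full_sub)
  define pre where "pre = make_nat C (rep B) (rep A) (\<lambda>Y h. h \<cdot>\<^bsub>C\<^esub> f)"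
  have pre: "pre \<in> hom_set (functor_cat C Ab) (rep B) (rep A)"
    unfolding pre_def
  proof (rule make_nat_hom[OF rep_Ab_functor[OF B] rep_Ab_functor[OF A]])
    fix Y show "(\<lambda>h. h \<cdot>\<^bsub>C\<^esub> f) \<in> hom (FO (rep B) Y) (FO (rep A) Y)"
      by (rule homI) (simp_all add: comp_hom[OF f] comp_plus_left[OF f])
  next
    fix g Y Z k assume g: "g \<in> hom_set C Y Z" and k: "k \<in> carrier (FO (rep B) Y)"
    then show "act (rep B) g k \<cdot>\<^bsub>C\<^esub> f = act (rep A) g (k \<cdot>\<^bsub>C\<^esub> f)"
      using comp_assoc[OF f _ g, of k] comp_hom[OF f, of k Y]
      by (simp add: act_hom_functor[OF g])
  qed
  let ?\<theta> = "\<lambda>A. make_nat C (rep A) (ext A) (\<lambda>X. comparison A)"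
  have \<theta>: "cpt (?\<theta> D) Y k = comparison D k" if "Y \<in> Obj C" "k \<in> hom_set C D Y" for D Y k
    using cpt_make_nat[OF that(1), of k "rep D"] that(2) by simp
  interpret B: Ab_nat C "rep B" "ext B" "?\<theta> B"
    by unfold_locales (rule comparison_nat[OF B])
  have bij: "bij_betw (cpt (?\<theta> B) Y) (carrier (FO (rep B) Y)) (carrier (FO (ext B) Y))" if "Y \<in> Obj C" for Y
    using comparison_bij[OF B that] \<theta>[OF that]
      bij_betw_cong[of "hom_set C B Y" "cpt (?\<theta> B) Y" "comparison B"] by simp
  define inverse where
    "inverse = make_nat C (ext B) (rep B) (\<lambda>A. inv_into (carrier (FO (rep B) A)) (cpt (?\<theta> B) A))"
  have inverse: "inverse \<in> hom_set (functor_cat C Ab) (ext B) (rep B)"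
    unfolding inverse_def by (rule B.pointwise_inverse[OF bij])
  have inverse_at: "cpt inverse Y (comparison B k) = k" if Y: "Y \<in> Obj C" and k: "k \<in> hom_set C B Y" for Y k
    using cpt_make_nat[OF Y comparison_closed[OF B k], of "rep B"] \<theta>[OF Y k]
      inv_into_f_f[OF bij_betw_imp_inj_on[OF bij[OF Y]], of k] k by (simp add: inverse_def)
  define \<eta> where "\<eta> = ?\<theta> A \<cdot>\<^bsub>functor_cat C Ab\<^esub> (pre \<cdot>\<^bsub>functor_cat C Ab\<^esub> inverse)"
  note pre_inverse = nat_trans_comp[OF inverse pre]
  have \<eta>: "\<eta> \<in> hom_set (functor_cat C Ab) (ext B) (ext A)"
    unfolding \<eta>_def by (rule nat_trans_comp[OF pre_inverse comparison_nat[OF A]])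
  have \<eta>_at: "cpt \<eta> Y (comparison B k) = comparison A (k \<cdot>\<^bsub>C\<^esub> f)"
    if Y: "Y \<in> Obj C" and k: "k \<in> hom_set C B Y" for Y k
  proof -
    note e = comparison_closed[OF B k]
    show ?thesis
      using cpt_comp[OF pre_inverse Y e] cpt_comp[OF inverse Y e] inverse_at[OF Y k]
        cpt_make_nat[OF Y, of k "rep B" "rep A" "\<lambda>Y h. h \<cdot>\<^bsub>C\<^esub> f"] k \<theta>[OF Y comp_hom[OF f k]]
      by (simp add: \<eta>_def pre_def)
  qed
  have \<eta>_fp: "NMap \<eta> Y = NMap ?\<alpha> Y" if Y: "Y \<in> fp_objects C" for Y
  proof (rule Ab_arr_eqI)
    show "NMap \<eta> Y \<in> hom_set Ab (hom_group C B Y) (hom_group C A Y)"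
      using NMap_hom[OF \<eta> fp_Obj[OF Y]] by (simp add: FO_ext A B Y)
    have "(\<lambda>h. h \<cdot>\<^bsub>C\<^esub> f) \<in> hom (hom_group C B Y) (hom_group C A Y)"
      by (rule homI) (simp_all add: comp_hom[OF f] comp_plus_left[OF f])
    from GMap_hom_Ab[OF _ _ this] show "NMap ?\<alpha> Y \<in> hom_set Ab (hom_group C B Y) (hom_group C A Y)"
      using \<alpha>_at[OF Y] additive_functor.FO_obj[of C Ab "rep A" Y] additive_functor.FO_obj[of C Ab "rep B" Y]
        rep_Ab_functor[OF A] rep_Ab_functor[OF B] fp_Obj[OF Y] by (simp add: Ab_functor_iff)
    fix k assume "k \<in> carrier (hom_group C B Y)"
    then show "cpt \<eta> Y k = cpt ?\<alpha> Y k"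
      using \<eta>_at[OF fp_Obj[OF Y], of k] comparison_fp[OF B Y, of k] comparison_fp[OF A Y comp_hom[OF f], of k]
        \<alpha>_at[OF Y] by simp
  qed
  have "extend_nat C ?\<alpha> = \<eta>"
    unfolding extend_nat_def src tgt
  proof (rule the_equality, intro conjI \<eta> ballI)
    show "NMap \<eta> Y = NMap ?\<alpha> Y" if "Y \<in> Obj (fp_cat C)" for Y
      using \<eta>_fp that by simp
  next
    fix \<eta>' assume \<eta>': "\<eta>' \<in> hom_set (functor_cat C Ab) (ext B) (ext A) \<and>
        (\<forall>Y\<in>Obj (fp_cat C). NMap \<eta>' Y = NMap ?\<alpha> Y)"
    show "\<eta>' = \<eta>"
      by (rule ext_nat_eqI[OF B _ \<eta>]) (use \<eta>' \<eta>_fp fp_Obj in simp_all)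
  qed
  then show ?thesis
    using \<eta>_at[OF X h] by simp
qed

end

section \<open>Composites of monoidal functors\<close>

lemma (in additive_functor) FA_is_iso:
  assumes f: "f \<in> hom_set C A B" and iso: "is_iso C f"
  shows "is_iso D (FA F f)"
proof -
  obtain g where g: "g \<in> hom_set C B A" "g \<cdot>\<^bsub>C\<^esub> f = Ident C A" "f \<cdot>\<^bsub>C\<^esub> g = Ident C B"
    using iso hom_setD[OF f] by (auto simp: is_iso_def)
  note AB = S.hom_set_objs[OF f]
  have "FA F g \<cdot>\<^bsub>D\<^esub> FA F f = Ident D (FO F A)" "FA F f \<cdot>\<^bsub>D\<^esub> FA F g = Ident D (FO F B)"
    using FA_comp[OF f g(1)] FA_comp[OF g(1) f] g(2,3) FA_ident AB by simp_all
  then show ?thesis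
    using FA_hom[OF f] FA_hom[OF g(1)] by (auto simp: is_iso_def hom_set_def)
qed

lemma (in preadditive_category) comp_is_iso:
  assumes f: "f \<in> hom_set C A B" "is_iso C f" and g: "g \<in> hom_set C B D" "is_iso C g"
  shows "is_iso C (g \<cdot> f)"
proof -
  obtain f' where f': "f' \<in> hom_set C B A" "f' \<cdot> f = Ident C A" "f \<cdot> f' = Ident C B"
    using f hom_setD[OF f(1)] by (auto simp: is_iso_def)
  obtain g' where g': "g' \<in> hom_set C D B" "g' \<cdot> g = Ident C B" "g \<cdot> g' = Ident C D"
    using g hom_setD[OF g(1)] by (auto simp: is_iso_def)
  note gf = comp_hom[OF f(1) g(1)] and f'g' = comp_hom[OF g'(1) f'(1)]
  have "(f' \<cdot> g') \<cdot> (g \<cdot> f) = f' \<cdot> ((g' \<cdot> g) \<cdot> f)"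
    using comp_assoc[OF gf g'(1) f'(1)] comp_assoc[OF f(1) g(1) g'(1)] by simp
  then have 1: "(f' \<cdot> g') \<cdot> (g \<cdot> f) = Ident C A"
    using g'(2) f'(2) comp_ident_left[OF f(1)] by simp
  have "(g \<cdot> f) \<cdot> (f' \<cdot> g') = g \<cdot> ((f \<cdot> f') \<cdot> g')"
    using comp_assoc[OF f'g' f(1) g(1)] comp_assoc[OF g'(1) f'(1) f(1)] by simp
  then have 2: "(g \<cdot> f) \<cdot> (f' \<cdot> g') = Ident C D"
    using f'(3) g'(3) comp_ident_left[OF g'(1)] by simp
  show ?thesis
    using gf f'g' 1 2 by (auto simp: is_iso_def hom_set_def)
qed

definition comp_func ::
    "('p, 'b, 'q, 'c) func \<Rightarrow> ('o, 'a, 'p, 'b) func \<Rightarrow> ('o, 'a, 'q, 'c) func" where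
  "comp_func G F = \<lparr>FO = (\<lambda>A. FO G (FO F A)), FA = (\<lambda>f. FA G (FA F f))\<rparr>"

lemma comp_func_simps [simp]:
  "FO (comp_func G F) A = FO G (FO F A)" "FA (comp_func G F) f = FA G (FA F f)"
  by (simp_all add: comp_func_def)

lemma additive_functor_comp:
  assumes "additive_functor C D F" "additive_functor D E G"
  shows "additive_functor C E (comp_func G F)"
proof -
  interpret F: additive_functor C D F by fact
  interpret G: additive_functor D E G by fact
  show ?thesis
    by unfold_locales
       (simp_all add: F.FO_obj G.FO_obj F.FA_hom G.FA_hom F.FA_ident G.FA_ident F.FA_comp F.FA_plus
          G.FA_comp[OF F.FA_hom F.FA_hom] G.FA_plus[OF F.FA_hom F.FA_hom])
qed

text \<open>A strong monoidal functor without its coherence conditions.  A \<open>monoidal_functor\<close> may have any source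
  with a tensor operation, so closure under that operation becomes a hypothesis when such functors are composed.\<close>

locale tensor_functor = additive_functor C D F
  for C :: "('o, 'a) precat" and M :: "('o, 'a) tensor"
    and D :: "('p, 'b) precat" and N :: "('p, 'b) tensor"
    and F :: "('o, 'a, 'p, 'b) func" and \<chi> :: "'o \<Rightarrow> 'o \<Rightarrow> 'b" +
  assumes mult_hom: "\<lbrakk>A \<in> Obj C; B \<in> Obj C\<rbrakk>
          \<Longrightarrow> \<chi> A B \<in> hom_set D (FO F A \<odot>\<^bsub>N\<^esub> FO F B) (FO F (A \<odot>\<^bsub>M\<^esub> B))"
    and mult_is_iso: "\<lbrakk>A \<in> Obj C; B \<in> Obj C\<rbrakk> \<Longrightarrow> is_iso D (\<chi> A B)"
    and mult_nat: "\<lbrakk>f \<in> hom_set C A A'; g \<in> hom_set C B B'\<rbrakk>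
          \<Longrightarrow> \<chi> A' B' \<cdot>\<^bsub>D\<^esub> (FA F f \<boxtimes>\<^bsub>N\<^esub> FA F g) = FA F (f \<boxtimes>\<^bsub>M\<^esub> g) \<cdot>\<^bsub>D\<^esub> \<chi> A B"

lemma (in monoidal_functor) tensor_functor: "tensor_functor C M D N F \<phi>"
  using mult_iso mult_natural by unfold_locales blast+

lemma tensor_functor_comp:
  assumes "tensor_functor C M D N F \<phi>" and "tensor_functor D N E T G \<psi>"
    and C_hom: "\<And>f g A A' B B'. \<lbrakk>f \<in> hom_set C A A'; g \<in> hom_set C B B'\<rbrakk>
        \<Longrightarrow> f \<boxtimes>\<^bsub>M\<^esub> g \<in> hom_set C (A \<odot>\<^bsub>M\<^esub> B) (A' \<odot>\<^bsub>M\<^esub> B')"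
    and D_hom: "\<And>f g A A' B B'. \<lbrakk>f \<in> hom_set D A A'; g \<in> hom_set D B B'\<rbrakk>
        \<Longrightarrow> f \<boxtimes>\<^bsub>N\<^esub> g \<in> hom_set D (A \<odot>\<^bsub>N\<^esub> B) (A' \<odot>\<^bsub>N\<^esub> B')"
    and E_hom: "\<And>f g A A' B B'. \<lbrakk>f \<in> hom_set E A A'; g \<in> hom_set E B B'\<rbrakk>
        \<Longrightarrow> f \<boxtimes>\<^bsub>T\<^esub> g \<in> hom_set E (A \<odot>\<^bsub>T\<^esub> B) (A' \<odot>\<^bsub>T\<^esub> B')"
  shows "tensor_functor C M E T (comp_func G F) (\<lambda>A B. FA G (\<phi> A B) \<cdot>\<^bsub>E\<^esub> \<psi> (FO F A) (FO F B))"
proof -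
  interpret F: tensor_functor C M D N F \<phi> by fact
  interpret G: tensor_functor D N E T G \<psi> by fact
  show ?thesis
  proof (rule tensor_functor.intro[OF additive_functor_comp[OF F.additive_functor_axioms
            G.additive_functor_axioms] tensor_functor_axioms.intro], unfold comp_func_simps)
    fix A B assume AB: "A \<in> Obj C" "B \<in> Obj C"
    note FAB = F.FO_obj[OF AB(1)] F.FO_obj[OF AB(2)]
    note \<phi>AB = F.mult_hom[OF AB] F.mult_is_iso[OF AB] and \<psi>AB = G.mult_hom[OF FAB] G.mult_is_iso[OF FAB]
    show "FA G (\<phi> A B) \<cdot>\<^bsub>E\<^esub> \<psi> (FO F A) (FO F B) \<in>
        hom_set E (FO G (FO F A) \<odot>\<^bsub>T\<^esub> FO G (FO F B)) (FO G (FO F (A \<odot>\<^bsub>M\<^esub> B)))"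
      by (rule G.T.comp_hom[OF \<psi>AB(1) G.FA_hom[OF \<phi>AB(1)]])
    show "is_iso E (FA G (\<phi> A B) \<cdot>\<^bsub>E\<^esub> \<psi> (FO F A) (FO F B))"
      by (rule G.T.comp_is_iso[OF \<psi>AB G.FA_hom[OF \<phi>AB(1)] G.FA_is_iso[OF \<phi>AB]])
  next
    fix A A' B B' f g assume f: "f \<in> hom_set C A A'" and g: "g \<in> hom_set C B B'"
    note A = F.S.hom_set_objs[OF f] and B = F.S.hom_set_objs[OF g]
    note Ff = F.FA_hom[OF f] and Fg = F.FA_hom[OF g]
    note \<psi>1 = G.mult_hom[OF F.FO_obj[OF A(1)] F.FO_obj[OF B(1)]]
    note \<psi>2 = G.mult_hom[OF F.FO_obj[OF A(2)] F.FO_obj[OF B(2)]]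
    note \<phi>1 = F.mult_hom[OF A(1) B(1)] and \<phi>2 = F.mult_hom[OF A(2) B(2)]
    have "(FA G (\<phi> A' B') \<cdot>\<^bsub>E\<^esub> \<psi> (FO F A') (FO F B')) \<cdot>\<^bsub>E\<^esub> (FA G (FA F f) \<boxtimes>\<^bsub>T\<^esub> FA G (FA F g)) =
        FA G (\<phi> A' B') \<cdot>\<^bsub>E\<^esub> (FA G (FA F f \<boxtimes>\<^bsub>N\<^esub> FA F g) \<cdot>\<^bsub>E\<^esub> \<psi> (FO F A) (FO F B))"
      using G.T.comp_assoc[OF E_hom[OF G.FA_hom[OF Ff] G.FA_hom[OF Fg]] \<psi>2 G.FA_hom[OF \<phi>2]] G.mult_nat[OF Ff Fg]
      by simp
    also have "\<dots> = FA G (\<phi> A' B' \<cdot>\<^bsub>D\<^esub> (FA F f \<boxtimes>\<^bsub>N\<^esub> FA F g)) \<cdot>\<^bsub>E\<^esub> \<psi> (FO F A) (FO F B)"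
      using G.T.comp_assoc[OF \<psi>1 G.FA_hom[OF D_hom[OF Ff Fg]] G.FA_hom[OF \<phi>2]] G.FA_comp[OF D_hom[OF Ff Fg] \<phi>2]
      by simp
    also have "\<dots> = FA G (FA F (f \<boxtimes>\<^bsub>M\<^esub> g) \<cdot>\<^bsub>D\<^esub> \<phi> A B) \<cdot>\<^bsub>E\<^esub> \<psi> (FO F A) (FO F B)"
      using F.mult_nat[OF f g] by simp
    also have "\<dots> = FA G (FA F (f \<boxtimes>\<^bsub>M\<^esub> g)) \<cdot>\<^bsub>E\<^esub> (FA G (\<phi> A B) \<cdot>\<^bsub>E\<^esub> \<psi> (FO F A) (FO F B))"
      using G.FA_comp[OF \<phi>1 F.FA_hom[OF C_hom[OF f g]]]
        G.T.comp_assoc[OF \<psi>1 G.FA_hom[OF \<phi>1] G.FA_hom[OF F.FA_hom[OF C_hom[OF f g]]]] by simp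
    finally show "(FA G (\<phi> A' B') \<cdot>\<^bsub>E\<^esub> \<psi> (FO F A') (FO F B')) \<cdot>\<^bsub>E\<^esub> (FA G (FA F f) \<boxtimes>\<^bsub>T\<^esub> FA G (FA F g)) =
        FA G (FA F (f \<boxtimes>\<^bsub>M\<^esub> g)) \<cdot>\<^bsub>E\<^esub> (FA G (\<phi> A B) \<cdot>\<^bsub>E\<^esub> \<psi> (FO F A) (FO F B))" .
  qed
qed

lemma op_cat_simps [simp]:
  "Obj (op_cat C) = Obj C" "Ident (op_cat C) = Ident C" "hom_set (op_cat C) A B = hom_set C B A"
  by (auto simp: op_cat_def hom_set_def)

lemma op_tensor_simps [simp]: "TO (op_tensor C M) = TO M" "TA (op_tensor C M) = TA M"
  by (simp_all add: op_tensor_def)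

lemma (in additive_symmetric_monoidal_category) op_tensor_hom:
  assumes "monoidal_subcategory C M S"
    and "f \<in> hom_set (op_cat (full_sub C S)) A A'" "g \<in> hom_set (op_cat (full_sub C S)) B B'"
  shows "f \<boxtimes>\<^bsub>op_tensor (full_sub C S) M\<^esub> g \<in> hom_set (op_cat (full_sub C S))
      (A \<odot>\<^bsub>op_tensor (full_sub C S) M\<^esub> B) (A' \<odot>\<^bsub>op_tensor (full_sub C S) M\<^esub> B')"
  using assms tensor_hom by (simp add: hom_set_full_sub_iff monoidal_subcategory_def)

section \<open>The exactness criterion\<close>

text \<open>\<open>R\<close> is the composite of the Yoneda embedding, the localisation functor and \<open>\<Psi>\<close>.  Its tensor
  isomorphisms come from all three; its values are known because \<open>\<Psi>\<close> after localisation is evaluation.\<close>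

lemma representables_tensor_functor:
  fixes C :: "('o, 'u) precat"
  assumes "additive_symmetric_monoidal_category C M" "monoidal_subcategory C M (fp_objects C)"
    and "is_day_convolution C M N" and "is_induced_structure C D N T"
  obtains R \<chi> where
    "tensor_functor (op_cat (fp_cat C)) (op_tensor (fp_cat C) M) (fun_cat C D) T R \<chi>"
    "\<forall>A\<in>Obj (fp_cat C). FO R A = restrict_func (full_sub C D) (extend C (hom_functor (fp_cat C) A))"
    "\<forall>f\<in>Arr (fp_cat C). FA R f = restrict_nat (full_sub C D) (extend_nat C (FA (yoneda (fp_cat C)) f))"
proof -
  let ?fp = "op_cat (fp_cat C)" and ?y = "yoneda (fp_cat C)" and ?L = "quotient_functor C D"
  obtain \<phi>0 \<epsilon>0 where N: "additive_symmetric_monoidal_category (fp_mod C) N"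
    and yoneda: "monoidal_functor ?fp (op_tensor (fp_cat C) M) (fp_mod C) N ?y \<phi>0 \<epsilon>0"
    using assms(3) by (auto simp: is_day_convolution_def)
  obtain Q \<Psi> \<phi> \<epsilon> \<psi> \<delta> where T: "additive_symmetric_monoidal_category (fun_cat C D) T"
    and Q: "additive_symmetric_monoidal_category (serre_quotient C D) Q"
    and L: "monoidal_functor (fp_mod C) N (serre_quotient C D) Q ?L \<phi> \<epsilon>"
    and \<Psi>_obj: "\<forall>F\<in>Obj (fp_mod C). FO \<Psi> (FO ?L F) = FO (evaluation C D) F"
    and \<Psi>_arr: "\<forall>\<alpha>\<in>Arr (fp_mod C). FA \<Psi> (FA ?L \<alpha>) = FA (evaluation C D) \<alpha>"
    and \<Psi>: "monoidal_functor (serre_quotient C D) Q (fun_cat C D) T \<Psi> \<psi> \<delta>"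
    using assms(4) unfolding is_induced_structure_def by (elim conjE exE)
  note op_hom = additive_symmetric_monoidal_category.op_tensor_hom[OF assms(1,2)]
    and N_hom = additive_symmetric_monoidal_category.tensor_hom[OF N]
    and Q_hom = additive_symmetric_monoidal_category.tensor_hom[OF Q]
    and T_hom = additive_symmetric_monoidal_category.tensor_hom[OF T]
  let ?R = "comp_func \<Psi> (comp_func ?L ?y)"
  have 1: "tensor_functor ?fp (op_tensor (fp_cat C) M) (serre_quotient C D) Q (comp_func ?L ?y)
      (\<lambda>A B. FA ?L (\<phi>0 A B) \<cdot>\<^bsub>serre_quotient C D\<^esub> \<phi> (FO ?y A) (FO ?y B))"
    by (rule tensor_functor_comp[OF monoidal_functor.tensor_functor[OF yoneda]
          monoidal_functor.tensor_functor[OF L] op_hom N_hom Q_hom])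
  have 2: "tensor_functor ?fp (op_tensor (fp_cat C) M) (fun_cat C D) T ?R
      (\<lambda>A B. FA \<Psi> (FA ?L (\<phi>0 A B) \<cdot>\<^bsub>serre_quotient C D\<^esub> \<phi> (FO ?y A) (FO ?y B)) \<cdot>\<^bsub>fun_cat C D\<^esub>
        \<psi> (FO (comp_func ?L ?y) A) (FO (comp_func ?L ?y) B))"
    by (rule tensor_functor_comp[OF 1 monoidal_functor.tensor_functor[OF \<Psi>] op_hom Q_hom T_hom])
  interpret y: monoidal_functor ?fp "op_tensor (fp_cat C) M" "fp_mod C" N ?y \<phi>0 \<epsilon>0 by (rule yoneda)
  show thesis
  proof (rule that[OF 2]; intro ballI)
    fix A assume "A \<in> Obj (fp_cat C)"
    then have "FO ?y A \<in> Obj (fp_mod C)"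
      using y.FO_obj by simp
    then show "FO ?R A = restrict_func (full_sub C D) (extend C (hom_functor (fp_cat C) A))"
      using \<Psi>_obj by (simp add: evaluation_def yoneda_def)
  next
    fix f assume "f \<in> Arr (fp_cat C)"
    then have "f \<in> hom_set (fp_cat C) (Src C f) (Tgt C f)"
      by (simp add: hom_set_def)
    then have "f \<in> hom_set ?fp (Tgt C f) (Src C f)"
      by simp
    then have "FA ?y f \<in> Arr (fp_mod C)"
      using hom_setD(1)[OF y.FA_hom] by blast
    then show "FA ?R f = restrict_nat (full_sub C D) (extend_nat C (FA ?y f))"
      using \<Psi>_arr by (simp add: evaluation_def)
  qed
qed

theorem proposition3p12:
  fixes C :: "('o, 'u) precat"
    and M :: "('o, 'u) tensor"
    and D :: "'o set"
    and N T :: "(('o, 'u) abfunc, ('o, 'u) abnat) tensor"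
  assumes "universe TYPE('u)"
    and "additive_category C" and "locally_small C"
    and "finitely_accessible C" and "has_products C"
    and "additive_symmetric_monoidal_category C M" and "closed_monoidal C M"
    and "monoidal_subcategory C M (fp_objects C)"
    and "definable_subcategory C D" and "fp_hom_closed C M D"
    and "is_day_convolution C M N"
    and "is_induced_structure C D N T"
    and "exact_in_each_variable (fun_cat C D) T"
  shows "exactness_criterion C M D"
proof -
  interpret M: additive_symmetric_monoidal_category C M by fact
  interpret finitely_accessible_category C
    using assms(1,3,4) by unfold_locales
  let ?S = "full_sub C D" and ?fun = "fun_cat C D" and ?fp = "op_cat (fp_cat C)"
  have fun_cat: "?fun = continuous_functor_cat ?S"
    by (simp add: fun_cat_def continuous_functors_def)
  have T: "additive_symmetric_monoidal_category ?fun T"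
    using assms(12) by (simp add: is_induced_structure_def)
  interpret T: additive_symmetric_monoidal_category ?fun T by (rule T)
  obtain R \<chi> where R: "tensor_functor ?fp (op_tensor (fp_cat C) M) ?fun T R \<chi>"
    and R_obj: "\<forall>A\<in>Obj (fp_cat C). FO R A = restrict_func ?S (ext A)"
    and R_arr: "\<forall>f\<in>Arr (fp_cat C). FA R f = restrict_nat ?S (extend_nat C (FA (yoneda (fp_cat C)) f))"
    by (rule representables_tensor_functor[OF assms(6,8,11,12)])
  interpret R: tensor_functor ?fp "op_tensor (fp_cat C) M" ?fun T R \<chi> by (rule R)
  have fp_tensor: "A \<odot>\<^bsub>M\<^esub> B \<in> fp_objects C" if "A \<in> fp_objects C" "B \<in> fp_objects C" for A B
    using assms(8) that by (simp add: monoidal_subcategory_def)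
  show ?thesis
    unfolding exactness_criterion_def
  proof (intro ballI impI; elim conjE)
    fix A B U V f g X h
    assume A: "A \<in> fp_objects C" and B: "B \<in> fp_objects C" and U: "U \<in> fp_objects C" and V: "V \<in> fp_objects C"
      and f: "f \<in> hom_set C A B" and g: "g \<in> hom_set C U V" and XD: "X \<in> D" and h: "h \<in> hom_set C (A \<odot>\<^bsub>M\<^esub> U) X"
      and fh: "divides C (f \<boxtimes>\<^bsub>M\<^esub> Ident C U) h" and gh: "divides C (Ident C A \<boxtimes>\<^bsub>M\<^esub> g) h"
    have X: "X \<in> Obj C" and XS: "X \<in> Obj ?S"
      using M.hom_set_objs(2)[OF h] XD by simp_all
    note id = M.ident_hom[OF fp_Obj[OF A]] M.ident_hom[OF fp_Obj[OF U]]
    have R_value: "FO (FO R P) X = FO (ext P) X" if "P \<in> fp_objects C" for P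
      using R_obj that fp_Obj[OF that] XS by (simp add: restrict_func_def)
    have R_at: "cpt (FA R p) X (comparison P' k) = comparison P (k \<cdot>\<^bsub>C\<^esub> p)"
      if "P \<in> fp_objects C" "P' \<in> fp_objects C" "p \<in> hom_set C P P'" "k \<in> hom_set C P' X" for P P' p k
      using R_arr extend_nat_yoneda[OF that(1-3) X that(4)] that(1,2) hom_setD[OF that(3)] XS
      by (simp add: restrict_nat_def)
    have R_hom: "FA R p \<in> hom_set ?fun (FO R P') (FO R P)"
      if "P \<in> fp_objects C" "P' \<in> fp_objects C" "p \<in> hom_set C P P'" for P P' p
      using R.FA_hom[of p P' P] that by (simp add: hom_set_full_sub)
    have R_ident: "FA R (Ident C P) = Ident ?fun (FO R P)" if "P \<in> fp_objects C" for P
      using R.FA_ident[of P] that fp_Obj[OF that] by simp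
    have \<chi>: "\<chi> P P' \<in> hom_set ?fun (FO R P \<odot>\<^bsub>T\<^esub> FO R P') (FO R (P \<odot>\<^bsub>M\<^esub> P'))" "is_iso ?fun (\<chi> P P')"
      if "P \<in> fp_objects C" "P' \<in> fp_objects C" for P P'
      using R.mult_hom R.mult_is_iso that fp_Obj by simp_all
    have \<chi>_natural: "\<chi> A U \<cdot>\<^bsub>?fun\<^esub> (FA R p \<boxtimes>\<^bsub>T\<^esub> FA R p') = FA R (p \<boxtimes>\<^bsub>M\<^esub> p') \<cdot>\<^bsub>?fun\<^esub> \<chi> P P'"
      if "P \<in> fp_objects C" "P' \<in> fp_objects C" "p \<in> hom_set C A P" "p' \<in> hom_set C U P'" for P P' p p'
      using R.mult_nat[of p P A p' P' U] that A U by (simp add: hom_set_full_sub)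
    have fun_hom: "\<alpha> \<in> hom_set (functor_cat ?S Ab) F G" if "\<alpha> \<in> hom_set ?fun F G" for \<alpha> F G
      using that by (simp add: fun_cat hom_set_full_sub_iff)
    have fun_comp: "cpt (\<beta> \<cdot>\<^bsub>?fun\<^esub> \<alpha>) X x = cpt \<beta> X (cpt \<alpha> X x)"
      if "\<alpha> \<in> hom_set ?fun F G" "x \<in> carrier (FO F X)" for \<alpha> \<beta> F G x
      using cpt_comp[OF fun_hom[OF that(1)] XS that(2)] by (simp add: fun_cat)
    have fun_ident: "cpt (Ident ?fun F) X x = x" if "x \<in> carrier (FO F X)" for F x
      using cpt_ident[OF XS that] by (simp add: fun_cat)
    have fun_closed: "cpt \<alpha> X x \<in> carrier (FO G X)" if "\<alpha> \<in> hom_set ?fun F G" "x \<in> carrier (FO F X)" for \<alpha> F G x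
      by (rule cpt_closed[OF fun_hom[OF that(1)] XS that(2)])
    obtain \<nu> where \<nu>: "\<nu> \<in> hom_set ?fun (FO R (A \<odot>\<^bsub>M\<^esub> U)) (FO R A \<odot>\<^bsub>T\<^esub> FO R U)"
      and \<nu>\<chi>: "\<nu> \<cdot>\<^bsub>?fun\<^esub> \<chi> A U = Ident ?fun (FO R A \<odot>\<^bsub>T\<^esub> FO R U)"
      and \<chi>\<nu>: "\<chi> A U \<cdot>\<^bsub>?fun\<^esub> \<nu> = Ident ?fun (FO R (A \<odot>\<^bsub>M\<^esub> U))"
      using \<chi>(2)[OF A U] hom_setD[OF \<chi>(1)[OF A U]] by (auto simp: is_iso_def)
    have \<chi>_surj: "\<exists>w. w \<in> carrier (FO (FO R P \<odot>\<^bsub>T\<^esub> FO R P') X) \<and> cpt (\<chi> P P') X w = e"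
      if P: "P \<in> fp_objects C" "P' \<in> fp_objects C" and e: "e \<in> carrier (FO (ext (P \<odot>\<^bsub>M\<^esub> P')) X)" for P P' e
    proof -
      obtain \<kappa> where \<kappa>: "\<kappa> \<in> hom_set ?fun (FO R (P \<odot>\<^bsub>M\<^esub> P')) (FO R P \<odot>\<^bsub>T\<^esub> FO R P')"
        "\<chi> P P' \<cdot>\<^bsub>?fun\<^esub> \<kappa> = Ident ?fun (FO R (P \<odot>\<^bsub>M\<^esub> P'))"
        using \<chi>(2)[OF P] hom_setD[OF \<chi>(1)[OF P]] by (auto simp: is_iso_def)
      have e': "e \<in> carrier (FO (FO R (P \<odot>\<^bsub>M\<^esub> P')) X)"
        using e R_value[OF fp_tensor[OF P]] by simp
      show ?thesis
        using fun_closed[OF \<kappa>(1) e'] fun_comp[OF \<kappa>(1) e', of "\<chi> P P'"] \<kappa>(2) fun_ident[OF e'] by auto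
    qed
    \<comment> \<open>The element of \<open>R A \<otimes> R U\<close> at \<open>X\<close> that corresponds to \<open>h\<close>.\<close>
    define z where "z = cpt \<nu> X (comparison (A \<odot>\<^bsub>M\<^esub> U) h)"
    have h': "comparison (A \<odot>\<^bsub>M\<^esub> U) h \<in> carrier (FO (FO R (A \<odot>\<^bsub>M\<^esub> U)) X)"
      using comparison_closed[OF fp_tensor[OF A U] h] R_value[OF fp_tensor[OF A U]] by simp
    have \<chi>z: "cpt (\<chi> A U) X z = comparison (A \<odot>\<^bsub>M\<^esub> U) h"
      using fun_comp[OF \<nu> h', of "\<chi> A U"] \<chi>\<nu> fun_ident[OF h'] by (simp add: z_def)
    \<comment> \<open>In terms of \<open>z\<close>, divisibility of \<open>h\<close> becomes membership in an image.\<close>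
    have divisible: "\<exists>w. w \<in> carrier (FO (FO R P \<odot>\<^bsub>T\<^esub> FO R P') X) \<and> cpt (FA R p \<boxtimes>\<^bsub>T\<^esub> FA R p') X w = z"
      if P: "P \<in> fp_objects C" "P' \<in> fp_objects C" and p: "p \<in> hom_set C A P" "p' \<in> hom_set C U P'"
        and div: "divides C (p \<boxtimes>\<^bsub>M\<^esub> p') h" for P P' p p'
    proof -
      note pp' = M.tensor_hom[OF p]
      obtain k where k: "k \<in> hom_set C (P \<odot>\<^bsub>M\<^esub> P') X" "h = k \<cdot>\<^bsub>C\<^esub> (p \<boxtimes>\<^bsub>M\<^esub> p')"
        using div hom_setD[OF pp'] hom_setD[OF h] by (auto simp: divides_def)
      obtain w where w: "w \<in> carrier (FO (FO R P \<odot>\<^bsub>T\<^esub> FO R P') X)"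
        "cpt (\<chi> P P') X w = comparison (P \<odot>\<^bsub>M\<^esub> P') k"
        using \<chi>_surj[OF P comparison_closed[OF fp_tensor[OF P] k(1)]] by blast
      note Rpp' = T.tensor_hom[OF R_hom[OF A P(1) p(1)] R_hom[OF U P(2) p(2)]]
      let ?v = "cpt (FA R p \<boxtimes>\<^bsub>T\<^esub> FA R p') X w"
      have "cpt (\<chi> A U) X ?v = cpt (FA R (p \<boxtimes>\<^bsub>M\<^esub> p')) X (comparison (P \<odot>\<^bsub>M\<^esub> P') k)"
        using fun_comp[OF Rpp' w(1), of "\<chi> A U"] fun_comp[OF \<chi>(1)[OF P] w(1), of "FA R (p \<boxtimes>\<^bsub>M\<^esub> p')"]
          \<chi>_natural[OF P p] w(2) by simp
      also have "\<dots> = comparison (A \<odot>\<^bsub>M\<^esub> U) h"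
        using R_at[OF fp_tensor[OF A U] fp_tensor[OF P] pp' k(1)] k(2) by simp
      finally have "cpt \<nu> X (cpt (\<chi> A U) X ?v) = z"
        by (simp add: z_def)
      then have "?v = z"
        using fun_closed[OF Rpp' w(1)] fun_comp[OF \<chi>(1)[OF A U] fun_closed[OF Rpp' w(1)], of \<nu>] \<nu>\<chi> fun_ident
        by simp
      with w(1) show ?thesis by blast
    qed
    obtain x where x: "x \<in> carrier (FO (FO R B \<odot>\<^bsub>T\<^esub> FO R U) X)"
      "cpt (FA R f \<boxtimes>\<^bsub>T\<^esub> Ident ?fun (FO R U)) X x = z"
      using divisible[OF B U f id(2) fh] R_ident[OF U] by auto
    obtain y where y: "y \<in> carrier (FO (FO R A \<odot>\<^bsub>T\<^esub> FO R V) X)"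
      "cpt (Ident ?fun (FO R A) \<boxtimes>\<^bsub>T\<^esub> FA R g) X y = z"
      using divisible[OF A V id(1) g gh] R_ident[OF A] by auto
    obtain w where w: "w \<in> carrier (FO (FO R B \<odot>\<^bsub>T\<^esub> FO R V) X)" "cpt (FA R f \<boxtimes>\<^bsub>T\<^esub> FA R g) X w = z"
      by (rule exact_tensor_image_intersection[OF universe T[unfolded fun_cat] assms(13)[unfolded fun_cat]
            R_hom[OF A B f, unfolded fun_cat] R_hom[OF U V g, unfolded fun_cat] XS
            x(1) x(2)[unfolded fun_cat] y(1) y(2)[unfolded fun_cat]])
    \<comment> \<open>Back to arrows of \<open>C\<close>: the preimage \<open>w\<close> corresponds to the required quotient of \<open>h\<close>.\<close>
    note fg = M.tensor_hom[OF f g]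
    note Rfg = T.tensor_hom[OF R_hom[OF A B f] R_hom[OF U V g]]
    have "cpt (\<chi> B V) X w \<in> carrier (FO (ext (B \<odot>\<^bsub>M\<^esub> V)) X)"
      using fun_closed[OF \<chi>(1)[OF B V] w(1)] R_value[OF fp_tensor[OF B V]] by simp
    then obtain k where k: "k \<in> hom_set C (B \<odot>\<^bsub>M\<^esub> V) X" "comparison (B \<odot>\<^bsub>M\<^esub> V) k = cpt (\<chi> B V) X w"
      by (rule comparison_surj[OF fp_tensor[OF B V] X])
    have "comparison (A \<odot>\<^bsub>M\<^esub> U) (k \<cdot>\<^bsub>C\<^esub> (f \<boxtimes>\<^bsub>M\<^esub> g)) = cpt (FA R (f \<boxtimes>\<^bsub>M\<^esub> g)) X (cpt (\<chi> B V) X w)"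
      using R_at[OF fp_tensor[OF A U] fp_tensor[OF B V] fg k(1)] k(2) by simp
    also have "\<dots> = cpt (\<chi> A U) X z"
      using fun_comp[OF \<chi>(1)[OF B V] w(1), of "FA R (f \<boxtimes>\<^bsub>M\<^esub> g)"] fun_comp[OF Rfg w(1), of "\<chi> A U"]
        \<chi>_natural[OF B V f g] w(2) by simp
    finally have "k \<cdot>\<^bsub>C\<^esub> (f \<boxtimes>\<^bsub>M\<^esub> g) = h"
      using inj_onD[OF comparison_inj[OF fp_tensor[OF A U] X]] M.comp_hom[OF fg k(1)] h \<chi>z by simp
    then show "divides C (f \<boxtimes>\<^bsub>M\<^esub> g) h"
      using k(1) hom_setD[OF fg] hom_setD[OF h] by (auto simp: divides_def)
  qed
qed

end
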